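(* For every fixed integer $l\ge 3$ and every $\eta>0$ there is a constant $c=c(\eta,l)>0$ such that for every positive integer $m$ and every $p\in[0,1]$, $$\mathbb{P}\big(\xi_l>(1+\eta)\,\mathbb{E}\xi_l\big)<\exp\!\big[-c\,\min\{m^2p^2\ln(1/p),\;m^lp^l\}\big],$$ where $\xi_l$ is the number of copies of the $l$-cycle $C_l$ in the random graph $G(m,p)$.
   Context: $G(m,p)$ is the Erdős–Rényi random graph on $m$ labelled vertices in which each of the $\binom m2$ possible edges is present independently with probability $p$. A copy of $C_l$ in a graph $G$ is a (not necessarily induced) subgraph of $G$ isomorphic to the cycle $C_l$ of length $l$. At $p=0$ the expression $p^2\ln(1/p)$ is interpreted as $0$. *)

theory Defs
  imports "HOL-Probability.Probability"
begin

text \<open>A graph is a pair of a vertex set and a set of edges, each edge being a two-element set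
  of vertices.\<close>

type_synonym 'a graph = "'a set \<times> 'a set set"

definition verts :: "'a graph \<Rightarrow> 'a set" where
  "verts G = fst G"

definition edges :: "'a graph \<Rightarrow> 'a set set" where
  "edges G = snd G"

definition all_edges :: "'a set \<Rightarrow> 'a set set" where
  "all_edges V = {e. e \<subseteq> V \<and> card e = 2}"

definition simple_graph :: "'a graph \<Rightarrow> bool" where
  "simple_graph G \<longleftrightarrow> edges G \<subseteq> all_edges (verts G)"

definition subgraph :: "'a graph \<Rightarrow> 'a graph \<Rightarrow> bool" where
  "subgraph H G \<longleftrightarrow> simple_graph H \<and> verts H \<subseteq> verts G \<and> edges H \<subseteq> edges G"

definition isomorphic :: "'a graph \<Rightarrow> 'b graph \<Rightarrow> bool" where
  "isomorphic G H \<longleftrightarrow>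
     (\<exists>f. bij_betw f (verts G) (verts H) \<and>
          (\<forall>u\<in>verts G. \<forall>v\<in>verts G. {u, v} \<in> edges G \<longleftrightarrow> {f u, f v} \<in> edges H))"

text \<open>For \<open>l \<ge> 3\<close> this is the cycle of length \<open>l\<close>; smaller values give degenerate edges or
  a single edge.\<close>

definition cycle_graph :: "nat \<Rightarrow> nat graph" where
  "cycle_graph l = ({..<l}, {{i, Suc i mod l} | i. i < l})"

text \<open>Copies are unlabelled: each subgraph is counted once, regardless of how many isomorphisms
  there are. Subgraphs of a finite graph form a finite set, so \<open>card\<close> is a genuine count below.\<close>

definition copies :: "'a graph \<Rightarrow> 'b graph \<Rightarrow> 'b graph set" where
  "copies F G = {H. subgraph H G \<and> isomorphic F H}"

definition num_cycles :: "nat \<Rightarrow> 'a graph \<Rightarrow> nat" where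
  "num_cycles l G = card (copies (cycle_graph l) G)"

text \<open>The random graph \<open>G(m,p)\<close>: one independent coin flip for each of the potential edges.
  The argument \<open>False\<close> is only the value that \<open>Pi_pmf\<close> assigns outside its index set.\<close>

definition random_graph :: "nat \<Rightarrow> real \<Rightarrow> nat graph pmf" where
  "random_graph m p =
     map_pmf (\<lambda>present. ({..<m}, {e \<in> all_edges {..<m}. present e}))
       (Pi_pmf (all_edges {..<m}) False (\<lambda>_. bernoulli_pmf p))"

end

(* The proof follows the method of Harel, Mousset and Samotij: high moments restricted to the event
   that no "seed" is present.  Let w(I) be the expected number of cycles given that the edge set I
   is present, let q = m p, and take n to be a small multiple of min (q^2 ln(1/p)) (q^l).  Call I a
   seed if it has at most l n edges and w(I) > (1 + eta/2) w({}).  Expanding the n-th moment one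
   cycle at a time shows that, off the event that the graph contains a seed, this moment is at most
   ((1 + eta/2) w({}))^n, so Markov's inequality bounds the tail there by a geometric term.  Greedy
   deletion of edges turns a seed into a core: a set all of whose edges contribute substantially to
   w.  Estimates of weighted walks show that a core has at least of order q^2 edges, and that each
   of its edges either has an endpoint of degree nearly m, or endpoints of degree at least 2 whose
   degrees have product nearly q^2; when q is below a small power of 1/p, each edge lies instead in
   two cycles of the core, so the core has fewer vertices than edges by a constant factor.  Both
   structures are rare enough for a union bound over all cores.  To avoid logarithms all quantities
   are compared with powers of H, where p = 1 / H^(12 l^2 (2 l + 5)). *)
theory Submission
  imports Defs
begin

section \<open>Cycles as edge sets\<close>

text \<open>Why counting alone fails: a core may have about q^2 edges, and choosing k of that order
  among the m^2 / 2 pairs gives, up to constant powers, p^(-2k) sets, far too many for p^k.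
  Structure has to recover the rest and may lose powers of H while doing so: a factor 1/H per edge
  over at least \<epsilon> q^2 edges is exp (-(\<epsilon>/J) q^2 ln (1/p)) when p = H^(-J). The
  exponent J = 12 l^2 (2l + 5) is 4l times 3l(2l + 5), as the dense cores need, and 4 times 3l^2(2l
  + 5), as the degree structure needs; the two ranges of q meet at H^(2l + 5). Both terms of
  \<Lambda> = min (q^2 ln (1/p)) (q^l) enter through the deletion threshold: an edge whose removal
  costs an equal share, among l n edges, of a quarter of \<eta> times the mean has cycles of weight
  at least 4 q^l / \<Lambda> through it, hence at least 4 and at least 4 q^(l-2) / H. H must be
  large, so p must be small. For p bounded below there are no seeds at all, and for \<Lambda>
  bounded the first-moment Markov inequality suffices.\<close>

definition cyc :: "'a list \<Rightarrow> 'a set set" where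
  "cyc zs = (\<lambda>i. {zs ! i, zs ! (Suc i mod length zs)}) ` {..<length zs}"

text \<open>As edge sets, cycles are counted once each, the presence of one is plain inclusion, and
  \<open>p ^ card (\<alpha> - I)\<close> is its conditional probability given
  \<open>I\<close>.\<close>

definition cycles :: "nat \<Rightarrow> 'a set \<Rightarrow> 'a set set set" where
  "cycles l V = cyc ` {zs. distinct zs \<and> length zs = l \<and> set zs \<subseteq> V}"

lemma finite_all_edges: "finite V \<Longrightarrow> finite (all_edges V)"
  unfolding all_edges_def by (rule finite_subset[of _ "Pow V"]) auto

lemma all_edgesE:
  assumes "e \<in> all_edges V"
  obtains u v where "e = {u, v}" "u \<noteq> v" "u \<in> V" "v \<in> V"
  using assms unfolding all_edges_def by (auto simp: card_2_iff)

lemma finite_cycles: "finite V \<Longrightarrow> finite (cycles l V)"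
proof -
  assume "finite V"
  then have "finite {zs. set zs \<subseteq> V \<and> length zs = l}"
    by (rule finite_lists_length_eq)
  then have "finite {zs. distinct zs \<and> length zs = l \<and> set zs \<subseteq> V}"
    by (rule rev_finite_subset) auto
  then show ?thesis
    unfolding cycles_def by simp
qed

lemma Suc_mod_neq: "i < l \<Longrightarrow> 2 \<le> l \<Longrightarrow> Suc i mod l \<noteq> i" for i l :: nat
  by (cases "Suc i = l") auto

lemma cyc_subset_all_edges:
  assumes "distinct zs" "2 \<le> length zs" "set zs \<subseteq> V"
  shows "cyc zs \<subseteq> all_edges V"
proof
  fix e assume "e \<in> cyc zs"
  then obtain i where i: "i < length zs" "e = {zs ! i, zs ! (Suc i mod length zs)}"
    unfolding cyc_def by auto
  have j: "Suc i mod length zs < length zs"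
    using assms(2) by (intro mod_less_divisor) auto
  have "zs ! i \<noteq> zs ! (Suc i mod length zs)"
    using Suc_mod_neq[OF i(1) assms(2)] assms(1) i(1) j by (simp add: nth_eq_iff_index_eq)
  then show "e \<in> all_edges V"
    using i j assms(3) unfolding all_edges_def by (auto simp: subset_eq)
qed

lemma cycles_subset_all_edges:
  assumes "\<alpha> \<in> cycles l V" "2 \<le> l"
  shows "\<alpha> \<subseteq> all_edges V"
  using assms cyc_subset_all_edges unfolding cycles_def by auto

lemma card_cycles_le:
  assumes "\<alpha> \<in> cycles l V"
  shows "card \<alpha> \<le> l"
proof -
  obtain zs where "\<alpha> = cyc zs" "length zs = l"
    using assms unfolding cycles_def by auto
  then show ?thesis
    unfolding cyc_def using card_image_le[of "{..<l}"] by force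
qed

text \<open>Two indices can share an edge only by running through it in opposite directions; then
  each is the cyclic successor of the other, which length 3 rules out.\<close>

lemma inj_on_cyc_edge:
  assumes "distinct zs" "3 \<le> length zs"
  shows "inj_on (\<lambda>i. {zs ! i, zs ! (Suc i mod length zs)}) {..<length zs}"
proof (rule inj_onI)
  fix i j assume ij: "i \<in> {..<length zs}" "j \<in> {..<length zs}"
    and eq: "{zs ! i, zs ! (Suc i mod length zs)} = {zs ! j, zs ! (Suc j mod length zs)}"
  let ?l = "length zs"
  have m: "Suc i mod ?l < ?l" "Suc j mod ?l < ?l"
    using assms(2) by (auto intro!: mod_less_divisor)
  from eq have "zs ! i = zs ! j \<or> (zs ! i = zs ! (Suc j mod ?l) \<and> zs ! (Suc i mod ?l) = zs ! j)"
    by (auto simp: doubleton_eq_iff)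
  then have "i = j \<or> (i = Suc j mod ?l \<and> Suc i mod ?l = j)"
    using ij m assms(1) by (simp add: nth_eq_iff_index_eq)
  moreover have False if "i = Suc j mod ?l" "Suc i mod ?l = j"
    using that ij assms(2) by (auto simp: mod_Suc split: if_splits)
  ultimately show "i = j" by blast
qed

lemma card_cyc:
  assumes "distinct zs" "3 \<le> length zs"
  shows "card (cyc zs) = length zs"
  unfolding cyc_def using card_image[OF inj_on_cyc_edge[OF assms]] by simp

lemma Union_cyc: "zs \<noteq> [] \<Longrightarrow> \<Union> (cyc zs) = set zs"
proof -
  assume "zs \<noteq> []"
  then have "Suc i mod length zs < length zs" for i
    by simp
  then show ?thesis
    unfolding cyc_def by (auto simp: in_set_conv_nth; blast)
qed

text \<open>With \<open>cyc_rev\<close>, this lets any edge of a cycle become the closing edge of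
  the list, in either orientation.\<close>

lemma cyc_rotate: "cyc (rotate n zs) = cyc zs"
proof (induction n)
  case (Suc n)
  have "cyc (rotate1 ys) = cyc ys" for ys :: "'a list"
  proof (cases "ys = []")
    case False
    let ?l = "length ys"
    let ?f = "\<lambda>i. {ys ! i, ys ! (Suc i mod ?l)}"
    have pos: "0 < ?l" using False by simp
    have "cyc (rotate1 ys) = (\<lambda>i. ?f (Suc i mod ?l)) ` {..<?l}"
      unfolding cyc_def using pos
      by (intro image_cong) (auto simp: nth_rotate1 mod_Suc_eq)
    also have "\<dots> = ?f ` ((\<lambda>i. Suc i mod ?l) ` {..<?l})"
      by (simp add: image_image)
    also have "(\<lambda>i. Suc i mod ?l) ` {..<?l} = {..<?l}"
    proof
      show "{..<?l} \<subseteq> (\<lambda>i. Suc i mod ?l) ` {..<?l}"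
      proof
        fix j assume j: "j \<in> {..<?l}"
        show "j \<in> (\<lambda>i. Suc i mod ?l) ` {..<?l}"
        proof (cases j)
          case 0
          then show ?thesis using pos by (intro image_eqI[of _ _ "?l - 1"]) auto
        next
          case (Suc i)
          then show ?thesis using j by (intro image_eqI[of _ _ i]) auto
        qed
      qed
    qed (use pos in auto)
    finally show ?thesis unfolding cyc_def .
  qed (simp add: cyc_def)
  then show ?case using Suc by simp
qed simp

text \<open>The edges of the path along the list, that is \<open>cyc\<close> without its closing
  edge.\<close>

fun pedges :: "'a list \<Rightarrow> 'a set set" where
  "pedges (x # y # zs) = insert {x, y} (pedges (y # zs))"
| "pedges _ = {}"

lemma pedges_nth: "pedges zs = (\<lambda>i. {zs ! i, zs ! Suc i}) ` {..<length zs - 1}"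
proof (induction zs rule: pedges.induct)
  case (1 x y zs)
  have "{..<length (x # y # zs) - 1} = insert 0 (Suc ` {..<length (y # zs) - 1})"
    by (auto simp: lessThan_Suc_eq_insert_0)
  then show ?case using 1 by (simp add: image_image)
qed auto

lemma pedges_append1: "zs \<noteq> [] \<Longrightarrow> pedges (zs @ [x]) = insert {last zs, x} (pedges zs)"
  by (induction zs rule: pedges.induct) auto

lemma pedges_rev: "pedges (rev zs) = pedges zs"
proof (induction zs rule: pedges.induct)
  case (1 x y zs)
  then show ?case
    using pedges_append1[of "rev zs @ [y]" x] by (simp add: insert_commute)
qed simp_all

lemma cyc_pedges:
  assumes "zs \<noteq> []"
  shows "cyc zs = insert {last zs, hd zs} (pedges zs)"
proof -
  obtain n where n: "length zs = Suc n"
    using assms by (cases zs) auto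
  have "{..<length zs} = insert n {..<n}"
    using n by auto
  then have "cyc zs = insert {zs ! n, zs ! 0} ((\<lambda>i. {zs ! i, zs ! (Suc i mod Suc n)}) ` {..<n})"
    unfolding cyc_def using n by simp
  also have "(\<lambda>i. {zs ! i, zs ! (Suc i mod Suc n)}) ` {..<n} = (\<lambda>i. {zs ! i, zs ! Suc i}) ` {..<n}"
    by (intro image_cong) auto
  finally show ?thesis
    using n assms by (simp add: pedges_nth last_conv_nth hd_conv_nth)
qed

lemma cyc_rev: "cyc (rev zs) = cyc zs"
  by (cases "zs = []") (auto simp: cyc_pedges pedges_rev hd_rev last_rev insert_commute)

text \<open>Rotating puts the given edge in closing position, and reversing corrects its
  orientation. Cycles through an edge thereby become paths with \<open>l - 2\<close> interior
  vertices.\<close>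

lemma cycle_through_edge:
  assumes \<alpha>: "\<alpha> \<in> cycles l V" and uv: "{u, v} \<in> \<alpha>" and l: "2 \<le> l"
  shows "\<exists>xs. length xs = l - 2 \<and> distinct (u # xs @ [v]) \<and> set (u # xs @ [v]) \<subseteq> V \<and>
           \<alpha> = insert {u, v} (pedges (u # xs @ [v]))"
proof -
  obtain zs where zs: "distinct zs" "length zs = l" "set zs \<subseteq> V" "\<alpha> = cyc zs"
    using \<alpha> unfolding cycles_def by auto
  then obtain i where i: "i < l" "{u, v} = {zs ! i, zs ! (Suc i mod l)}"
    using uv unfolding cyc_def by auto
  define ys where "ys = rotate (Suc i) zs"
  have ys: "distinct ys" "length ys = l" "set ys \<subseteq> V" "\<alpha> = cyc ys"
    using zs by (auto simp: ys_def cyc_rotate simp del: rotate_Suc)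
  have hd: "hd ys = zs ! (Suc i mod l)"
    unfolding ys_def using zs(2) l by (subst hd_rotate_conv_nth) auto
  have "last ys = ys ! (l - 1)"
    using ys(2) l by (subst last_conv_nth) auto
  also have "\<dots> = zs ! ((Suc i + (l - 1)) mod l)"
    unfolding ys_def using zs(2) l by (subst nth_rotate) auto
  also have "(Suc i + (l - 1)) mod l = i"
    using i l by simp
  finally have last: "last ys = zs ! i" .
  obtain ws where ws: "distinct ws" "length ws = l" "set ws \<subseteq> V" "\<alpha> = cyc ws"
      "hd ws = u" "last ws = v"
  proof (cases "u = hd ys")
    case True
    then have "last ys = v" using i(2) hd last by (auto simp: doubleton_eq_iff)
    then show ?thesis using that[of ys] True ys by simp
  next
    case False
    then have "u = last ys" "v = hd ys" using i(2) hd last by (auto simp: doubleton_eq_iff)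
    then show ?thesis using that[of "rev ys"] ys by (simp add: cyc_rev hd_rev last_rev)
  qed
  obtain xs where "ws = u # xs @ [v]"
  proof (cases ws)
    case (Cons a as)
    then have "as \<noteq> []" using ws(2) l by auto
    then have "as = butlast as @ [last as]" by simp
    then show ?thesis
      using that[of "butlast as"] Cons ws(5,6) \<open>as \<noteq> []\<close> by auto
  qed (use ws(2) l in simp)
  then show ?thesis
    using ws l by (intro exI[of _ xs]) (auto simp: cyc_pedges insert_commute)
qed

text \<open>A cycle determines its vertex set, so at most l^l lists produce it. The number of lists
  is a falling factorial, at least (n - l + 1)^l, and n <= l (n - l + 1). The order n^l is all that
  matters later.\<close>

lemma card_cycles_ge:
  assumes "finite V" "1 \<le> l" "l \<le> card V"
  shows "(real (card V) / (real l)\<^sup>2) ^ l \<le> real (card (cycles l V))"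
proof -
  let ?Z = "{zs. length zs = l \<and> distinct zs \<and> set zs \<subseteq> V}"
  let ?n = "card V"
  have finZ: "finite ?Z"
    by (rule finite_subset[OF _ finite_lists_length_eq[OF assms(1), of l]]) auto
  have C: "cycles l V = cyc ` ?Z"
    unfolding cycles_def by (rule arg_cong[where f = "(`) cyc"]) auto
  have fib: "card {zs \<in> ?Z. cyc zs = \<alpha>} \<le> l ^ l" if \<alpha>: "\<alpha> \<in> cyc ` ?Z" for \<alpha>
  proof -
    obtain ws where ws: "ws \<in> ?Z" "\<alpha> = cyc ws" using \<alpha> by blast
    then have U: "\<Union> \<alpha> = set ws" using assms(2) by (subst ws(2), subst Union_cyc) auto
    have "set zs = set ws" if "zs \<in> ?Z" "cyc zs = \<alpha>" for zs
      using U Union_cyc[of zs] that assms(2) by (cases "zs = []") auto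
    then have "{zs \<in> ?Z. cyc zs = \<alpha>} \<subseteq> {zs. set zs \<subseteq> set ws \<and> length zs = l}"
      by blast
    then have "card {zs \<in> ?Z. cyc zs = \<alpha>} \<le> card {zs. set zs \<subseteq> set ws \<and> length zs = l}"
      by (intro card_mono finite_lists_length_eq) auto
    also have "\<dots> = card (set ws) ^ l" by (simp add: card_lists_length_eq)
    also have "card (set ws) = l" using ws by (simp add: distinct_card)
    finally show ?thesis .
  qed
  have "card ?Z = (\<Sum>\<alpha>\<in>cyc ` ?Z. card {zs \<in> ?Z. cyc zs = \<alpha>})"
    using sum.image_gen[OF finZ, of "\<lambda>_. 1::nat" cyc] by simp
  also have "\<dots> \<le> (\<Sum>\<alpha>\<in>cyc ` ?Z. l ^ l)"
    by (intro sum_mono fib)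
  finally have 1: "card ?Z \<le> card (cycles l V) * l ^ l"
    by (simp add: C)
  have "card ?Z = \<Prod>{?n - l + 1..?n}"
    by (rule card_lists_distinct_length_eq) fact+
  also have "(?n - l + 1) ^ l \<le> \<Prod>{?n - l + 1..?n}"
  proof -
    have "(\<Prod>i\<in>{?n - l + 1..?n}. ?n - l + 1) \<le> \<Prod>{?n - l + 1..?n}"
      by (intro prod_mono) auto
    then show ?thesis using assms(3) by simp
  qed
  finally have 2: "(?n - l + 1) ^ l \<le> card (cycles l V) * l ^ l"
    using 1 by (metis le_trans)
  have "real ?n \<le> real l * real (?n - l + 1)"
  proof -
    obtain d where d: "?n = l + d" using assms(3) le_Suc_ex by blast
    have "real d \<le> real l * real d" using assms(2) by (simp add: mult_le_cancel_right1)
    then show ?thesis unfolding d by (simp add: algebra_simps)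
  qed
  then have "(real ?n / real l) ^ l \<le> real (?n - l + 1) ^ l"
    using assms(2) by (intro power_mono) (auto simp: field_simps)
  also have "\<dots> \<le> real (card (cycles l V)) * real l ^ l"
    using 2 by (metis of_nat_le_iff of_nat_mult of_nat_power)
  finally show ?thesis
    using assms(2) by (simp add: power_divide field_simps power2_eq_square power_mult_distrib)
qed

text \<open>A copy of the cycle has no isolated vertex, so it is recovered from its edge set, and
  \<open>edges\<close> is a bijection between the two families.\<close>

lemma num_cycles_eq:
  fixes V :: "'a set"
  assumes l: "3 \<le> l" and g: "g \<subseteq> all_edges V"
  shows "num_cycles l (V, g) = card {\<alpha> \<in> cycles l V. \<alpha> \<subseteq> g}"
proof -
  let ?C = "copies (cycle_graph l) (V, g)"
  have mlt: "Suc i mod l < l" for i using l by simp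
  \<comment> \<open>The list consists of the images of 0, ..., l - 1 under the isomorphism.\<close>
  have shape: "\<exists>zs. distinct zs \<and> length zs = l \<and> verts H = set zs \<and> edges H = cyc zs"
    if H: "H \<in> ?C" for H
  proof -
    obtain f where f: "bij_betw f {..<l} (verts H)"
      and e: "\<And>u v. u < l \<Longrightarrow> v < l \<Longrightarrow>
        {u, v} \<in> edges (cycle_graph l) \<longleftrightarrow> {f u, f v} \<in> edges H"
      using H unfolding copies_def isomorphic_def cycle_graph_def verts_def edges_def by auto
    have sH: "edges H \<subseteq> all_edges (verts H)"
      using H unfolding copies_def subgraph_def simple_graph_def by auto
    let ?zs = "map f [0..<l]"
    have set: "set ?zs = verts H"
      using f by (simp add: bij_betw_def atLeast0LessThan)
    have "edges H = cyc ?zs"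
    proof
      show "edges H \<subseteq> cyc ?zs"
      proof
        fix x assume x: "x \<in> edges H"
        then obtain a b where ab: "x = {a, b}" "a \<in> verts H" "b \<in> verts H"
          using sH by (meson all_edgesE subsetD)
        then obtain u v where uv: "u < l" "v < l" "a = f u" "b = f v"
          using f unfolding bij_betw_def by (metis imageE lessThan_iff)
        then have "{u, v} \<in> edges (cycle_graph l)"
          using e x ab by simp
        then obtain i where i: "i < l" "{u, v} = {i, Suc i mod l}"
          unfolding cycle_graph_def edges_def by auto
        have "x = f ` {u, v}"
          using ab uv by simp
        then have "x = f ` {i, Suc i mod l}"
          using i by simp
        then have "x = {?zs ! i, ?zs ! (Suc i mod length ?zs)}"
          using i mlt by simp
        then show "x \<in> cyc ?zs"
          unfolding cyc_def using i by (intro image_eqI[of _ _ i]) auto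
      qed
      show "cyc ?zs \<subseteq> edges H"
      proof
        fix x assume "x \<in> cyc ?zs"
        then obtain i where i: "i < l" "x = {f i, f (Suc i mod l)}"
          unfolding cyc_def using mlt by auto
        have "{i, Suc i mod l} \<in> edges (cycle_graph l)"
          unfolding cycle_graph_def edges_def using i by auto
        then show "x \<in> edges H"
          using e[of i "Suc i mod l"] i mlt by simp
      qed
    qed
    then show ?thesis
      using f set by (intro exI[of _ ?zs]) (auto simp: bij_betw_def distinct_map atLeast0LessThan)
  qed
  have "bij_betw edges ?C {\<alpha> \<in> cycles l V. \<alpha> \<subseteq> g}"
    unfolding bij_betw_def
  proof
    show "inj_on edges ?C"
    proof (rule inj_onI)
      fix H H' assume HH: "H \<in> ?C" "H' \<in> ?C" "edges H = edges H'"
      have "verts K = \<Union> (edges K)" if K: "K \<in> ?C" for K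
      proof -
        obtain zs where "length zs = l" "verts K = set zs" "edges K = cyc zs"
          using shape[OF K] by blast
        moreover have "zs \<noteq> []" using calculation(1) l by auto
        ultimately show ?thesis by (simp add: Union_cyc)
      qed
      then have "verts H = verts H'" using HH by simp
      then show "H = H'" using HH(3) unfolding verts_def edges_def by (simp add: prod_eq_iff)
    qed
    show "edges ` ?C = {\<alpha> \<in> cycles l V. \<alpha> \<subseteq> g}"
    proof
      show "edges ` ?C \<subseteq> {\<alpha> \<in> cycles l V. \<alpha> \<subseteq> g}"
      proof
        fix \<alpha> assume "\<alpha> \<in> edges ` ?C"
        then obtain H where H: "H \<in> ?C" "\<alpha> = edges H" by auto
        then have "verts H \<subseteq> V" "edges H \<subseteq> g"
          unfolding copies_def subgraph_def by (auto simp: verts_def edges_def)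
        then show "\<alpha> \<in> {\<alpha> \<in> cycles l V. \<alpha> \<subseteq> g}"
          using shape[OF H(1)] H(2) unfolding cycles_def by auto
      qed
      show "{\<alpha> \<in> cycles l V. \<alpha> \<subseteq> g} \<subseteq> edges ` ?C"
      proof
        fix \<alpha> assume "\<alpha> \<in> {\<alpha> \<in> cycles l V. \<alpha> \<subseteq> g}"
        then obtain zs where zs: "distinct zs" "length zs = l" "set zs \<subseteq> V" "\<alpha> = cyc zs" "\<alpha> \<subseteq> g"
          unfolding cycles_def by auto
        have bij: "bij_betw ((!) zs) {..<l} (set zs)"
          using zs by (intro bij_betw_nth) auto
        have "{u, v} \<in> edges (cycle_graph l) \<longleftrightarrow> {zs ! u, zs ! v} \<in> cyc zs" if "u < l" "v < l" for u v
        proof -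
          have "{zs ! u, zs ! v} = {zs ! i, zs ! (Suc i mod l)} \<longleftrightarrow> {u, v} = {i, Suc i mod l}"
            if "i < l" for i
          proof -
            have "(!) zs ` {u, v} = (!) zs ` {i, Suc i mod l} \<longleftrightarrow> {u, v} = {i, Suc i mod l}"
              by (rule inj_on_image_eq_iff[OF bij_betw_imp_inj_on[OF bij]])
                (use that \<open>u < l\<close> \<open>v < l\<close> mlt in auto)
            then show ?thesis by simp
          qed
          then show ?thesis
            unfolding cycle_graph_def edges_def cyc_def using zs(2) by auto
        qed
        then have "isomorphic (cycle_graph l) (set zs, \<alpha>)"
          unfolding isomorphic_def using bij zs(4)
          by (intro exI[of _ "(!) zs"]) (auto simp: cycle_graph_def verts_def edges_def)
        moreover have "subgraph (set zs, \<alpha>) (V, g)"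
          unfolding subgraph_def simple_graph_def verts_def edges_def
          using cyc_subset_all_edges[of zs "set zs"] zs l by auto
        ultimately have "(set zs, \<alpha>) \<in> ?C"
          unfolding copies_def by simp
        then show "\<alpha> \<in> edges ` ?C"
          by (rule rev_image_eqI) (simp add: edges_def)
      qed
    qed
  qed
  then show ?thesis
    unfolding num_cycles_def by (rule bij_betw_same_card)
qed

section \<open>Weighted walks\<close>

text \<open>The parameter \<open>n\<close> counts interior vertices, so these walks have \<open>n + 1\<close> steps.\<close>

fun walks :: "'a set \<Rightarrow> ('a \<Rightarrow> 'a \<Rightarrow> real) \<Rightarrow> nat \<Rightarrow> 'a \<Rightarrow> 'a \<Rightarrow> real" where
  "walks V W 0 u v = W u v"
| "walks V W (Suc n) u v = (\<Sum>x\<in>V. W u x * walks V W n x v)"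

fun pweight :: "('a \<Rightarrow> 'a \<Rightarrow> real) \<Rightarrow> 'a list \<Rightarrow> real" where
  "pweight W (x # y # zs) = W x y * pweight W (y # zs)"
| "pweight W _ = 1"

lemma lists_Suc_eq:
  "{xs. set xs \<subseteq> V \<and> length xs = Suc n} = (\<lambda>(x, xs). x # xs) ` (V \<times> {xs. set xs \<subseteq> V \<and> length xs = n})"
  by (auto simp: length_Suc_conv image_iff)

text \<open>Vertices may repeat in these lists, which is what makes the sum an entry of the matrix
  power W^(n+1). Ignoring distinctness only enlarges the upper bounds.\<close>

lemma sum_pweight_eq_walks:
  assumes "finite V"
  shows "(\<Sum>xs | set xs \<subseteq> V \<and> length xs = n. pweight W (u # xs @ [v])) = walks V W n u v"
proof (induction n arbitrary: u)
  case 0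
  have "{xs. set xs \<subseteq> V \<and> length xs = 0} = {[]}" by auto
  then show ?case by simp
next
  case (Suc n)
  have inj: "inj_on (\<lambda>(x, xs). x # xs) (V \<times> {xs. set xs \<subseteq> V \<and> length xs = n})"
    by (auto intro: inj_onI)
  have "(\<Sum>xs | set xs \<subseteq> V \<and> length xs = Suc n. pweight W (u # xs @ [v]))
    = (\<Sum>(x, xs)\<in>V \<times> {xs. set xs \<subseteq> V \<and> length xs = n}. W u x * pweight W (x # xs @ [v]))"
    unfolding lists_Suc_eq sum.reindex[OF inj] by (simp add: case_prod_unfold)
  also have "\<dots> = (\<Sum>x\<in>V. \<Sum>xs | set xs \<subseteq> V \<and> length xs = n. W u x * pweight W (x # xs @ [v]))"
    by (rule sum.cartesian_product[symmetric])
  also have "\<dots> = walks V W (Suc n) u v"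
    using Suc by (simp add: sum_distrib_left[symmetric])
  finally show ?case .
qed

lemma walks_Suc_right:
  "walks V W (Suc n) u v = (\<Sum>y\<in>V. walks V W n u y * W y v)"
proof (induction n arbitrary: u)
  case (Suc n)
  have "walks V W (Suc (Suc n)) u v = (\<Sum>x\<in>V. W u x * (\<Sum>y\<in>V. walks V W n x y * W y v))"
    using Suc by simp
  also have "\<dots> = (\<Sum>x\<in>V. \<Sum>y\<in>V. W u x * walks V W n x y * W y v)"
    by (simp add: sum_distrib_left mult.assoc)
  also have "\<dots> = (\<Sum>y\<in>V. \<Sum>x\<in>V. W u x * walks V W n x y * W y v)"
    by (rule sum.swap)
  also have "\<dots> = (\<Sum>y\<in>V. walks V W (Suc n) u y * W y v)"
    by (simp add: sum_distrib_right)
  finally show ?case .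
qed simp

lemma pweight_mono:
  assumes "\<And>x y. 0 \<le> W x y" "\<And>x y. W x y \<le> W' x y"
  shows "pweight W zs \<le> pweight W' zs"
proof -
  have "0 \<le> pweight W zs \<and> pweight W zs \<le> pweight W' zs"
    by (induction zs rule: pedges.induct)
      (auto intro!: mult_mono assms mult_nonneg_nonneg intro: order_trans[OF assms])
  then show ?thesis by simp
qed

section \<open>Walks weighted relative to a fixed edge set\<close>

definition degree_in :: "'a set set \<Rightarrow> 'a \<Rightarrow> nat" where
  "degree_in I u = card {x. {u, x} \<in> I}"

definition adj :: "'a set set \<Rightarrow> 'a \<Rightarrow> 'a \<Rightarrow> real" where
  "adj I u v = (if {u, v} \<in> I then 1 else 0)"

text \<open>The conditional probability of an edge, given that all of \<open>I\<close> is
  present.\<close>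

definition edge_wt :: "real \<Rightarrow> 'a set set \<Rightarrow> 'a \<Rightarrow> 'a \<Rightarrow> real" where
  "edge_wt p I u v = (if {u, v} \<in> I then 1 else p)"

lemma pweight_adj: "pweight (adj I) zs = (if pedges zs \<subseteq> I then 1 else 0)"
  by (induction zs rule: pedges.induct) (auto simp: adj_def)

lemma Union_pedges: "\<Union> (pedges zs) \<subseteq> set zs"
  by (induction zs rule: pedges.induct) auto

lemma finite_pedges: "finite (pedges zs)"
  by (induction zs rule: pedges.induct) auto

text \<open>Distinct vertices make the steps distinct edges, so each edge outside \<open>I\<close>
  contributes its factor exactly once.\<close>

lemma pweight_edge_wt:
  assumes "distinct zs"
  shows "pweight (edge_wt p I) zs = p ^ card (pedges zs - I)"
  using assms
proof (induction zs rule: pedges.induct)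
  case (1 x y zs)
  have "{x, y} \<notin> pedges (y # zs)"
    using Union_pedges[of "y # zs"] 1(2) by auto
  then show ?case
    using 1 finite_pedges[of "y # zs"]
    by (auto simp: edge_wt_def insert_Diff_if card_insert_if)
qed auto

text \<open>\<open>I\<close> stands for a seed or core. \<open>Q\<close> counts walks inside
  \<open>I\<close>; \<open>F\<close> admits all walks, each step off \<open>I\<close> at price
  \<open>p\<close>, and \<open>q\<close> is the total price of one such step over all
  targets.\<close>

locale edge_subset =
  fixes V :: "'a set" and I :: "'a set set" and p :: real
  assumes finV: "finite V" and I: "I \<subseteq> all_edges V" and p0: "0 \<le> p" and p1: "p \<le> 1"
begin

abbreviation d where "d \<equiv> degree_in I"
abbreviation k where "k \<equiv> card I"
abbreviation m where "m \<equiv> card V"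
abbreviation q where "q \<equiv> real m * p"
abbreviation Q where "Q \<equiv> walks V (adj I)"
abbreviation F where "F \<equiv> walks V (edge_wt p I)"

lemma finI: "finite I"
  using I finV finite_all_edges finite_subset by blast

lemma edgeD: "{u, x} \<in> I \<Longrightarrow> u \<in> V \<and> x \<in> V \<and> u \<noteq> x"
  using I unfolding all_edges_def by (cases "u = x") auto

lemma finite_nbrs: "finite {x. {u, x} \<in> I}"
  using edgeD by (intro finite_subset[OF _ finV]) auto

lemma degree_eq_sum: "real (d u) = (\<Sum>x\<in>V. adj I u x)"
proof -
  have "(\<Sum>x\<in>V. adj I u x) = (\<Sum>x\<in>{x\<in>V. {u, x} \<in> I}. 1)"
    unfolding adj_def using finV by (simp add: sum.inter_filter[symmetric])
  also have "{x\<in>V. {u, x} \<in> I} = {x. {u, x} \<in> I}" using edgeD by auto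
  finally show ?thesis by (simp add: degree_in_def)
qed

lemma adj_commute: "adj I u v = adj I v u"
  by (simp add: adj_def insert_commute)

lemma adj_nonneg: "0 \<le> adj I u v"
  by (simp add: adj_def)

lemma adj_sq: "(adj I u v)\<^sup>2 = adj I u v"
  by (simp add: adj_def)

lemma handshake: "(\<Sum>u\<in>V. d u) = 2 * k"
proof -
  have "(\<Sum>u\<in>V. d u) = card (Sigma V (\<lambda>u. {x. {u, x} \<in> I}))"
    using finV finite_nbrs by (subst card_SigmaI) (auto simp: degree_in_def)
  also have "Sigma V (\<lambda>u. {x. {u, x} \<in> I}) = (\<Union>e\<in>I. {(u, x). {u, x} = e})"
    using edgeD by auto
  also have "card \<dots> = (\<Sum>e\<in>I. card {(u, x). {u, x} = e})"
  proof (rule card_UN_disjoint)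
    show "\<forall>e\<in>I. finite {(u, x). {u, x} = e}"
    proof
      fix e assume "e \<in> I"
      then obtain u v where "e = {u, v}" using I all_edgesE by blast
      then have "{(u, x). {u, x} = e} \<subseteq> {u, v} \<times> {u, v}" by auto
      then show "finite {(u, x). {u, x} = e}" by (rule finite_subset) auto
    qed
  qed (use finI in auto)
  also have "\<dots> = (\<Sum>e\<in>I. 2)"
  proof (rule sum.cong)
    fix e assume "e \<in> I"
    then obtain u v where "e = {u, v}" "u \<noteq> v" using I all_edgesE by blast
    moreover from this have "{(u, x). {u, x} = e} = {(u, v), (v, u)}"
      by (auto simp: doubleton_eq_iff)
    ultimately show "card {(u, x). {u, x} = e} = 2" by simp
  qed simp
  finally show ?thesis by simp
qed

lemma handshake_real: "(\<Sum>u\<in>V. real (d u)) = 2 * real k"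
  using handshake by (metis of_nat_mult of_nat_numeral of_nat_sum)

lemma degree_le_m: "d u \<le> m"
proof -
  have "{x. {u, x} \<in> I} \<subseteq> V" using edgeD by auto
  then show ?thesis unfolding degree_in_def by (intro card_mono finV)
qed

lemma degree_le_k: "d u \<le> k"
proof -
  have "inj_on (\<lambda>x. {u, x}) {x. {u, x} \<in> I}"
    by (auto intro!: inj_onI simp: doubleton_eq_iff)
  moreover have "(\<lambda>x. {u, x}) ` {x. {u, x} \<in> I} \<subseteq> I" by auto
  ultimately show ?thesis
    unfolding degree_in_def using card_inj_on_le finI by blast
qed

lemma sum_nbr_degree_le: "(\<Sum>x\<in>V. adj I u x * real (d x)) \<le> 2 * real k"
proof -
  have "(\<Sum>x\<in>V. adj I u x * real (d x)) \<le> (\<Sum>x\<in>V. real (d x))"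
    by (intro sum_mono) (simp add: adj_def)
  then show ?thesis using handshake_real by simp
qed

text \<open>Cauchy-Schwarz against the indicator of the neighbourhood, using that \<open>adj\<close>
  is idempotent.\<close>

lemma sum_nbr_sqrt_le:
  "(\<Sum>x\<in>V. adj I u x * sqrt (real (d x))) \<le> sqrt (real (d u)) * sqrt (2 * real k)"
proof -
  have "(\<Sum>x\<in>V. adj I u x * (adj I u x * sqrt (real (d x))))\<^sup>2
     \<le> (\<Sum>x\<in>V. (adj I u x)\<^sup>2) * (\<Sum>x\<in>V. (adj I u x * sqrt (real (d x)))\<^sup>2)"
    by (rule Cauchy_Schwarz_ineq_sum)
  also have "(\<Sum>x\<in>V. (adj I u x * sqrt (real (d x)))\<^sup>2) = (\<Sum>x\<in>V. adj I u x * real (d x))"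
    by (simp add: power_mult_distrib adj_sq)
  also have "(\<Sum>x\<in>V. (adj I u x)\<^sup>2) = real (d u)"
    by (simp add: adj_sq degree_eq_sum)
  also have "real (d u) * (\<Sum>x\<in>V. adj I u x * real (d x)) \<le> real (d u) * (2 * real k)"
    by (intro mult_left_mono sum_nbr_degree_le) simp
  also have "(\<Sum>x\<in>V. adj I u x * (adj I u x * sqrt (real (d x)))) = (\<Sum>x\<in>V. adj I u x * sqrt (real (d x)))"
    by (intro sum.cong) (auto simp: adj_def)
  finally show ?thesis
    by (simp add: real_le_rsqrt real_sqrt_mult[symmetric])
qed

text \<open>For one interior vertex this is Cauchy-Schwarz on common neighbours; each further step
  multiplies by at most sqrt (2k), a bound on the spectral radius of a graph with k edges.\<close>

lemma Q_le: "Q (Suc n) u v \<le> sqrt (real (d u)) * sqrt (real (d v)) * sqrt (2 * real k) ^ n"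
proof (induction n arbitrary: u)
  case 0
  have "(\<Sum>x\<in>V. adj I u x * adj I x v)\<^sup>2 \<le> (\<Sum>x\<in>V. (adj I u x)\<^sup>2) * (\<Sum>x\<in>V. (adj I x v)\<^sup>2)"
    by (rule Cauchy_Schwarz_ineq_sum)
  also have "\<dots> = real (d u) * real (d v)"
    by (simp add: adj_sq degree_eq_sum adj_commute[of _ v])
  finally show ?case
    by (simp add: real_le_rsqrt real_sqrt_mult[symmetric])
next
  case (Suc n)
  let ?s = "sqrt (2 * real k)"
  have "Q (Suc (Suc n)) u v = (\<Sum>x\<in>V. adj I u x * Q (Suc n) x v)" by simp
  also have "\<dots> \<le> (\<Sum>x\<in>V. adj I u x * (sqrt (real (d x)) * sqrt (real (d v)) * ?s ^ n))"
    by (intro sum_mono mult_left_mono Suc adj_nonneg)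
  also have "\<dots> = (\<Sum>x\<in>V. adj I u x * sqrt (real (d x))) * (sqrt (real (d v)) * ?s ^ n)"
    by (simp only: sum_distrib_right mult.assoc)
  also have "\<dots> \<le> sqrt (real (d u)) * ?s * (sqrt (real (d v)) * ?s ^ n)"
    by (intro mult_right_mono sum_nbr_sqrt_le) simp
  finally show ?case by (simp add: mult_ac)
qed

lemma edge_wt_bounds:
  "0 \<le> edge_wt p I u v" "adj I u v \<le> edge_wt p I u v" "edge_wt p I u v \<le> adj I u v + p"
  using p0 by (auto simp: edge_wt_def adj_def)

lemma walks_wt_nonneg: "0 \<le> F n u v"
  by (induction n arbitrary: u) (auto intro!: sum_nonneg mult_nonneg_nonneg edge_wt_bounds)

text \<open>A step off \<open>I\<close> has total weight at most q. A step inside \<open>I\<close>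
  is controlled on average, since 2k <= H q^2; the factor \<open>1 + d v / q\<close> records the
  last step. The induction extends walks at the end \<open>v\<close>.\<close>

lemma walk_sum_le:
  assumes H: "1 \<le> H" "2 * real k \<le> H * q\<^sup>2" and q: "0 < q"
  shows "(\<Sum>u\<in>V. F n u v) \<le> (3 * H) ^ Suc n * q ^ Suc n * (1 + real (d v) / q)"
proof (induction n arbitrary: v)
  case 0
  have "(\<Sum>u\<in>V. F 0 u v) \<le> (\<Sum>u\<in>V. adj I u v + p)"
    by (auto intro!: sum_mono edge_wt_bounds)
  also have "\<dots> = 1 * (real (d v) + q)"
    by (simp add: sum.distrib degree_eq_sum adj_commute[of _ v])
  also have "\<dots> \<le> 3 * H * (real (d v) + q)"
    using H(1) p0 by (intro mult_right_mono) auto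
  also have "\<dots> = (3 * H) ^ Suc 0 * q ^ Suc 0 * (1 + real (d v) / q)"
  proof -
    have "c * (a + r) = c * r * (1 + a / r)" if "0 < r" for a c r :: real
      using that by (simp add: field_simps)
    from this[OF q] show ?thesis by (simp only: power_Suc0_right mult.assoc)
  qed
  finally show ?case .
next
  case (Suc n)
  let ?b = "(3 * H) ^ Suc n * q ^ Suc n"
  have b: "0 \<le> ?b" using H(1) q by simp
  have mq: "real m * p = q" by simp
  have "(\<Sum>u\<in>V. F (Suc n) u v) = (\<Sum>u\<in>V. \<Sum>y\<in>V. F n u y * edge_wt p I y v)"
    by (simp only: walks_Suc_right)
  also have "\<dots> = (\<Sum>y\<in>V. (\<Sum>u\<in>V. F n u y) * edge_wt p I y v)"
    by (subst sum.swap) (simp add: sum_distrib_right)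
  also have "\<dots> \<le> (\<Sum>y\<in>V. (?b * (1 + real (d y) / q)) * (adj I y v + p))"
    by (intro sum_mono mult_mono Suc edge_wt_bounds b mult_nonneg_nonneg)
      (use q H in \<open>auto intro!: add_nonneg_nonneg divide_nonneg_nonneg\<close>)
  also have "\<dots> = ?b * ((\<Sum>y\<in>V. adj I y v) + (\<Sum>y\<in>V. adj I v y * real (d y)) / q
      + q + p * (\<Sum>y\<in>V. real (d y)) / q)"
  proof -
    have "(\<Sum>y\<in>V. b * (1 + e y / r) * (a y + c))
      = b * ((\<Sum>y\<in>V. a y) + (\<Sum>y\<in>V. a y * e y) / r + real m * c + c * (\<Sum>y\<in>V. e y) / r)"
      for a e :: "'a \<Rightarrow> real" and b c r
      by (simp add: sum.distrib sum_distrib_left sum_divide_distrib algebra_simps add_divide_distrib)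
    then show ?thesis by (simp only: adj_commute[of v])
  qed
  also have "\<dots> \<le> ?b * (real (d v) + (2 * real k) / q + q + p * (2 * real k) / q)"
    using q p0 sum_nbr_degree_le[of v] b degree_eq_sum[of v]
    by (intro mult_left_mono add_mono divide_right_mono)
      (auto simp: handshake_real adj_commute[of _ v])
  also have "\<dots> \<le> ?b * (real (d v) + H * q + H * q + H * q)"
  proof (intro mult_left_mono add_mono b)
    show 1: "2 * real k / q \<le> H * q"
      using H q by (simp add: divide_le_eq power2_eq_square mult_ac)
    have "p * (2 * real k / q) \<le> 1 * (2 * real k / q)"
      using p1 q by (intro mult_right_mono) auto
    then show "p * (2 * real k) / q \<le> H * q" using 1 by simp
    show "q \<le> H * q" using mult_right_mono[OF H(1), of q] q by simp
  qed simp
  also have "\<dots> \<le> ?b * (3 * H * (real (d v) + q))"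
  proof (intro mult_left_mono b)
    have "1 * real (d v) \<le> (3 * H) * real (d v)"
      using H(1) by (intro mult_right_mono) auto
    then show "real (d v) + H * q + H * q + H * q \<le> 3 * H * (real (d v) + q)"
      by (simp add: algebra_simps)
  qed
  also have "\<dots> = (3 * H) ^ Suc (Suc n) * q ^ Suc (Suc n) * (1 + real (d v) / q)"
    using q by (simp add: field_simps)
  finally show ?case .
qed

text \<open>\<open>F n u v - Q n u v\<close> is the weight of the walks that leave \<open>I\<close> at least once; the first step
  outside \<open>I\<close> is what produces the isolated factor \<open>p\<close>.\<close>

lemma walk_jump_le:
  assumes H: "1 \<le> H" "2 * real k \<le> H * q\<^sup>2" and q: "0 < q"
  shows "F n u v - Q n u v \<le> p * (3 * H) ^ Suc n * q ^ n * (1 + real (d u) / q) * (1 + real (d v) / q)"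
proof (induction n arbitrary: u)
  case 0
  have "F 0 u v - Q 0 u v \<le> p"
    using p0 by (simp add: edge_wt_def adj_def)
  also have "\<dots> \<le> p * ((3 * H) * ((1 + real (d u) / q) * (1 + real (d v) / q)))"
  proof -
    have "1 \<le> (1 + real (d u) / q)" "1 \<le> (1 + real (d v) / q)" "1 \<le> 3 * H"
      using q H by auto
    then have "1 * (1 * 1) \<le> (3 * H) * ((1 + real (d u) / q) * (1 + real (d v) / q))"
      using H(1) by (intro mult_mono) auto
    then have "p * 1 \<le> p * ((3 * H) * ((1 + real (d u) / q) * (1 + real (d v) / q)))"
      using p0 by (intro mult_left_mono) auto
    then show ?thesis by simp
  qed
  finally show ?case by (simp only: mult.assoc power_Suc0_right power_0 mult_1_right mult_1)
next
  case (Suc n)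
  let ?E = "\<lambda>x. 1 + real (d x) / q"
  let ?g = "p * (3 * H) ^ Suc n * q ^ n * ?E v"
  have E: "0 \<le> ?E x" for x using q by simp
  have g: "0 \<le> ?g" using q p0 H E by simp
  have "F (Suc n) u v - Q (Suc n) u v
      = (\<Sum>x\<in>V. edge_wt p I u x * F n x v - adj I u x * Q n x v)"
    by (simp add: sum_subtractf)
  also have "\<dots> \<le> (\<Sum>x\<in>V. adj I u x * (?g * ?E x) + p * F n x v)"
  proof (rule sum_mono)
    fix x
    \<comment> \<open>Either the first step already leaves \<open>I\<close>, and any walk may
      follow, or it stays in \<open>I\<close> and the departure is still to come.\<close>
    have "edge_wt p I u x * F n x v - adj I u x * Q n x v
      = (edge_wt p I u x - adj I u x) * F n x v + adj I u x * (F n x v - Q n x v)"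
      by (simp add: algebra_simps)
    also have "\<dots> \<le> p * F n x v + adj I u x * (?g * ?E x)"
      using edge_wt_bounds(3)[of u x] Suc[of x]
      by (intro add_mono mult_right_mono mult_left_mono walks_wt_nonneg adj_nonneg)
        (auto simp: mult_ac)
    finally show "edge_wt p I u x * F n x v - adj I u x * Q n x v
      \<le> adj I u x * (?g * ?E x) + p * F n x v" by simp
  qed
  also have "\<dots> = ?g * ((\<Sum>x\<in>V. adj I u x) + (\<Sum>x\<in>V. adj I u x * real (d x)) / q) + p * (\<Sum>x\<in>V. F n x v)"
  proof -
    have "(\<Sum>x\<in>V. a x * (g * (1 + b x / r)) + c * f x)
      = g * ((\<Sum>x\<in>V. a x) + (\<Sum>x\<in>V. a x * b x) / r) + c * (\<Sum>x\<in>V. f x)"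
      for a b f :: "'a \<Rightarrow> real" and g c r
      by (simp add: sum.distrib sum_distrib_left sum_divide_distrib algebra_simps)
    then show ?thesis .
  qed
  also have "\<dots> \<le> ?g * (real (d u) + 2 * real k / q) + p * ((3 * H) ^ Suc n * q ^ Suc n * ?E v)"
    using q p0 g sum_nbr_degree_le[of u] walk_sum_le[OF H q, of n v]
    by (intro add_mono mult_left_mono divide_right_mono) (auto simp: degree_eq_sum)
  also have "\<dots> \<le> ?g * (H * real (d u) + H * q) + ?g * (H * (real (d u) + q))"
  proof (intro add_mono mult_left_mono g)
    show "real (d u) \<le> H * real (d u)" using H(1) mult_right_mono[of 1 H "real (d u)"] by simp
    show "2 * real k / q \<le> H * q"
      using H q by (simp add: divide_le_eq power2_eq_square mult_ac)
    have "1 * q \<le> H * (real (d u) + q)"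
      using H(1) q by (intro mult_mono) auto
    then have "?g * q \<le> ?g * (H * (real (d u) + q))"
      using g by (intro mult_left_mono) auto
    then show "p * ((3 * H) ^ Suc n * q ^ Suc n * ?E v) \<le> ?g * (H * (real (d u) + q))"
      by (simp add: mult_ac)
  qed
  also have "\<dots> \<le> ?g * (3 * H * (real (d u) + q))"
  proof -
    have "H * real (d u) + H * q + H * (real (d u) + q) \<le> 3 * H * (real (d u) + q)"
      using H(1) q by (simp add: algebra_simps)
    from mult_left_mono[OF this g] show ?thesis by (simp only: distrib_left)
  qed
  also have "\<dots> = p * (3 * H) ^ Suc (Suc n) * q ^ Suc n * ?E u * ?E v"
  proof -
    have "(p * h * r ^ n * e) * (c * (a + r)) = p * (c * h) * (r * r ^ n) * (1 + a / r) * e"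
      if "0 < r" for h r e c a :: real
      using that by (simp add: field_simps)
    from this[OF q] show ?thesis by (simp only: power_Suc)
  qed
  finally show ?case .
qed

section \<open>Cycles through one edge, bounded by walks between its ends\<close>

context
  fixes l :: nat
  assumes l: "3 \<le> l"
begin

definition through :: "'a \<Rightarrow> 'a \<Rightarrow> 'a set set set" where
  "through u v = {\<alpha> \<in> cycles l V. {u, v} \<in> \<alpha>}"

lemma finite_through: "finite (through u v)"
  unfolding through_def using finite_cycles[OF finV] by simp

text \<open>Passes from cycles to vertex lists. Several lists may give the same cycle and the range
  of lists is enlarged; both only increase a nonnegative sum. \<open>P\<close> selects the cycles
  inside \<open>I\<close>, those not inside, or all of them.\<close>

lemma sum_through_le:
  fixes f :: "'a set set \<Rightarrow> real"
  assumes uv: "{u, v} \<in> I" and nn: "\<And>xs. 0 \<le> h xs"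
    and f: "\<And>xs. distinct (u # xs @ [v]) \<Longrightarrow> P (insert {u, v} (pedges (u # xs @ [v]))) \<Longrightarrow>
      f (insert {u, v} (pedges (u # xs @ [v]))) \<le> h xs"
    and f0: "\<And>\<alpha>. 0 \<le> f \<alpha>"
  shows "(\<Sum>\<alpha> | \<alpha> \<in> through u v \<and> P \<alpha>. f \<alpha>) \<le> (\<Sum>xs | set xs \<subseteq> V \<and> length xs = l - 2. h xs)"
proof -
  define c where "c = (\<lambda>xs. insert {u, v} (pedges (u # xs @ [v])))"
  let ?X = "{xs. set xs \<subseteq> V \<and> length xs = l - 2}"
  let ?Y = "{xs \<in> ?X. distinct (u # xs @ [v]) \<and> P (c xs)}"
  have finX: "finite ?X" by (rule finite_lists_length_eq[OF finV])
  have "{\<alpha> \<in> through u v. P \<alpha>} \<subseteq> c ` ?Y"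
  proof
    fix \<alpha> assume "\<alpha> \<in> {\<alpha> \<in> through u v. P \<alpha>}"
    then have \<alpha>: "\<alpha> \<in> cycles l V" "{u, v} \<in> \<alpha>" "P \<alpha>" by (auto simp: through_def)
    from cycle_through_edge[OF this(1,2)] l
    obtain xs where "length xs = l - 2" "distinct (u # xs @ [v])" "set (u # xs @ [v]) \<subseteq> V"
        "\<alpha> = c xs" unfolding c_def by auto
    then show "\<alpha> \<in> c ` ?Y" using \<alpha>(3) by (intro image_eqI[of _ _ xs]) auto
  qed
  then have "(\<Sum>\<alpha> | \<alpha> \<in> through u v \<and> P \<alpha>. f \<alpha>) \<le> sum f (c ` ?Y)"
    using f0 by (intro sum_mono2 finite_imageI finite_subset[OF _ finX]) auto
  also have "\<dots> \<le> sum (f \<circ> c) ?Y"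
    using f0 by (intro sum_image_le finite_subset[OF _ finX]) auto
  also have "\<dots> \<le> sum h ?Y"
    by (intro sum_mono) (use f in \<open>auto simp: c_def\<close>)
  also have "\<dots> \<le> sum h ?X"
    using nn by (intro sum_mono2 finX) auto
  finally show ?thesis .
qed

lemma card_through_inside_le:
  assumes uv: "{u, v} \<in> I"
  shows "real (card {\<alpha> \<in> through u v. \<alpha> \<subseteq> I}) \<le> Q (l - 2) u v"
proof -
  have "real (card {\<alpha> \<in> through u v. \<alpha> \<subseteq> I}) = (\<Sum>\<alpha> | \<alpha> \<in> through u v \<and> \<alpha> \<subseteq> I. 1)"
    by simp
  also have "\<dots> \<le> (\<Sum>xs | set xs \<subseteq> V \<and> length xs = l - 2. pweight (adj I) (u # xs @ [v]))"
    by (rule sum_through_le[OF uv]) (auto simp: pweight_adj)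
  finally show ?thesis by (simp add: sum_pweight_eq_walks[OF finV])
qed

text \<open>For a path leaving \<open>I\<close> the \<open>adj\<close> weight vanishes, so the
  difference of the two path weights is the wanted power of \<open>p\<close>; on all other lists the
  difference is still nonnegative.\<close>

lemma sum_through_outside_le:
  assumes uv: "{u, v} \<in> I"
  shows "(\<Sum>\<alpha> | \<alpha> \<in> through u v \<and> \<not> \<alpha> \<subseteq> I. p ^ card (\<alpha> - I)) \<le> F (l - 2) u v - Q (l - 2) u v"
proof -
  have "(\<Sum>\<alpha> | \<alpha> \<in> through u v \<and> \<not> \<alpha> \<subseteq> I. p ^ card (\<alpha> - I))
    \<le> (\<Sum>xs | set xs \<subseteq> V \<and> length xs = l - 2.
        pweight (edge_wt p I) (u # xs @ [v]) - pweight (adj I) (u # xs @ [v]))"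
  proof (rule sum_through_le[OF uv])
    show "0 \<le> pweight (edge_wt p I) (u # xs @ [v]) - pweight (adj I) (u # xs @ [v])" for xs
      using pweight_mono[of "adj I" "edge_wt p I" "u # xs @ [v]"] adj_nonneg edge_wt_bounds
      by simp
  next
    fix xs
    assume xs: "distinct (u # xs @ [v])" "\<not> insert {u, v} (pedges (u # xs @ [v])) \<subseteq> I"
    then show "p ^ card (insert {u, v} (pedges (u # xs @ [v])) - I)
      \<le> pweight (edge_wt p I) (u # xs @ [v]) - pweight (adj I) (u # xs @ [v])"
      using uv by (simp only: pweight_edge_wt pweight_adj insert_Diff1 insert_subset) simp
  qed (use p0 in simp)
  then show ?thesis
    by (simp add: sum_subtractf sum_pweight_eq_walks[OF finV])
qed

text \<open>The trivial bound, sufficient when \<open>p\<close> is bounded below.\<close>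

lemma card_through_le:
  assumes uv: "{u, v} \<in> I"
  shows "real (card (through u v)) \<le> real m ^ (l - 2)"
proof -
  have "real (card (through u v)) = (\<Sum>\<alpha> | \<alpha> \<in> through u v \<and> True. 1)"
    by simp
  also have "\<dots> \<le> (\<Sum>xs | set xs \<subseteq> V \<and> length xs = l - 2. 1)"
    by (rule sum_through_le[OF uv]) auto
  finally show ?thesis using card_lists_length_eq[OF finV] by simp
qed

lemma degree_ge_2:
  assumes "\<alpha> \<in> through u v" "\<alpha> \<subseteq> I"
  shows "2 \<le> d u"
proof -
  from assms(1) have "\<alpha> \<in> cycles l V" "{u, v} \<in> \<alpha>" by (auto simp: through_def)
  from cycle_through_edge[OF this] l
  obtain xs where xs: "length xs = l - 2" "distinct (u # xs @ [v])"
      "\<alpha> = insert {u, v} (pedges (u # xs @ [v]))" by auto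
  then obtain y ys where y: "xs = y # ys"
    using l by (cases xs) auto
  have "{u, y} \<in> I" "{u, v} \<in> I" "y \<noteq> v" using xs y assms(2) by auto
  then have "card {y, v} \<le> d u"
    unfolding degree_in_def by (intro card_mono finite_nbrs) auto
  then show ?thesis using \<open>y \<noteq> v\<close> by simp
qed

end

end

section \<open>Counting by subset sums, and density\<close>

lemma sum_Pow_power:
  fixes y :: real
  assumes "finite E"
  shows "(\<Sum>X\<in>Pow E. y ^ card X) = (1 + y) ^ card E"
  using assms
proof (induction E rule: finite_induct)
  case (insert x E)
  have inj: "inj_on (insert x) (Pow E)"
    using insert(2) by (auto intro!: inj_onI)
  have "(\<Sum>X\<in>Pow (insert x E). y ^ card X)
      = (\<Sum>X\<in>Pow E. y ^ card X) + (\<Sum>X\<in>insert x ` Pow E. y ^ card X)"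
    unfolding Pow_insert using insert(1,2) by (intro sum.union_disjoint) auto
  also have "(\<Sum>X\<in>insert x ` Pow E. y ^ card X) = (\<Sum>X\<in>Pow E. y * y ^ card X)"
    unfolding sum.reindex[OF inj] using insert(1,2)
    by (intro sum.cong) (auto simp: card_insert_if finite_subset)
  finally show ?case
    using insert by (simp add: sum_distrib_left[symmetric] algebra_simps)
qed simp

lemma sum_Pow_power_le_exp:
  fixes y :: real
  assumes "finite E" "0 \<le> y"
  shows "(\<Sum>X\<in>Pow E. y ^ card X) \<le> exp (y * real (card E))"
proof -
  have "(1 + y) ^ card E \<le> exp y ^ card E"
    using assms(2) by (intro power_mono exp_ge_add_one_self) auto
  then show ?thesis
    using sum_Pow_power[OF assms(1)] by (simp add: exp_of_nat_mult[symmetric] mult.commute)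
qed

text \<open>Sets sharing a code \<open>c\<close> are subsets of \<open>E c\<close>, so their sum is
  at most (1 + y)^|E c|. Reserving a factor \<open>y\<close> per edge thus pays for the choice of
  the edges, and only the codes remain to be counted.\<close>

lemma sum_encoded_le:
  fixes y :: real
  assumes fin: "finite \<I>" "finite C"
    and code: "\<And>I. I \<in> \<I> \<Longrightarrow> code I \<in> C \<and> I \<subseteq> E (code I)"
    and E: "\<And>c. c \<in> C \<Longrightarrow> finite (E c)" "\<And>c. c \<in> C \<Longrightarrow> real (card (E c)) \<le> b c"
    and y: "0 \<le> y" and \<phi>: "\<And>c. 0 \<le> \<phi> c"
  shows "(\<Sum>I\<in>\<I>. \<phi> (code I) * y ^ card I) \<le> (\<Sum>c\<in>C. \<phi> c * exp (y * b c))"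
proof -
  have "(\<Sum>I\<in>\<I>. \<phi> (code I) * y ^ card I)
      = (\<Sum>c\<in>code ` \<I>. \<Sum>I | I \<in> \<I> \<and> code I = c. \<phi> (code I) * y ^ card I)"
    by (rule sum.image_gen[OF fin(1)])
  also have "\<dots> \<le> (\<Sum>c\<in>code ` \<I>. \<phi> c * exp (y * b c))"
  proof (rule sum_mono)
    fix c assume "c \<in> code ` \<I>"
    then have c: "c \<in> C" using code by auto
    have "(\<Sum>I | I \<in> \<I> \<and> code I = c. \<phi> (code I) * y ^ card I)
      = \<phi> c * (\<Sum>I | I \<in> \<I> \<and> code I = c. y ^ card I)"
      by (simp add: sum_distrib_left)
    also have "\<dots> \<le> \<phi> c * (\<Sum>I\<in>Pow (E c). y ^ card I)"
      using code y E(1)[OF c] by (intro mult_left_mono sum_mono2 \<phi>) auto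
    also have "\<dots> \<le> \<phi> c * exp (y * real (card (E c)))"
      by (intro mult_left_mono sum_Pow_power_le_exp E(1)[OF c] y \<phi>)
    also have "\<dots> \<le> \<phi> c * exp (y * b c)"
      using E(2)[OF c] y by (intro mult_left_mono \<phi>) (auto intro: mult_left_mono)
    finally show "(\<Sum>I | I \<in> \<I> \<and> code I = c. \<phi> (code I) * y ^ card I) \<le> \<phi> c * exp (y * b c)" .
  qed
  also have "\<dots> \<le> (\<Sum>c\<in>C. \<phi> c * exp (y * b c))"
    using code fin(2) \<phi> by (intro sum_mono2) auto
  finally show ?thesis .
qed

text \<open>Each new vertex is charged to the edge leaving it, which cannot lie in \<open>H\<close>.
  One edge more is gained where the cycle enters the new vertices, or, if there are none, from the
  assumed edge outside \<open>H\<close>.\<close>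

lemma cycle_new_vertices:
  assumes zs: "distinct zs" "3 \<le> length zs"
    and new: "cyc zs - H \<noteq> {}" and H: "finite H" and meet: "set zs \<inter> \<Union> H \<noteq> {}"
  shows "card (set zs - \<Union> H) + 1 \<le> card (cyc zs - H)"
proof -
  let ?l = "length zs"
  let ?e = "\<lambda>i. {zs ! i, zs ! (Suc i mod ?l)}"
  let ?S = "{i. i < ?l \<and> zs ! i \<notin> \<Union> H}"
  have mlt: "Suc i mod ?l < ?l" for i using zs(2) by (intro mod_less_divisor) auto
  have inj: "inj_on ?e {..<?l}" by (rule inj_on_cyc_edge[OF zs])
  have eS: "?e ` ?S \<subseteq> cyc zs - H" unfolding cyc_def by auto
  have finc: "finite (cyc zs)" unfolding cyc_def by simp
  have cS: "card (?e ` ?S) = card ?S"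
    by (rule card_image[OF inj_on_subset[OF inj]]) auto
  have "set zs - \<Union> H = (!) zs ` ?S"
    by (auto simp: in_set_conv_nth)
  then have c1: "card (set zs - \<Union> H) \<le> card ?S"
    using card_image_le[of ?S "(!) zs"] by simp
  show ?thesis
  proof (cases "?S = {}")
    case True
    then have "card (set zs - \<Union> H) = 0" using c1 by (simp only: card.empty)
    moreover have "0 < card (cyc zs - H)"
      using new finc by (simp add: card_gt_0_iff)
    ultimately show ?thesis by linarith
  next
    case False
    \<comment> \<open>Otherwise, going round from a vertex covered by \<open>H\<close>, one would
      never meet a new vertex. The edge found here starts at an old vertex, so it has not been
      charged yet.\<close>
    have "\<exists>i<?l. i \<notin> ?S \<and> Suc i mod ?l \<in> ?S"
    proof (rule ccontr)
      assume no: "\<not> ?thesis"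
      obtain x where "x \<in> set zs" "x \<in> \<Union> H" using meet by blast
      then obtain a where a: "a < ?l" "zs ! a \<in> \<Union> H"
        by (metis in_set_conv_nth)
      have "zs ! ((a + j) mod ?l) \<in> \<Union> H" for j
      proof (induction j)
        case 0 then show ?case using a by simp
      next
        case (Suc j)
        have "(a + j) mod ?l < ?l" using a by (intro mod_less_divisor) auto
        moreover have "Suc ((a + j) mod ?l) mod ?l = (a + Suc j) mod ?l"
          by (simp add: mod_Suc_eq)
        ultimately show ?case using no Suc mlt by (metis (mono_tags, lifting) mem_Collect_eq)
      qed
      moreover obtain b where b: "b < ?l" "zs ! b \<notin> \<Union> H" using False by auto
      moreover have "(a + (b + ?l - a)) mod ?l = b" using a b by simp
      ultimately show False by metis
    qed
    then obtain i where i: "i < ?l" "i \<notin> ?S" "Suc i mod ?l \<in> ?S" by blast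
    have "?e i \<notin> ?e ` ?S"
      using i inj inj_on_image_mem_iff[OF inj, of i ?S] by auto
    moreover have "?e i \<in> cyc zs - H"
      using i unfolding cyc_def by auto
    ultimately have "card (insert (?e i) (?e ` ?S)) \<le> card (cyc zs - H)"
      using eS finc by (intro card_mono) auto
    then show ?thesis
      using \<open>?e i \<notin> ?e ` ?S\<close> cS c1 by simp
  qed
qed

text \<open>Consider a maximal dense subset. A cycle that meets it and is not contained in it adds
  fewer vertices than edges, at most \<open>l\<close> edges in all, and would extend it. Hence the
  two cycles through an uncovered edge are disjoint from it, and their union is itself dense. One
  cycle would not do: it has as many vertices as edges.\<close>

lemma dense_of_two_cycles:
  fixes V :: "'a set"
  assumes l: "3 \<le> l" and finI: "finite I" and IV: "I \<subseteq> all_edges V"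
    and two: "\<And>e. e \<in> I \<Longrightarrow> \<exists>\<alpha> \<beta>. \<alpha> \<in> cycles l V \<and> \<beta> \<in> cycles l V \<and> \<alpha> \<noteq> \<beta> \<and>
      \<alpha> \<subseteq> I \<and> \<beta> \<subseteq> I \<and> e \<in> \<alpha> \<and> e \<in> \<beta>"
  shows "2 * l * card (\<Union> I) + card I \<le> 2 * l * card I"
proof -
  define P where "P = (\<lambda>H. H \<subseteq> I \<and> 2 * l * card (\<Union> H) + card H \<le> 2 * l * card H)"
  have fe: "finite e" if "e \<in> I" for e
  proof -
    have "card e = 2" using that IV unfolding all_edges_def by auto
    then show ?thesis by (intro card_ge_0_finite) simp
  qed
  have fU: "finite (\<Union> H)" if "H \<subseteq> I" for H
    using that fe by (intro finite_Union finite_subset[OF that finI]) auto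
  have cy: "card \<alpha> = l \<and> card (\<Union> \<alpha>) = l \<and> (\<exists>zs. distinct zs \<and> length zs = l \<and> \<alpha> = cyc zs)"
    if \<alpha>: "\<alpha> \<in> cycles l V" for \<alpha>
  proof -
    obtain zs where "distinct zs" "length zs = l" "\<alpha> = cyc zs"
      using \<alpha> unfolding cycles_def by auto
    moreover from this have "\<Union> \<alpha> = set zs"
      using l Union_cyc[of zs] by (cases "zs = []") auto
    ultimately show ?thesis
      using card_cyc[of zs] l by (auto simp: distinct_card)
  qed
  have ext: "card (\<Union> (H \<union> \<alpha>)) + card H + 1 \<le> card (H \<union> \<alpha>) + card (\<Union> H) \<and> card (H \<union> \<alpha>) \<le> card H + l"
    if H: "H \<subseteq> I" and \<alpha>: "\<alpha> \<in> cycles l V" "\<alpha> \<subseteq> I" "\<not> \<alpha> \<subseteq> H" "\<Union> \<alpha> \<inter> \<Union> H \<noteq> {}" for H \<alpha>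
  proof -
    obtain zs where zs: "distinct zs" "length zs = l" "\<alpha> = cyc zs" using cy \<alpha>(1) by blast
    then have U: "\<Union> \<alpha> = set zs"
      using l Union_cyc[of zs] by (cases "zs = []") auto
    have finH: "finite H" "finite \<alpha>" using finI H \<alpha>(2) finite_subset by blast+
    have *: "card (\<Union> \<alpha> - \<Union> H) + 1 \<le> card (\<alpha> - H)"
      using cycle_new_vertices[of zs H] zs l \<alpha> U finH by auto
    have "\<Union> (H \<union> \<alpha>) = \<Union> H \<union> (\<Union> \<alpha> - \<Union> H)" by auto
    then have "card (\<Union> (H \<union> \<alpha>)) = card (\<Union> H) + card (\<Union> \<alpha> - \<Union> H)"
      using fU[OF H] fU[OF \<alpha>(2)] by (simp add: card_Un_disjoint Int_Diff del: Un_Diff_cancel)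
    moreover have "card (H \<union> \<alpha>) = card H + card (\<alpha> - H)"
      using finH card_Un_disjoint[of H "\<alpha> - H"] by auto
    moreover have "card (\<alpha> - H) \<le> l"
      using cy[OF \<alpha>(1)] finH card_mono[of \<alpha> "\<alpha> - H"] by auto
    ultimately show ?thesis using * by linarith
  qed
  have "P {}" unfolding P_def by simp
  moreover have "finite {H. P H}"
    by (rule finite_subset[of _ "Pow I"]) (use finI in \<open>auto simp: P_def\<close>)
  ultimately obtain H where H: "P H" and max: "\<And>H'. P H' \<Longrightarrow> H \<subseteq> H' \<Longrightarrow> H' = H"
    using finite_has_maximal[of "{H. P H}"] by blast
  have HI: "H \<subseteq> I" and dH: "2 * l * card (\<Union> H) + card H \<le> 2 * l * card H"
    using H unfolding P_def by auto
  have no_meet: "\<alpha> \<subseteq> H \<or> \<Union> \<alpha> \<inter> \<Union> H = {}" if \<alpha>: "\<alpha> \<in> cycles l V" "\<alpha> \<subseteq> I" for \<alpha>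
  proof (rule ccontr)
    assume "\<not> ?thesis"
    then have e: "card (\<Union> (H \<union> \<alpha>)) + card H + 1 \<le> card (H \<union> \<alpha>) + card (\<Union> H)"
        "card (H \<union> \<alpha>) \<le> card H + l" and "\<not> \<alpha> \<subseteq> H"
      using ext[OF HI \<alpha>] by auto
    have "2 * l * (card (\<Union> (H \<union> \<alpha>)) + card H + 1) \<le> 2 * l * (card (H \<union> \<alpha>) + card (\<Union> H))"
      using e(1) by (rule mult_le_mono2)
    then have "P (H \<union> \<alpha>)"
      unfolding P_def using HI \<alpha>(2) e(2) dH by (simp add: algebra_simps)
    then show False using max[of "H \<union> \<alpha>"] \<open>\<not> \<alpha> \<subseteq> H\<close> by auto
  qed
  have "H = I"
  proof (rule ccontr)
    assume "H \<noteq> I"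
    then obtain e where e: "e \<in> I" "e \<notin> H" using HI by blast
    obtain \<alpha> \<beta> where ab: "\<alpha> \<in> cycles l V" "\<beta> \<in> cycles l V" "\<alpha> \<noteq> \<beta>" "\<alpha> \<subseteq> I" "\<beta> \<subseteq> I" "e \<in> \<alpha>" "e \<in> \<beta>"
      using two[OF e(1)] by blast
    have dis: "\<Union> \<alpha> \<inter> \<Union> H = {}" "\<Union> \<beta> \<inter> \<Union> H = {}"
      using no_meet ab e by blast+
    have fin: "finite \<alpha>" "finite \<beta>" "finite H" using finI HI ab finite_subset by blast+
    have "\<not> \<beta> \<subseteq> \<alpha>"
      using card_subset_eq[OF fin(1), of \<beta>] cy ab by auto
    moreover obtain x where "x \<in> e" using IV e(1) unfolding all_edges_def by (auto simp: card_2_iff)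
    then have "\<Union> \<beta> \<inter> \<Union> \<alpha> \<noteq> {}" using ab by blast
    \<comment> \<open>\<alpha> has l vertices and l edges; \<beta> shares the edge \<open>e\<close>
      with it and adds fewer vertices than edges. With at most 2l edges in total, one missing vertex
      is the density deficit 1/(2l).\<close>
    ultimately have x: "card (\<Union> (\<alpha> \<union> \<beta>)) + l + 1 \<le> card (\<alpha> \<union> \<beta>) + l" "card (\<alpha> \<union> \<beta>) \<le> l + l"
      using ext[OF ab(4) ab(2) ab(5)] cy[OF ab(1)] by auto
    define K where "K = \<alpha> \<union> \<beta>"
    have K: "K \<subseteq> I" "card (\<Union> K) + 1 \<le> card K" "card K \<le> 2 * l" "\<Union> K \<inter> \<Union> H = {}" "finite K" "e \<in> K"
      using x ab dis fin by (auto simp: K_def)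
    have "{} \<notin> I" using IV unfolding all_edges_def by auto
    have "K \<inter> H = {}"
    proof (rule ccontr)
      assume "K \<inter> H \<noteq> {}"
      then obtain f where f: "f \<in> K" "f \<in> H" by blast
      then have "f \<noteq> {}" using \<open>{} \<notin> I\<close> K(1) by (metis subsetD)
      then obtain y where "y \<in> f" by blast
      then show False using f K(4) by blast
    qed
    then have c1: "card (H \<union> K) = card H + card K" using K(5) fin by (simp add: card_Un_disjoint Int_commute)
    have c2: "card (\<Union> (H \<union> K)) = card (\<Union> H) + card (\<Union> K)"
      using fU[OF HI] fU[OF K(1)] K(4) by (simp add: card_Un_disjoint Int_commute)
    have "2 * l * (card (\<Union> K) + 1) \<le> 2 * l * card K"
      using K(2) by (rule mult_le_mono2)
    then have "P (H \<union> K)"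
      unfolding P_def c1 c2 using HI K dH by (simp add: algebra_simps)
    then show False using max[of "H \<union> K"] K(6) e(2) by auto
  qed
  then show ?thesis using dH by simp
qed

section \<open>Moments away from seeds\<close>

text \<open>The sum is the expected number of present members of \<open>\<F>\<close>, given
  \<open>S\<close>, when elements appear independently with probability \<open>p\<close>.\<close>

definition seed :: "'e set set \<Rightarrow> real \<Rightarrow> real \<Rightarrow> nat \<Rightarrow> 'e set \<Rightarrow> bool" where
  "seed \<F> p \<theta> b S \<longleftrightarrow> card S \<le> b \<and> \<theta> < (\<Sum>\<alpha>\<in>\<F>. p ^ card (\<alpha> - S))"

text \<open>\<open>S\<close> collects the cycles already expanded. If \<open>S\<close> is a seed,
  the restricted event excludes \<open>S\<close> and the expectation is 0; if not, the next cycle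
  contributes a factor at most \<theta>. The budget \<open>card S + l * n \<le> b\<close> keeps
  every such union within the size allowed for seeds.\<close>

lemma restricted_moment_le:
  fixes \<nu> :: "'e set pmf" and \<F> :: "'e set set" and p :: real
  assumes fin: "finite (set_pmf \<nu>)" "finite \<F>" "finite \<Omega>" and F: "\<And>\<alpha>. \<alpha> \<in> \<F> \<Longrightarrow> \<alpha> \<subseteq> \<Omega> \<and> card \<alpha> \<le> l"
    and \<nu>: "\<And>S. S \<subseteq> \<Omega> \<Longrightarrow> measure_pmf.prob \<nu> {g. S \<subseteq> g} = p ^ card S"
    and p: "0 \<le> p" "p \<le> 1" and \<theta>: "0 \<le> \<theta>"
    and S: "S \<subseteq> \<Omega>" "card S + l * n \<le> b"
  shows "measure_pmf.expectation \<nu> (\<lambda>g. of_bool (S \<subseteq> g \<and> \<not> (\<exists>T\<subseteq>g. T \<subseteq> \<Omega> \<and> seed \<F> p \<theta> b T)) * real (card {\<alpha>\<in>\<F>. \<alpha> \<subseteq> g}) ^ n)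
    \<le> \<theta> ^ n * p ^ card S"
  using S
proof (induction n arbitrary: S)
  case 0
  let ?good = "\<lambda>g. \<not> (\<exists>T\<subseteq>g. T \<subseteq> \<Omega> \<and> seed \<F> p \<theta> b T)"
  have "measure_pmf.expectation \<nu> (\<lambda>g. of_bool (S \<subseteq> g \<and> ?good g) * real (card {\<alpha>\<in>\<F>. \<alpha> \<subseteq> g}) ^ 0)
    \<le> measure_pmf.expectation \<nu> (\<lambda>g. indicator {g. S \<subseteq> g} g)"
    by (intro integral_mono integrable_measure_pmf_finite fin) (auto simp: indicator_def)
  also have "\<dots> = p ^ card S"
    using \<nu>[OF 0(1)] by simp
  finally show ?case by simp
next
  case (Suc n)
  let ?good = "\<lambda>g. \<not> (\<exists>T\<subseteq>g. T \<subseteq> \<Omega> \<and> seed \<F> p \<theta> b T)"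
  let ?X = "\<lambda>g. real (card {\<alpha>\<in>\<F>. \<alpha> \<subseteq> g})"
  let ?E = "\<lambda>S n. measure_pmf.expectation \<nu> (\<lambda>g. of_bool (S \<subseteq> g \<and> ?good g) * ?X g ^ n)"
  show ?case
  proof (cases "seed \<F> p \<theta> b S")
    case True
    then have "\<not> (S \<subseteq> g \<and> ?good g)" for g using Suc(2) by blast
    then have "?E S (Suc n) = measure_pmf.expectation \<nu> (\<lambda>g. 0)"
      by (intro arg_cong[where f = "measure_pmf.expectation \<nu>"]) (auto simp: fun_eq_iff)
    then show ?thesis using \<theta> p by simp
  next
    case False
    then have sum_le: "(\<Sum>\<alpha>\<in>\<F>. p ^ card (\<alpha> - S)) \<le> \<theta>"
      using Suc(3) unfolding seed_def by auto
    have finS: "finite S" using Suc(2) fin(3) finite_subset by blast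
    have X: "?X g = (\<Sum>\<alpha>\<in>\<F>. of_bool (\<alpha> \<subseteq> g))" for g
      using fin(2) by (simp add: sum_of_bool_eq Int_def)
    have "?E S (Suc n) = measure_pmf.expectation \<nu>
        (\<lambda>g. \<Sum>\<alpha>\<in>\<F>. of_bool (S \<union> \<alpha> \<subseteq> g \<and> ?good g) * ?X g ^ n)"
    proof (intro arg_cong[where f = "measure_pmf.expectation \<nu>"] ext)
      fix g
      have "of_bool (S \<subseteq> g \<and> ?good g) * ?X g ^ Suc n
        = (\<Sum>\<alpha>\<in>\<F>. of_bool (\<alpha> \<subseteq> g)) * (of_bool (S \<subseteq> g \<and> ?good g) * ?X g ^ n)"
        unfolding power_Suc by (subst (1) X) (simp add: mult_ac)
      also have "\<dots> = (\<Sum>\<alpha>\<in>\<F>. of_bool (S \<union> \<alpha> \<subseteq> g \<and> ?good g) * ?X g ^ n)"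
        unfolding sum_distrib_right by (intro sum.cong) (auto simp: of_bool_def)
      finally show "of_bool (S \<subseteq> g \<and> ?good g) * ?X g ^ Suc n
        = (\<Sum>\<alpha>\<in>\<F>. of_bool (S \<union> \<alpha> \<subseteq> g \<and> ?good g) * ?X g ^ n)" .
    qed
    also have "\<dots> = (\<Sum>\<alpha>\<in>\<F>. ?E (S \<union> \<alpha>) n)"
      by (intro Bochner_Integration.integral_sum integrable_measure_pmf_finite fin)
    also have "\<dots> \<le> (\<Sum>\<alpha>\<in>\<F>. \<theta> ^ n * (p ^ card S * p ^ card (\<alpha> - S)))"
    proof (rule sum_mono)
      fix \<alpha> assume \<alpha>: "\<alpha> \<in> \<F>"
      have fin\<alpha>: "finite \<alpha>" using F[OF \<alpha>] fin(3) finite_subset by blast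
      have c: "card (S \<union> \<alpha>) = card S + card (\<alpha> - S)"
        using finS fin\<alpha> card_Un_disjoint[of S "\<alpha> - S"] by auto
      have "card (\<alpha> - S) \<le> l" using F[OF \<alpha>] card_mono[OF fin\<alpha>, of "\<alpha> - S"] by auto
      then have "card (S \<union> \<alpha>) + l * n \<le> b" using Suc(3) c by simp
      then have "?E (S \<union> \<alpha>) n \<le> \<theta> ^ n * p ^ card (S \<union> \<alpha>)"
        using Suc.IH[of "S \<union> \<alpha>"] Suc(2) F[OF \<alpha>] by auto
      then show "?E (S \<union> \<alpha>) n \<le> \<theta> ^ n * (p ^ card S * p ^ card (\<alpha> - S))"
        by (simp add: c power_add)
    qed
    also have "\<dots> = \<theta> ^ n * p ^ card S * (\<Sum>\<alpha>\<in>\<F>. p ^ card (\<alpha> - S))"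
      by (simp add: sum_distrib_left mult_ac)
    also have "\<dots> \<le> \<theta> ^ n * p ^ card S * \<theta>"
      using sum_le \<theta> p by (intro mult_left_mono) auto
    finally show ?thesis by (simp add: mult_ac)
  qed
qed

text \<open>As long as some edge contributes less than \<tau> it is deleted. There are at most
  \<open>b\<close> deletions, so the weight falls by at most \<open>b * \<tau>\<close>.\<close>

lemma seed_contains_core:
  fixes \<F> :: "'e set set" and p :: real
  assumes fin: "finite S" and seed: "seed \<F> p \<theta> b S" and \<tau>: "0 \<le> \<tau>"
  shows "\<exists>I\<subseteq>S. \<theta> - real b * \<tau> < (\<Sum>\<alpha>\<in>\<F>. p ^ card (\<alpha> - I)) \<and>
     (\<forall>e\<in>I. \<tau> \<le> (\<Sum>\<alpha>\<in>\<F>. p ^ card (\<alpha> - I)) - (\<Sum>\<alpha>\<in>\<F>. p ^ card (\<alpha> - (I - {e}))))"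
proof -
  let ?w = "\<lambda>I. \<Sum>\<alpha>\<in>\<F>. p ^ card (\<alpha> - I)"
  \<comment> \<open>The threshold \<open>t\<close> is general because each deletion lowers it by
    \<tau>.\<close>
  have "\<exists>I\<subseteq>S. t - real (card S) * \<tau> < ?w I \<and> (\<forall>e\<in>I. \<tau> \<le> ?w I - ?w (I - {e}))"
    if "t < ?w S" for t
    using fin that
  proof (induction "card S" arbitrary: S t)
    case 0
    then show ?case by (intro exI[of _ S]) auto
  next
    case (Suc n)
    show ?case
    proof (cases "\<forall>e\<in>S. \<tau> \<le> ?w S - ?w (S - {e})")
      case True
      have "t - real (card S) * \<tau> < ?w S" using Suc(4) \<tau>
        by (smt (verit) mult_nonneg_nonneg of_nat_0_le_iff)
      then show ?thesis using True by (intro exI[of _ S]) auto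
    next
      case False
      then obtain e where e: "e \<in> S" "?w S - ?w (S - {e}) < \<tau>" by auto
      have n: "n = card (S - {e})" using Suc(2,3) e by simp
      have t: "t - \<tau> < ?w (S - {e})" using e(2) Suc(4) by linarith
      have "finite (S - {e})" using Suc(3) by simp
      from Suc(1)[OF n this t] obtain I where I: "I \<subseteq> S - {e}"
          "t - \<tau> - real n * \<tau> < ?w I" "\<forall>e\<in>I. \<tau> \<le> ?w I - ?w (I - {e})"
        unfolding n[symmetric] by blast
      have "t - real (card S) * \<tau> = t - \<tau> - real n * \<tau>"
        by (simp add: Suc(2)[symmetric] algebra_simps)
      then show ?thesis using I by (intro exI[of _ I]) auto
    qed
  qed
  from this[of \<theta>] obtain I where I: "I \<subseteq> S" "\<theta> - real (card S) * \<tau> < ?w I"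
      "\<forall>e\<in>I. \<tau> \<le> ?w I - ?w (I - {e})"
    using seed unfolding seed_def by blast
  have "real (card S) * \<tau> \<le> real b * \<tau>"
    using seed \<tau> unfolding seed_def by (intro mult_right_mono) auto
  then show ?thesis using I by (intro exI[of _ I]) auto
qed

text \<open>Only members containing \<open>e\<close> change weight. Dropping the subtracted term
  leaves the full weight of the cycles through \<open>e\<close>, which walks can bound.\<close>

lemma weight_drop_le:
  fixes p :: real
  assumes "finite \<F>" "\<And>\<alpha>. \<alpha> \<in> \<F> \<Longrightarrow> finite \<alpha>" "0 \<le> p" "p \<le> 1" "e \<in> I"
  shows "(\<Sum>\<alpha>\<in>\<F>. p ^ card (\<alpha> - I)) - (\<Sum>\<alpha>\<in>\<F>. p ^ card (\<alpha> - (I - {e})))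
    \<le> (\<Sum>\<alpha> | \<alpha> \<in> \<F> \<and> e \<in> \<alpha>. p ^ card (\<alpha> - I))"
proof -
  have "(\<Sum>\<alpha>\<in>\<F>. p ^ card (\<alpha> - I)) - (\<Sum>\<alpha>\<in>\<F>. p ^ card (\<alpha> - (I - {e})))
    = (\<Sum>\<alpha>\<in>\<F>. p ^ card (\<alpha> - I) - p ^ card (\<alpha> - (I - {e})))"
    by (simp add: sum_subtractf)
  also have "\<dots> \<le> (\<Sum>\<alpha>\<in>\<F>. if e \<in> \<alpha> then p ^ card (\<alpha> - I) else 0)"
  proof (rule sum_mono)
    fix \<alpha> assume "\<alpha> \<in> \<F>"
    have "\<alpha> - (I - {e}) = \<alpha> - I" if "e \<notin> \<alpha>" using that by auto
    then show "p ^ card (\<alpha> - I) - p ^ card (\<alpha> - (I - {e})) \<le> (if e \<in> \<alpha> then p ^ card (\<alpha> - I) else 0)"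
      using assms(3) by auto
  qed
  also have "\<dots> = (\<Sum>\<alpha> | \<alpha> \<in> \<F> \<and> e \<in> \<alpha>. p ^ card (\<alpha> - I))"
    using assms(1) by (simp add: sum.inter_filter)
  finally show ?thesis .
qed

text \<open>Either the graph contains a seed, hence a member of \<open>\<C>\<close>, or Markov's
  inequality applies to the restricted n-th moment. Where seeds do not exist, \<open>\<C>\<close>
  can be empty.\<close>

lemma upper_tail_le:
  fixes \<nu> :: "'e set pmf" and \<F> :: "'e set set" and p :: real
  assumes fin: "finite (set_pmf \<nu>)" "finite \<F>" "finite \<Omega>" and F: "\<And>\<alpha>. \<alpha> \<in> \<F> \<Longrightarrow> \<alpha> \<subseteq> \<Omega> \<and> card \<alpha> \<le> l"
    and \<nu>: "\<And>S. S \<subseteq> \<Omega> \<Longrightarrow> measure_pmf.prob \<nu> {g. S \<subseteq> g} = p ^ card S"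
    and p: "0 \<le> p" "p \<le> 1" and \<theta>: "0 \<le> \<theta>" and x: "0 < x"
    and cores: "\<And>S. S \<subseteq> \<Omega> \<Longrightarrow> seed \<F> p \<theta> (l * n) S \<Longrightarrow> \<exists>I\<in>\<C>. I \<subseteq> S"
    and C: "finite \<C>" "\<And>I. I \<in> \<C> \<Longrightarrow> I \<subseteq> \<Omega>"
  shows "measure_pmf.prob \<nu> {g. x < real (card {\<alpha>\<in>\<F>. \<alpha> \<subseteq> g})} \<le> (\<theta> / x) ^ n + (\<Sum>I\<in>\<C>. p ^ card I)"
proof -
  let ?good = "\<lambda>g. \<not> (\<exists>T\<subseteq>g. T \<subseteq> \<Omega> \<and> seed \<F> p \<theta> (l * n) T)"
  let ?X = "\<lambda>g. real (card {\<alpha>\<in>\<F>. \<alpha> \<subseteq> g})"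
  let ?P = "measure_pmf.prob \<nu>"
  have "?P {g. x < ?X g} \<le> ?P ({g. ?good g \<and> x < ?X g} \<union> (\<Union>I\<in>\<C>. {g. I \<subseteq> g}))"
  proof (intro measure_pmf.finite_measure_mono subsetI)
    fix g assume g: "g \<in> {g. x < ?X g}"
    show "g \<in> {g. ?good g \<and> x < ?X g} \<union> (\<Union>I\<in>\<C>. {g. I \<subseteq> g})"
    proof (cases "?good g")
      case False
      then obtain T where "T \<subseteq> g" "T \<subseteq> \<Omega>" "seed \<F> p \<theta> (l * n) T" by blast
      with cores obtain I where "I \<in> \<C>" "I \<subseteq> T" by blast
      then show ?thesis using \<open>T \<subseteq> g\<close> by blast
    qed (use g in auto)
  qed auto
  also have "\<dots> \<le> ?P {g. ?good g \<and> x < ?X g} + ?P (\<Union>I\<in>\<C>. {g. I \<subseteq> g})"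
    by (intro measure_Un_le) auto
  also have "?P (\<Union>I\<in>\<C>. {g. I \<subseteq> g}) \<le> (\<Sum>I\<in>\<C>. ?P {g. I \<subseteq> g})"
    by (intro measure_pmf.finite_measure_subadditive_finite C) auto
  also have "\<dots> = (\<Sum>I\<in>\<C>. p ^ card I)"
    using \<nu> C by (intro sum.cong) auto
  also have "?P {g. ?good g \<and> x < ?X g} \<le> (\<theta> / x) ^ n"
  proof -
    have "?P {g. ?good g \<and> x < ?X g} = measure_pmf.expectation \<nu> (indicator {g. ?good g \<and> x < ?X g})"
      by simp
    also have "\<dots> \<le> measure_pmf.expectation \<nu> (\<lambda>g. of_bool ({} \<subseteq> g \<and> ?good g) * ?X g ^ n / x ^ n)"
    proof (intro integral_mono integrable_measure_pmf_finite fin)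
      fix g
      show "indicator {g. ?good g \<and> x < ?X g} g \<le> of_bool ({} \<subseteq> g \<and> ?good g) * ?X g ^ n / x ^ n"
      proof (cases "?good g \<and> x < ?X g")
        case True
        then have "x ^ n \<le> ?X g ^ n" using x by (intro power_mono) auto
        then show ?thesis using True x by (simp add: le_divide_eq)
      next
        case False
        then show ?thesis using x by auto
      qed
    qed
    also have "\<dots> = measure_pmf.expectation \<nu> (\<lambda>g. of_bool ({} \<subseteq> g \<and> ?good g) * ?X g ^ n) / x ^ n"
      by (simp add: integral_divide_zero)
    also have "\<dots> \<le> \<theta> ^ n * p ^ card ({} :: 'e set) / x ^ n"
      using x by (intro divide_right_mono restricted_moment_le[where b = "l * n", OF fin F \<nu> p \<theta>]) auto
    finally show ?thesis by (simp add: power_divide)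
  qed
  finally show ?thesis by simp
qed

section \<open>Structure of cores\<close>

context edge_subset
begin

context
  fixes l :: nat
  assumes l: "3 \<le> l"
begin

lemma sum_through_split:
  "(\<Sum>\<alpha>\<in>through l u v. p ^ card (\<alpha> - I))
    = real (card {\<alpha> \<in> through l u v. \<alpha> \<subseteq> I}) + (\<Sum>\<alpha> | \<alpha> \<in> through l u v \<and> \<not> \<alpha> \<subseteq> I. p ^ card (\<alpha> - I))"
proof -
  have "(\<Sum>\<alpha>\<in>through l u v. p ^ card (\<alpha> - I))
    = (\<Sum>\<alpha> | \<alpha> \<in> through l u v \<and> \<alpha> \<subseteq> I. p ^ card (\<alpha> - I))
      + (\<Sum>\<alpha> | \<alpha> \<in> through l u v \<and> \<not> \<alpha> \<subseteq> I. p ^ card (\<alpha> - I))"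
    using finite_through[OF l, of u v]
    by (subst sum.union_disjoint[symmetric]) (auto intro!: sum.cong)
  also have "(\<Sum>\<alpha> | \<alpha> \<in> through l u v \<and> \<alpha> \<subseteq> I. p ^ card (\<alpha> - I))
    = (\<Sum>\<alpha> | \<alpha> \<in> through l u v \<and> \<alpha> \<subseteq> I. 1)"
  proof (rule sum.cong)
    fix \<alpha> assume "\<alpha> \<in> {\<alpha> \<in> through l u v. \<alpha> \<subseteq> I}"
    then have "\<alpha> - I = {}" by auto
    then show "p ^ card (\<alpha> - I) = 1" by (simp only: card.empty power_0)
  qed simp
  finally show ?thesis by simp
qed

text \<open>Cycles meeting \<open>I\<close> are charged to edges of \<open>I\<close>. Those staying
  in \<open>I\<close> give the 2 in the constant, through \<open>Q_le\<close>; those leaving it give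
  the 8 * 3^(l-1), through \<open>walk_jump_le\<close> with H = 1. In the contrapositive, cores have
  at least \<epsilon> q^2 edges.\<close>

lemma weight_gain_le:
  assumes q: "0 < q" and \<epsilon>: "real k \<le> \<epsilon> * q\<^sup>2" "2 * \<epsilon> \<le> 1"
  shows "(\<Sum>\<alpha>\<in>cycles l V. p ^ card (\<alpha> - I))
    \<le> (\<Sum>\<alpha>\<in>cycles l V. p ^ card \<alpha>) + (2 + 8 * 3 ^ (l - 1)) * \<epsilon> * q ^ l"
proof -
  let ?C = "cycles l V"
  let ?s = "sqrt (2 * real k)"
  let ?E = "\<lambda>x. 1 + real (d x) / q"
  let ?g = "p * 3 ^ (l - 1) * q ^ (l - 2)"
  have finC: "finite ?C" by (rule finite_cycles[OF finV])
  obtain n where n: "l = Suc (Suc (Suc n))" using l by (metis Suc3_eq_add_3 add.commute le_Suc_ex)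
  have ln: "l - 2 = Suc n" "l - 1 = Suc (Suc n)" using n by auto
  have g: "0 \<le> ?g" using p0 q by simp
  have k2: "2 * real k \<le> 2 * \<epsilon> * q\<^sup>2" using \<epsilon>(1) by simp
  also have "\<dots> \<le> 1 * q\<^sup>2" using \<epsilon>(2) by (intro mult_right_mono) auto
  finally have k1: "2 * real k \<le> q\<^sup>2" by simp
  have s: "?s \<le> q" using k1 q by (intro real_le_lsqrt) auto
  \<comment> \<open>One edge of \<open>I\<close> on the cycle suffices; the double sum runs over
    ordered pairs and overcounts harmlessly.\<close>
  have bnd: "p ^ card (\<alpha> - I) \<le> p ^ card \<alpha> + (\<Sum>u\<in>V. \<Sum>v\<in>V. adj I u v * (if {u, v} \<in> \<alpha> then p ^ card (\<alpha> - I) else 0))"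
    (is "_ \<le> _ + ?R") if \<alpha>: "\<alpha> \<in> ?C" for \<alpha>
  proof (cases "\<alpha> \<inter> I = {}")
    case True
    then have "\<alpha> - I = \<alpha>" by auto
    moreover have "0 \<le> ?R" using p0 adj_nonneg by (intro sum_nonneg mult_nonneg_nonneg) auto
    ultimately show ?thesis by simp
  next
    case False
    then obtain e where e: "e \<in> \<alpha>" "e \<in> I" by auto
    then obtain u v where uv: "e = {u, v}" "u \<in> V" "v \<in> V" using I by (meson all_edgesE subsetD)
    let ?f = "\<lambda>u v. adj I u v * (if {u, v} \<in> \<alpha> then p ^ card (\<alpha> - I) else 0)"
    have nn: "0 \<le> ?f x y" for x y using p0 adj_nonneg by auto
    have "p ^ card (\<alpha> - I) = ?f u v" using e uv by (simp add: adj_def)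
    also have "\<dots> \<le> (\<Sum>v\<in>V. ?f u v)"
      by (rule member_le_sum[OF uv(3)]) (use nn finV in auto)
    also have "\<dots> \<le> ?R"
      by (rule member_le_sum[OF uv(2), where f = "\<lambda>u. \<Sum>v\<in>V. ?f u v"])
        (use nn finV in \<open>auto intro!: sum_nonneg\<close>)
    finally show ?thesis using p0 by (simp add: add_increasing)
  qed
  have "(\<Sum>\<alpha>\<in>?C. p ^ card (\<alpha> - I)) \<le> (\<Sum>\<alpha>\<in>?C. p ^ card \<alpha> +
      (\<Sum>u\<in>V. \<Sum>v\<in>V. adj I u v * (if {u, v} \<in> \<alpha> then p ^ card (\<alpha> - I) else 0)))"
    by (intro sum_mono bnd)
  also have "\<dots> = (\<Sum>\<alpha>\<in>?C. p ^ card \<alpha>) +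
      (\<Sum>\<alpha>\<in>?C. \<Sum>u\<in>V. \<Sum>v\<in>V. adj I u v * (if {u, v} \<in> \<alpha> then p ^ card (\<alpha> - I) else 0))"
    by (simp add: sum.distrib)
  also have "(\<Sum>\<alpha>\<in>?C. \<Sum>u\<in>V. \<Sum>v\<in>V. adj I u v * (if {u, v} \<in> \<alpha> then p ^ card (\<alpha> - I) else 0))
      = (\<Sum>u\<in>V. \<Sum>\<alpha>\<in>?C. \<Sum>v\<in>V. adj I u v * (if {u, v} \<in> \<alpha> then p ^ card (\<alpha> - I) else 0))"
    by (rule sum.swap)
  also have "\<dots> = (\<Sum>u\<in>V. \<Sum>v\<in>V. \<Sum>\<alpha>\<in>?C. adj I u v * (if {u, v} \<in> \<alpha> then p ^ card (\<alpha> - I) else 0))"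
    by (intro sum.cong refl sum.swap)
  also have "\<dots> = (\<Sum>u\<in>V. \<Sum>v\<in>V. adj I u v * (\<Sum>\<alpha>\<in>through l u v. p ^ card (\<alpha> - I)))"
    unfolding through_def[OF l] using finC by (simp add: sum_distrib_left[symmetric] sum.inter_filter)
  also have "\<dots> \<le> (\<Sum>u\<in>V. \<Sum>v\<in>V. adj I u v * (sqrt (real (d u)) * sqrt (real (d v)) * ?s ^ n + ?g * ?E u * ?E v))"
  proof (intro sum_mono)
    fix u v
    show "adj I u v * (\<Sum>\<alpha>\<in>through l u v. p ^ card (\<alpha> - I))
      \<le> adj I u v * (sqrt (real (d u)) * sqrt (real (d v)) * ?s ^ n + ?g * ?E u * ?E v)"
    proof (cases "{u, v} \<in> I")
      case True
      have "(\<Sum>\<alpha>\<in>through l u v. p ^ card (\<alpha> - I)) \<le> Q (l - 2) u v + (F (l - 2) u v - Q (l - 2) u v)"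
        unfolding sum_through_split
        by (intro add_mono card_through_inside_le[OF l True] sum_through_outside_le[OF l True])
      also have "\<dots> \<le> sqrt (real (d u)) * sqrt (real (d v)) * ?s ^ n + ?g * ?E u * ?E v"
      proof (rule add_mono)
        show "Q (l - 2) u v \<le> sqrt (real (d u)) * sqrt (real (d v)) * ?s ^ n"
          unfolding ln by (rule Q_le)
        show "F (l - 2) u v - Q (l - 2) u v \<le> ?g * ?E u * ?E v"
          using walk_jump_le[of 1 "l - 2" u v] k1 q unfolding ln by simp
      qed
      finally show ?thesis by (simp add: mult_left_mono adj_nonneg)
    qed (simp add: adj_def)
  qed
  also have "\<dots> = (\<Sum>u\<in>V. sqrt (real (d u)) * (\<Sum>v\<in>V. adj I u v * sqrt (real (d v)))) * ?s ^ n
      + ?g * (\<Sum>u\<in>V. ?E u * ((\<Sum>v\<in>V. adj I u v) + (\<Sum>v\<in>V. adj I u v * real (d v)) / q))"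
  proof -
    have "(\<Sum>u\<in>V. \<Sum>v\<in>V. a u v * (x u * x v * t + h * e u * (1 + c v / r)))
      = (\<Sum>u\<in>V. x u * (\<Sum>v\<in>V. a u v * x v)) * t + h * (\<Sum>u\<in>V. e u * ((\<Sum>v\<in>V. a u v) + (\<Sum>v\<in>V. a u v * c v) / r))"
      for a :: "'a \<Rightarrow> 'a \<Rightarrow> real" and x e c t h r
      by (simp add: sum.distrib sum_distrib_left sum_distrib_right sum_divide_distrib
          algebra_simps add_divide_distrib)
    then show ?thesis .
  qed
  also have "\<dots> \<le> 2 * \<epsilon> * q ^ l + 8 * 3 ^ (l - 1) * \<epsilon> * q ^ l"
  proof (rule add_mono)
    have "(\<Sum>u\<in>V. sqrt (real (d u)) * (\<Sum>v\<in>V. adj I u v * sqrt (real (d v))))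
      \<le> (\<Sum>u\<in>V. sqrt (real (d u)) * (sqrt (real (d u)) * ?s))"
      by (intro sum_mono mult_left_mono sum_nbr_sqrt_le) simp
    also have "\<dots> = (\<Sum>u\<in>V. real (d u)) * ?s"
      by (simp add: sum_distrib_right mult.assoc[symmetric])
    also have "\<dots> = 2 * real k * ?s" by (simp only: handshake_real)
    finally have "(\<Sum>u\<in>V. sqrt (real (d u)) * (\<Sum>v\<in>V. adj I u v * sqrt (real (d v)))) * ?s ^ n
      \<le> 2 * real k * ?s * ?s ^ n"
      by (intro mult_right_mono) auto
    also have "\<dots> \<le> 2 * \<epsilon> * q\<^sup>2 * q * q ^ n"
      by (rule mult_mono[OF mult_mono[OF k2 s] power_mono[OF s]]) (use q k2 in \<open>auto intro: order_trans[OF _ k2]\<close>)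
    also have "\<dots> = 2 * \<epsilon> * q ^ l"
      unfolding n by (simp add: power2_eq_square mult.assoc del: of_nat_mult)
    finally show "(\<Sum>u\<in>V. sqrt (real (d u)) * (\<Sum>v\<in>V. adj I u v * sqrt (real (d v)))) * ?s ^ n
      \<le> 2 * \<epsilon> * q ^ l" .
    have "(\<Sum>u\<in>V. ?E u * ((\<Sum>v\<in>V. adj I u v) + (\<Sum>v\<in>V. adj I u v * real (d v)) / q))
      \<le> (\<Sum>u\<in>V. ?E u * (real (d u) + 2 * real k / q))"
      using q by (intro sum_mono mult_left_mono add_mono divide_right_mono sum_nbr_degree_le)
        (auto simp: degree_eq_sum[symmetric])
    also have "\<dots> \<le> (\<Sum>u\<in>V. real (d u) + real m * real (d u) / q + 2 * real k / q + 2 * real k / q\<^sup>2 * real (d u))"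
    proof (rule sum_mono)
      fix u
      have "?E u * (real (d u) + 2 * real k / q)
        = real (d u) + real (d u) * real (d u) / q + 2 * real k / q + 2 * real k / q\<^sup>2 * real (d u)"
      proof -
        have "(1 + a / r) * (a + 2 * b / r) = a + a * a / r + 2 * b / r + 2 * b / r\<^sup>2 * a"
          if "0 < r" for a b r :: real
          using that by (simp add: field_simps power2_eq_square)
        from this[OF q] show ?thesis .
      qed
      \<comment> \<open>One of the two degree factors is replaced by \<open>m\<close>, since the
        factor \<open>p\<close> outside turns m / q into 1.\<close>
      also have "\<dots> \<le> real (d u) + real m * real (d u) / q + 2 * real k / q + 2 * real k / q\<^sup>2 * real (d u)"
        using q degree_le_m[of u] by (intro add_mono divide_right_mono mult_right_mono) auto
      finally show "?E u * (real (d u) + 2 * real k / q)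
        \<le> real (d u) + real m * real (d u) / q + 2 * real k / q + 2 * real k / q\<^sup>2 * real (d u)" .
    qed
    also have "\<dots> = 2 * real k + real m * (2 * real k) / q + real m * (2 * real k / q) + 2 * real k / q\<^sup>2 * (2 * real k)"
      by (simp add: sum.distrib sum_distrib_left[symmetric] sum_divide_distrib[symmetric] handshake_real)
    finally have "p * (\<Sum>u\<in>V. ?E u * ((\<Sum>v\<in>V. adj I u v) + (\<Sum>v\<in>V. adj I u v * real (d v)) / q))
      \<le> p * (2 * real k + real m * (2 * real k) / q + real m * (2 * real k / q) + 2 * real k / q\<^sup>2 * (2 * real k))"
      by (rule mult_left_mono) (rule p0)
    also have "\<dots> = p * (2 * real k) + 4 * real k * (q / q) + p * (2 * real k / q\<^sup>2 * (2 * real k))"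
      by (simp add: distrib_left mult_ac)
    \<comment> \<open>The contributions 2k, 4k and 2k add up to the 8 of the constant.\<close>
    also have "\<dots> \<le> 1 * (2 * real k) + 4 * real k * 1 + 1 * (1 * (2 * real k))"
      using q p0 p1 k1 by (intro add_mono mult_mono) (auto simp: divide_le_eq_1)
    also have "\<dots> = 8 * real k" by simp
    also have "\<dots> \<le> 8 * \<epsilon> * q\<^sup>2" using \<epsilon>(1) by simp
    finally have "p * (\<Sum>u\<in>V. ?E u * ((\<Sum>v\<in>V. adj I u v) + (\<Sum>v\<in>V. adj I u v * real (d v)) / q)) \<le> 8 * \<epsilon> * q\<^sup>2" .
    then have "3 ^ (l - 1) * q ^ (l - 2) * (p * (\<Sum>u\<in>V. ?E u * ((\<Sum>v\<in>V. adj I u v) + (\<Sum>v\<in>V. adj I u v * real (d v)) / q)))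
      \<le> 3 ^ (l - 1) * q ^ (l - 2) * (8 * \<epsilon> * q\<^sup>2)"
      using q by (intro mult_left_mono) auto
    also have "\<dots> = 8 * 3 ^ (l - 1) * \<epsilon> * (q ^ (l - 2) * q\<^sup>2)"
      by (simp only: mult_ac)
    also have "q ^ (l - 2) * q\<^sup>2 = q ^ l"
      unfolding n by (simp add: power2_eq_square mult.assoc mult.commute mult.left_commute)
    finally show "?g * (\<Sum>u\<in>V. ?E u * ((\<Sum>v\<in>V. adj I u v) + (\<Sum>v\<in>V. adj I u v * real (d v)) / q))
      \<le> 8 * 3 ^ (l - 1) * \<epsilon> * q ^ l"
      by (simp only: mult_ac)
  qed
  finally show ?thesis by (simp add: algebra_simps)
qed

text \<open>At least half of the weight through the edge comes from walks leaving \<open>I\<close>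
  or from cycles inside \<open>I\<close>. The former bounds (1 + x)(1 + y) from below, x and y being
  the degrees divided by q; the latter bounds the degree product through
  \<open>Q_le\<close>.\<close>

lemma core_edge_degrees:
  assumes uv: "{u, v} \<in> I" and H: "4 \<le> H" "2 * real k \<le> H * q\<^sup>2" and pH: "p * H ^ J = 1" "2 * l \<le> J"
    and q: "2 * H ^ (2 * l) \<le> q"
    and core: "4 * (q ^ (l - 2) / H) \<le> (\<Sum>\<alpha>\<in>through l u v. p ^ card (\<alpha> - I))"
  shows "real m / H ^ (2 * l) \<le> real (d u) \<or> real m / H ^ (2 * l) \<le> real (d v) \<or>
    (q\<^sup>2 / H ^ (2 * l) \<le> real (d u) * real (d v) \<and> 2 \<le> d u \<and> 2 \<le> d v)"
proof -
  let ?c = "real (card {\<alpha> \<in> through l u v. \<alpha> \<subseteq> I})"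
  define x y where "x = real (d u) / q" and "y = real (d v) / q"
  have H1: "1 \<le> H" using H by simp
  have Hp: "0 < H" using H by simp
  have "0 < H ^ (2 * l)" using Hp by simp
  then have q0: "0 < q" using q by linarith
  have xy: "0 \<le> x" "0 \<le> y" using q0 by (auto simp: x_def y_def)
  obtain n where n: "l = Suc (Suc (Suc n))" using l by (metis Suc3_eq_add_3 add.commute le_Suc_ex)
  have ln: "l - 2 = Suc n" "l - 1 = Suc (Suc n)" using n by auto
  have "H ^ J = H ^ (J - 2 * l) * H ^ (2 * l)"
    using pH(2) by (simp add: power_add[symmetric])
  then have "q * H ^ (J - 2 * l) * H ^ (2 * l) = real m"
    using pH(1) by (simp add: mult.assoc)
  \<comment> \<open>Converts a lower bound H^(J - 2l) on a normalised degree into the degree m /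
    H^(2l).\<close>
  then have qH: "q * H ^ (J - 2 * l) = real m / H ^ (2 * l)"
    using Hp by (simp add: eq_divide_eq)
  have sum: "4 * (q ^ (l - 2) / H) \<le> ?c + (F (l - 2) u v - Q (l - 2) u v)"
    using core sum_through_outside_le[OF l uv] unfolding sum_through_split by linarith
  show ?thesis
  proof (cases "2 * (q ^ (l - 2) / H) \<le> F (l - 2) u v - Q (l - 2) u v")
    case True
    note True
    also have "F (l - 2) u v - Q (l - 2) u v \<le> p * (3 * H) ^ (l - 1) * q ^ (l - 2) * (1 + x) * (1 + y)"
      using walk_jump_le[OF H1 H(2) q0, of "l - 2" u v] unfolding ln x_def y_def .
    also have "\<dots> \<le> p * (H * H) ^ (l - 1) * q ^ (l - 2) * (1 + x) * (1 + y)"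
      using H p0 q0 xy by (intro mult_right_mono mult_left_mono power_mono) auto
    finally have "2 * (q ^ (l - 2) / H) \<le> q ^ (l - 2) * (p * (H * H) ^ (l - 1) * ((1 + x) * (1 + y)))"
      by (simp only: mult_ac)
    then have "q ^ (l - 2) * (2 / H) \<le> q ^ (l - 2) * (p * (H * H) ^ (l - 1) * ((1 + x) * (1 + y)))"
      by (simp add: mult.commute)
    then have "2 / H \<le> p * (H * H) ^ (l - 1) * ((1 + x) * (1 + y))"
      using q0 by (subst (asm) mult_le_cancel_left_pos) auto
    then have "2 / H * H ^ J \<le> p * (H * H) ^ (l - 1) * ((1 + x) * (1 + y)) * H ^ J"
      using Hp by (intro mult_right_mono) auto
    also have "\<dots> = (p * H ^ J) * H ^ (2 * (l - 1)) * ((1 + x) * (1 + y))"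
      by (simp only: mult_ac power_mult power2_eq_square power_mult_distrib)
    also have "2 / H * H ^ J = 2 * H ^ (J - 2 * l) * H * H ^ (2 * (l - 1))"
    proof -
      have "J = Suc ((J - 2 * l) + 1 + 2 * (l - 1))" using pH(2) l by simp
      then have "H ^ J = H ^ Suc ((J - 2 * l) + 1 + 2 * (l - 1))"
        by (rule arg_cong)
      also have "\<dots> = H * (H ^ (J - 2 * l) * H * H ^ (2 * (l - 1)))"
        by (simp only: power_Suc power_add power_one_right)
      finally have "H ^ J = H * (H ^ (J - 2 * l) * H * H ^ (2 * (l - 1)))" .
      then show ?thesis using Hp by simp
    qed
    finally have "2 * H ^ (J - 2 * l) * H \<le> (1 + x) * (1 + y)"
      unfolding pH(1) using Hp by simp
    moreover have "2 * H ^ (J - 2 * l) * 4 \<le> 2 * H ^ (J - 2 * l) * H"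
      using H by (intro mult_left_mono) auto
    moreover have W: "1 \<le> H ^ (J - 2 * l)" using H1 by (rule one_le_power)
    \<comment> \<open>The product (1 + x)(1 + y) has four terms and is at least 8 H^(J - 2l), so one
      of the last three is large.\<close>
    ultimately have "H ^ (J - 2 * l) \<le> x \<or> H ^ (J - 2 * l) \<le> y \<or> H ^ (J - 2 * l) \<le> x * y"
    proof -
      assume a: "2 * H ^ (J - 2 * l) * H \<le> (1 + x) * (1 + y)"
        "2 * H ^ (J - 2 * l) * 4 \<le> 2 * H ^ (J - 2 * l) * H" "1 \<le> H ^ (J - 2 * l)"
      have "(1 + x) * (1 + y) = 1 + x + y + x * y" by (simp add: algebra_simps)
      then show ?thesis using a by linarith
    qed
    then consider "H ^ (J - 2 * l) \<le> x" | "H ^ (J - 2 * l) \<le> y" | "H ^ (J - 2 * l) \<le> x * y" by blast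
    then show ?thesis
    proof cases
      case 1
      then have "q * H ^ (J - 2 * l) \<le> real (d u)"
        using q0 by (simp add: x_def le_divide_eq mult.commute)
      then have "real m / H ^ (2 * l) \<le> real (d u)" unfolding qH .
      then show ?thesis by blast
    next
      case 2
      then have "q * H ^ (J - 2 * l) \<le> real (d v)"
        using q0 by (simp add: y_def le_divide_eq mult.commute)
      then have "real m / H ^ (2 * l) \<le> real (d v)" unfolding qH .
      then show ?thesis by blast
    next
      case 3
      then have "H ^ (J - 2 * l) \<le> real (d u) * real (d v) / (q * q)"
        by (simp add: x_def y_def)
      then have "(q * q) * H ^ (J - 2 * l) \<le> real (d u) * real (d v)"
        using q0 by (subst (asm) le_divide_eq) (simp add: mult.commute)
      then have P: "q * (real m / H ^ (2 * l)) \<le> real (d u) * real (d v)"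
        by (simp only: mult.assoc[of q q] qH)
      \<comment> \<open>As no degree exceeds m, a degree product of order q m forces each factor to
        be of order q, hence at least 2.\<close>
      have two: "2 \<le> a" if "q * (real m / H ^ (2 * l)) \<le> real a * real b" "b \<le> m" for a b
      proof -
        have m0: "0 < real m" using q0 by (cases "m = 0") auto
        have "real a * real b \<le> real a * real m" using that(2) by (intro mult_left_mono) auto
        then have "real m * (q / H ^ (2 * l)) \<le> real m * real a" using that(1) by (simp add: mult_ac)
        then have "q / H ^ (2 * l) \<le> real a" using m0 by (subst (asm) mult_le_cancel_left_pos) auto
        moreover have "2 \<le> q / H ^ (2 * l)" using q Hp by (simp add: le_divide_eq)
        ultimately show ?thesis by linarith
      qed
      have "q * q \<le> q * real m"
        using q0 p1 by (intro mult_left_mono mult_left_le) auto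
      then have "q\<^sup>2 / H ^ (2 * l) \<le> q * (real m / H ^ (2 * l))"
        using Hp by (simp add: power2_eq_square divide_right_mono)
      then show ?thesis
        using P two[OF P degree_le_m] two[of "d v" "d u"] degree_le_m[of u] by (auto simp: mult.commute)
    qed
  next
    case False
    then have c: "2 * (q ^ (l - 2) / H) < ?c" using sum by linarith
    have "0 \<le> 2 * (q ^ (l - 2) / H)" using q0 Hp by simp
    then have "0 < ?c" using c by linarith
    then have "{\<alpha> \<in> through l u v. \<alpha> \<subseteq> I} \<noteq> {}"
      by (intro notI) (simp only: card.empty of_nat_0 less_irrefl)
    then obtain \<alpha> where \<alpha>: "\<alpha> \<in> through l u v" "\<alpha> \<subseteq> I" by blast
    then have d2: "2 \<le> d u" "2 \<le> d v"
      using degree_ge_2[OF l \<alpha>] degree_ge_2[OF l, of \<alpha> v u] unfolding through_def[OF l]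
      by (auto simp: insert_commute)
    have s: "sqrt (2 * real k) \<le> H * q"
    proof (rule real_le_lsqrt)
      have "H * q\<^sup>2 \<le> (H * H) * q\<^sup>2" using H1 by (intro mult_right_mono) auto
      then show "2 * real k \<le> (H * q)\<^sup>2" using H(2) by (simp add: power2_eq_square mult_ac)
    qed (use Hp q0 in auto)
    \<comment> \<open>Many cycles inside \<open>I\<close> force large degrees at both ends of the
      edge; squaring gives the product.\<close>
    have "?c \<le> Q (Suc n) u v" using card_through_inside_le[OF l uv] unfolding ln .
    also have "\<dots> \<le> sqrt (real (d u)) * sqrt (real (d v)) * sqrt (2 * real k) ^ n" by (rule Q_le)
    also have "\<dots> \<le> sqrt (real (d u)) * sqrt (real (d v)) * (H * q) ^ n"
      using s by (intro mult_left_mono power_mono) auto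
    finally have "2 * (q ^ Suc n / H) \<le> sqrt (real (d u)) * sqrt (real (d v)) * (H * q) ^ n"
      using c unfolding ln by linarith
    then have "q ^ n * (2 * (q / H)) \<le> q ^ n * (sqrt (real (d u) * real (d v)) * H ^ n)"
      by (simp add: power_mult_distrib real_sqrt_mult mult_ac)
    then have "2 * (q / H) \<le> sqrt (real (d u) * real (d v)) * H ^ n"
      using q0 by (subst (asm) mult_le_cancel_left_pos) auto
    moreover have "q / H \<le> 2 * (q / H)" 
    proof -
      have "x \<le> 2 * x" if "0 < x" for x :: real using that by simp
      from this[OF divide_pos_pos[OF q0 Hp]] show ?thesis .
    qed
    ultimately have "q / H \<le> sqrt (real (d u) * real (d v)) * H ^ n" by linarith
    then have "(q / H)\<^sup>2 \<le> (sqrt (real (d u) * real (d v)) * H ^ n)\<^sup>2"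
      using q0 Hp by (intro power_mono) auto
    then have "q\<^sup>2 \<le> real (d u) * real (d v) * ((H ^ n)\<^sup>2 * H\<^sup>2)"
      using Hp by (simp add: power_divide power_mult_distrib divide_le_eq mult_ac)
    also have "(H ^ n)\<^sup>2 * H\<^sup>2 = H ^ (2 * n + 2)"
      by (simp add: power_add power_mult power2_eq_square power_mult_distrib)
    also have "real (d u) * real (d v) * H ^ (2 * n + 2) \<le> real (d u) * real (d v) * H ^ (2 * l)"
      using n H1 by (intro mult_left_mono power_increasing) auto
    finally have "q\<^sup>2 / H ^ (2 * l) \<le> real (d u) * real (d v)"
      using Hp by (simp add: divide_le_eq)
    then show ?thesis using d2 by simp
  qed
qed

text \<open>When q is at most H^J1, one factor p outweighs all powers of q and H in
  \<open>walk_jump_le\<close>. Cycles leaving \<open>I\<close> then weigh at most 1 out of 4, so at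
  least three cycles lie inside.\<close>

lemma core_edge_two_cycles:
  assumes uv: "{u, v} \<in> I" and H: "4 \<le> H" "2 * real k \<le> H * q\<^sup>2"
    and pH: "p * H ^ J = 1" "2 * l + 3 * l * J1 \<le> J"
    and q: "1 \<le> q" "q \<le> H ^ J1" "real k \<le> q ^ l"
    and core: "4 \<le> (\<Sum>\<alpha>\<in>through l u v. p ^ card (\<alpha> - I))"
  shows "\<exists>\<alpha> \<beta>. \<alpha> \<in> cycles l V \<and> \<beta> \<in> cycles l V \<and> \<alpha> \<noteq> \<beta> \<and>
      \<alpha> \<subseteq> I \<and> \<beta> \<subseteq> I \<and> {u, v} \<in> \<alpha> \<and> {u, v} \<in> \<beta>"
proof -
  let ?A = "{\<alpha> \<in> through l u v. \<alpha> \<subseteq> I}"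
  have H1: "1 \<le> H" and Hp: "0 < H" and q0: "0 < q" using H q by auto
  obtain n where n: "l = Suc (Suc (Suc n))" using l by (metis Suc3_eq_add_3 add.commute le_Suc_ex)
  have ln: "l - 2 = Suc n" "l - 1 = Suc (Suc n)" using n by auto
  have e: "1 + real (d x) / q \<le> 2 * q ^ l" for x
  proof -
    have "real (d x) / q \<le> real (d x) / 1" using q(1) by (intro divide_left_mono) auto
    also have "\<dots> \<le> real k" using degree_le_k[of x] by simp
    finally show ?thesis using q(3) one_le_power[OF q(1), of l] by linarith
  qed
  have "F (l - 2) u v - Q (l - 2) u v \<le> p * (3 * H) ^ (l - 1) * q ^ (l - 2) * (1 + real (d u) / q) * (1 + real (d v) / q)"
    using walk_jump_le[OF H1 H(2) q0, of "l - 2" u v] unfolding ln .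
  also have "\<dots> \<le> p * (H * H) ^ (l - 1) * q ^ l * (2 * q ^ l) * (2 * q ^ l)"
    using H p0 q(1) q0 by (intro mult_mono mult_left_mono power_mono e power_increasing) auto
  also have "\<dots> = 4 * (p * H ^ (2 * (l - 1)) * (q ^ l) ^ 3)"
    by (simp add: power_mult power2_eq_square power3_eq_cube mult_ac del: of_nat_mult)
  \<comment> \<open>The three factors q^l, one from the path and one from each degree, become H^(3 l
    J1); the total exponent of H stays within J, so p cancels it.\<close>
  also have "\<dots> \<le> H * (p * H ^ (2 * (l - 1)) * ((H ^ J1) ^ l) ^ 3)"
    using H p0 q q0 by (intro mult_mono mult_left_mono power_mono) auto
  also have "\<dots> = p * H ^ (1 + 2 * (l - 1) + 3 * l * J1)"
    by (simp add: power_add power_mult[symmetric] mult_ac)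
  also have "\<dots> \<le> p * H ^ J"
    using pH(2) n p0 H1 by (intro mult_left_mono power_increasing) auto
  finally have "F (l - 2) u v - Q (l - 2) u v \<le> 1" using pH(1) by simp
  then have "3 \<le> real (card ?A)"
    using core sum_through_outside_le[OF l uv] unfolding sum_through_split by linarith
  then have "\<not> card ?A \<le> Suc 0" by linarith
  moreover have "finite ?A" using finite_through[OF l] by auto
  ultimately obtain \<alpha> \<beta> where "\<alpha> \<in> ?A" "\<beta> \<in> ?A" "\<alpha> \<noteq> \<beta>"
    by (auto simp: card_le_Suc0_iff_eq)
  then show ?thesis unfolding through_def[OF l] by blast
qed

end

end

section \<open>Counting cores\<close>

lemma card_doubletons_le:
  assumes "finite X"
  shows "finite {{u, v} | u v. (u, v) \<in> X}" "card {{u, v} | u v. (u, v) \<in> X} \<le> card X"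
proof -
  have eq: "{{u, v} | u v. (u, v) \<in> X} = (\<lambda>(u, v). {u, v}) ` X" by auto
  show "finite {{u, v} | u v. (u, v) \<in> X}" "card {{u, v} | u v. (u, v) \<in> X} \<le> card X"
    unfolding eq using assms by (auto intro: card_image_le)
qed

lemma card_all_edges_le: "finite U \<Longrightarrow> card (all_edges U) \<le> (card U)\<^sup>2"
proof -
  assume U: "finite U"
  have "all_edges U \<subseteq> {{u, v} | u v. (u, v) \<in> U \<times> U}"
    by (auto elim!: all_edgesE)
  then have "card (all_edges U) \<le> card {{u, v} | u v. (u, v) \<in> U \<times> U}"
    using U by (intro card_mono card_doubletons_le) auto
  also have "\<dots> \<le> card (U \<times> U)"
    using U by (intro card_doubletons_le) auto
  finally show ?thesis by (simp add: card_cartesian_product power2_eq_square)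
qed

text \<open>A graph is encoded by its vertex set. Splitting p^k, the part p^v pays for the v
  vertices, and density leaves p^(k-v) <= y^(2k): one y^k pays for the edges among these vertices,
  the other is the gain.\<close>

lemma card_dense_graphs_le:
  fixes p y :: real
  assumes V: "finite V" and l: "1 \<le> l"
    and \<I>: "\<And>I. I \<in> \<I> \<Longrightarrow> I \<subseteq> all_edges V \<and> card I = k \<and> 2 * l * card (\<Union> I) + card I \<le> 2 * l * card I"
    and y: "0 \<le> y" "y \<le> 1" "y * real k \<le> 1" and p: "p = y ^ (4 * l)"
  shows "real (card \<I>) * p ^ k \<le> y ^ k * exp (p * real (card V) + real k)"
proof -
  have p0: "0 \<le> p" "p \<le> 1" using y p by (auto intro: power_le_one)
  have fin: "finite \<I>"
    by (rule finite_subset[of _ "Pow (all_edges V)"]) (use \<I> V finite_all_edges in auto)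
  let ?C = "{U \<in> Pow V. card U \<le> k}"
  have U: "\<Union> I \<in> ?C \<and> I \<subseteq> all_edges (\<Union> I)" if "I \<in> \<I>" for I
  proof -
    have "card I = k" "2 * l * card (\<Union> I) + card I \<le> 2 * l * card I"
      using \<I>[OF that] by blast+
    then have "2 * l * card (\<Union> I) \<le> 2 * l * k" by (metis add_leD1)
    then have "card (\<Union> I) \<le> k" by (rule mult_left_le_imp_le) (use l in simp)
    moreover have "\<Union> I \<subseteq> V" "I \<subseteq> all_edges (\<Union> I)"
      using \<I>[OF that] unfolding all_edges_def by auto
    ultimately show ?thesis by simp
  qed
  have "real (card \<I>) * p ^ k = (\<Sum>I\<in>\<I>. p ^ k)" by simp
  also have "\<dots> \<le> (\<Sum>I\<in>\<I>. y ^ k * (p ^ card (\<Union> I) * y ^ card I))"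
  proof (rule sum_mono)
    fix I assume I: "I \<in> \<I>"
    let ?v = "card (\<Union> I)"
    have v: "?v \<le> k" using U[OF I] by auto
    \<comment> \<open>Density says k - v is at least k / (2l), which is why \<open>p\<close> is
      taken to be the power 4l of \<open>y\<close>.\<close>
    have e: "2 * k \<le> 4 * l * (k - ?v)"
    proof -
      obtain j where j: "k = ?v + j" using v le_Suc_ex by blast
      have "2 * l * ?v + k \<le> 2 * l * ?v + 2 * l * j"
        using \<I>[OF I] unfolding j by (metis distrib_left)
      then show ?thesis unfolding j by simp
    qed
    have "p ^ k = p ^ ?v * p ^ (k - ?v)" using v by (simp add: power_add[symmetric])
    also have "p ^ (k - ?v) = y ^ (4 * l * (k - ?v))" unfolding p by (simp add: power_mult)
    also have "p ^ ?v * y ^ (4 * l * (k - ?v)) \<le> p ^ ?v * y ^ (2 * k)"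
      using e y p0 by (intro mult_left_mono power_decreasing) auto
    also have "\<dots> = y ^ k * (p ^ ?v * y ^ card I)"
      using \<I>[OF I] by (simp add: mult_2 power_add)
    finally show "p ^ k \<le> y ^ k * (p ^ ?v * y ^ card I)" .
  qed
  also have "\<dots> = y ^ k * (\<Sum>I\<in>\<I>. p ^ card (\<Union> I) * y ^ card I)"
    by (simp add: sum_distrib_left)
  also have "\<dots> \<le> y ^ k * (\<Sum>U\<in>?C. p ^ card U * exp (y * (real k)\<^sup>2))"
  proof (intro mult_left_mono sum_encoded_le[where E = all_edges] fin)
    fix c assume c: "c \<in> ?C"
    then have "finite c" using V finite_subset by auto
    then have "card (all_edges c) \<le> (card c)\<^sup>2" by (rule card_all_edges_le)
    also have "\<dots> \<le> k\<^sup>2" using c by (intro power_mono) auto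
    finally show "real (card (all_edges c)) \<le> (real k)\<^sup>2"
      by (simp only: of_nat_power[symmetric] of_nat_le_iff)
    show "finite (all_edges c)" using \<open>finite c\<close> by (rule finite_all_edges)
  qed (use U V y p0 in auto)
  also have "\<dots> \<le> y ^ k * ((\<Sum>U\<in>Pow V. p ^ card U) * exp (real k))"
  proof (intro mult_left_mono)
    have "y * (real k)\<^sup>2 = (y * real k) * real k" by (simp add: power2_eq_square)
    also have "\<dots> \<le> 1 * real k" using y by (intro mult_right_mono) auto
    finally have "(\<Sum>U\<in>?C. p ^ card U * exp (y * (real k)\<^sup>2)) \<le> (\<Sum>U\<in>?C. p ^ card U * exp (real k))"
      using p0 by (intro sum_mono mult_left_mono) auto
    also have "\<dots> \<le> (\<Sum>U\<in>Pow V. p ^ card U * exp (real k))"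
      using V p0 by (intro sum_mono2) auto
    finally show "(\<Sum>U\<in>?C. p ^ card U * exp (y * (real k)\<^sup>2)) \<le> (\<Sum>U\<in>Pow V. p ^ card U) * exp (real k)"
      by (simp add: sum_distrib_right)
  qed (use y in auto)
  also have "\<dots> \<le> y ^ k * (exp (p * real (card V)) * exp (real k))"
    using sum_Pow_power_le_exp[OF V p0(1)] y by (intro mult_left_mono mult_right_mono) auto
  finally show ?thesis by (simp add: exp_add)
qed

section \<open>Larger q: counting cores by their degrees\<close>

lemma card_ge_mult_le:
  fixes f :: "'a \<Rightarrow> real"
  assumes "finite S" "\<And>x. x \<in> S \<Longrightarrow> 0 \<le> f x" "sum f S \<le> s" "0 < M"
  shows "real (card {x \<in> S. M \<le> f x}) \<le> s / M"
proof -
  have "real (card {x \<in> S. M \<le> f x}) * M = (\<Sum>x | x \<in> S \<and> M \<le> f x. M)" by simp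
  also have "\<dots> \<le> (\<Sum>x | x \<in> S \<and> M \<le> f x. f x)" by (intro sum_mono) auto
  also have "\<dots> \<le> sum f S" using assms(1,2) by (intro sum_mono2) auto
  finally show ?thesis using assms(3,4) by (simp add: le_divide_eq)
qed

text \<open>A core is encoded by its vertices of degree at least \<open>D\<close>, with their degrees, and a set
  containing its vertices of smaller degree (at least 2). The threshold \<open>D\<close> exceeds the logarithm
  of the number of vertices, so the first part costs only \<open>exp (O(k))\<close> for cores with \<open>k\<close> edges.\<close>

definition high_profile :: "'a set \<Rightarrow> real \<Rightarrow> 'a set set \<Rightarrow> ('a \<times> nat) set" where
  "high_profile V D I = {(v, a). v \<in> V \<and> a = degree_in I v \<and> D \<le> real a}"

definition low_vertices :: "'a set \<Rightarrow> real \<Rightarrow> 'a set set \<Rightarrow> 'a set" where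
  "low_vertices V D I = {v \<in> V. 2 \<le> degree_in I v \<and> real (degree_in I v) < D}"

text \<open>One family per way an edge of a \<open>degree_rich\<close> graph can arise: an end of
  degree at least \<open>M1\<close>; two ends of degree at least \<open>D\<close>; or an end of
  degree below \<open>D\<close>, whose partner then has degree at least
  \<open>M2 / D\<close>.\<close>

definition admissible_edges ::
  "'a set \<Rightarrow> real \<Rightarrow> real \<Rightarrow> real \<Rightarrow> ('a \<times> nat) set \<Rightarrow> 'a set \<Rightarrow> 'a set set" where
  "admissible_edges V M1 M2 D \<Gamma> W =
     {{u, v} | u v. (u, v) \<in> fst ` {x \<in> \<Gamma>. M1 \<le> real (snd x)} \<times> V} \<union>
     {{u, v} | u v. (u, v) \<in> (\<lambda>(x, y). (fst x, fst y)) ` {(x, y) \<in> \<Gamma> \<times> \<Gamma>. M2 \<le> real (snd x) * real (snd y)}} \<union>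
     {{u, v} | u v. (u, v) \<in> fst ` {x \<in> \<Gamma>. M2 / D \<le> real (snd x)} \<times> W}"

text \<open>Markov's inequality for the recorded degrees, whose sum is at most \<open>s\<close>, and
  for products of two of them, whose sum is at most s^2.\<close>

lemma admissible_edges_card:
  assumes V: "finite V" and \<Gamma>: "finite \<Gamma>" "(\<Sum>x\<in>\<Gamma>. real (snd x)) \<le> s"
    and M: "0 < M1" "0 < M2" "0 < D" and W: "finite W"
  shows "finite (admissible_edges V M1 M2 D \<Gamma> W)"
    "real (card (admissible_edges V M1 M2 D \<Gamma> W))
      \<le> s / M1 * real (card V) + s\<^sup>2 / M2 + s * D / M2 * real (card W)"
proof -
  have "0 \<le> (\<Sum>x\<in>\<Gamma>. real (snd x))" by (intro sum_nonneg) simp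
  then have s0: "0 \<le> s" using \<Gamma>(2) by linarith
  let ?X = "fst ` {x \<in> \<Gamma>. M1 \<le> real (snd x)} \<times> V"
  let ?Y = "(\<lambda>(x, y). (fst x, fst y)) ` {(x, y) \<in> \<Gamma> \<times> \<Gamma>. M2 \<le> real (snd x) * real (snd y)}"
  let ?Z = "fst ` {x \<in> \<Gamma>. M2 / D \<le> real (snd x)} \<times> W"
  let ?E = "\<lambda>X. {{u, v} | u v. (u, v) \<in> X}"
  have pairs: "{(x, y) \<in> \<Gamma> \<times> \<Gamma>. M2 \<le> real (snd x) * real (snd y)}
    = {z \<in> \<Gamma> \<times> \<Gamma>. M2 \<le> real (snd (fst z)) * real (snd (snd z))}" by auto
  have fin: "finite ?X" "finite ?Y" "finite ?Z"
    using V \<Gamma> W unfolding pairs by auto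
  show "finite (admissible_edges V M1 M2 D \<Gamma> W)"
    unfolding admissible_edges_def by (intro finite_UnI card_doubletons_le fin)
  have X: "real (card ?X) \<le> s / M1 * real (card V)"
  proof -
    have "card ?X \<le> card {x \<in> \<Gamma>. M1 \<le> real (snd x)} * card V"
      unfolding card_cartesian_product by (intro mult_le_mono1 card_image_le) (use \<Gamma>(1) in simp)
    then have "real (card ?X) \<le> real (card {x \<in> \<Gamma>. M1 \<le> real (snd x)}) * real (card V)"
      by (simp only: of_nat_mult[symmetric] of_nat_le_iff)
    also have "\<dots> \<le> s / M1 * real (card V)"
      using \<Gamma> M by (intro mult_right_mono card_ge_mult_le) auto
    finally show ?thesis .
  qed
  have Z: "real (card ?Z) \<le> s * D / M2 * real (card W)"
  proof -
    have "card ?Z \<le> card {x \<in> \<Gamma>. M2 / D \<le> real (snd x)} * card W"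
      unfolding card_cartesian_product by (intro mult_le_mono1 card_image_le) (use \<Gamma>(1) in simp)
    then have "real (card ?Z) \<le> real (card {x \<in> \<Gamma>. M2 / D \<le> real (snd x)}) * real (card W)"
      by (simp only: of_nat_mult[symmetric] of_nat_le_iff)
    also have "\<dots> \<le> s / (M2 / D) * real (card W)"
      using \<Gamma> M by (intro mult_right_mono card_ge_mult_le) auto
    finally show ?thesis by simp
  qed
  have Y: "real (card ?Y) \<le> s\<^sup>2 / M2"
  proof -
    have "card ?Y \<le> card {(x, y) \<in> \<Gamma> \<times> \<Gamma>. M2 \<le> real (snd x) * real (snd y)}"
      by (rule card_image_le) (unfold pairs, use \<Gamma>(1) in simp)
    then have "real (card ?Y) \<le> real (card {z \<in> \<Gamma> \<times> \<Gamma>. M2 \<le> real (snd (fst z)) * real (snd (snd z))})"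
      unfolding pairs by simp
    also have "\<dots> \<le> s\<^sup>2 / M2"
    proof (rule card_ge_mult_le)
      have "(\<Sum>z\<in>\<Gamma> \<times> \<Gamma>. real (snd (fst z)) * real (snd (snd z))) = (\<Sum>x\<in>\<Gamma>. real (snd x)) * (\<Sum>x\<in>\<Gamma>. real (snd x))"
        by (simp add: sum_product sum.cartesian_product case_prod_unfold)
      also have "\<dots> \<le> s * s" using \<Gamma>(2) s0 by (intro mult_mono sum_nonneg) auto
      finally show "(\<Sum>z\<in>\<Gamma> \<times> \<Gamma>. real (snd (fst z)) * real (snd (snd z))) \<le> s\<^sup>2"
        by (simp add: power2_eq_square)
    qed (use \<Gamma> M in auto)
    finally show ?thesis .
  qed
  have "card (admissible_edges V M1 M2 D \<Gamma> W) \<le> card (?E ?X) + card (?E ?Y) + card (?E ?Z)"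
    unfolding admissible_edges_def by (rule order_trans[OF card_Un_le]) (intro add_mono card_Un_le order_refl)
  also have "\<dots> \<le> card ?X + card ?Y + card ?Z"
    by (intro add_mono card_doubletons_le fin)
  finally show "real (card (admissible_edges V M1 M2 D \<Gamma> W))
      \<le> s / M1 * real (card V) + s\<^sup>2 / M2 + s * D / M2 * real (card W)"
    using X Y Z by linarith
qed

text \<open>The alternative proved in \<open>core_edge_degrees\<close>, with thresholds m / H^(2l)
  and q^2 / H^(2l) in the application.\<close>

definition degree_rich :: "real \<Rightarrow> real \<Rightarrow> 'a set set \<Rightarrow> bool" where
  "degree_rich M1 M2 I \<longleftrightarrow> (\<forall>u v. {u, v} \<in> I \<longrightarrow> M1 \<le> real (degree_in I u) \<or> M1 \<le> real (degree_in I v) \<or>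
     (M2 \<le> real (degree_in I u) * real (degree_in I v) \<and> 2 \<le> degree_in I u \<and> 2 \<le> degree_in I v))"

lemma degree_rich_subset:
  assumes V: "finite V" and I: "I \<subseteq> all_edges V" and rich: "degree_rich M1 M2 I"
    and M: "0 < D" "D \<le> M1" "D * D \<le> M2" and W: "low_vertices V D I \<subseteq> W"
  shows "I \<subseteq> admissible_edges V M1 M2 D (high_profile V D I) W"
proof
  fix e assume e: "e \<in> I"
  then obtain u v where uv: "e = {u, v}" "u \<in> V" "v \<in> V" using I by (meson all_edgesE subsetD)
  let ?d = "degree_in I"
  let ?A = "admissible_edges V M1 M2 D (high_profile V D I) W"
  \<comment> \<open>Hence the partner of a low vertex is itself recorded in the profile.\<close>
  have MD: "D \<le> M2 / D" using M by (simp add: le_divide_eq)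
  have prof: "(x, ?d x) \<in> high_profile V D I" if "x \<in> V" "D \<le> real (?d x)" for x
    using that by (simp add: high_profile_def)
  have one: "{x, w} \<in> ?A" if "x \<in> V" "w \<in> V" "M1 \<le> real (?d x)" for x w
  proof -
    have "x \<in> fst ` {z \<in> high_profile V D I. M1 \<le> real (snd z)}"
      using that prof[of x] M(2) by (intro image_eqI[of _ _ "(x, ?d x)"]) auto
    then show ?thesis
      unfolding admissible_edges_def using that(2)
      by (intro UnI1 CollectI exI[of _ x] exI[of _ w] conjI refl SigmaI)
  qed
  have two: "{x, w} \<in> ?A" if xw: "x \<in> V" "w \<in> V" "D \<le> real (?d x)" "D \<le> real (?d w)" "M2 \<le> real (?d x) * real (?d w)" for x w
  proof -
    have "(x, w) \<in> (\<lambda>(x, y). (fst x, fst y)) ` {(x, y) \<in> high_profile V D I \<times> high_profile V D I. M2 \<le> real (snd x) * real (snd y)}"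
      using xw prof[of x] prof[of w] by (intro image_eqI[of _ _ "((x, ?d x), (w, ?d w))"]) auto
    then show ?thesis
      unfolding admissible_edges_def by (intro UnI1 UnI2 CollectI exI[of _ x] exI[of _ w] conjI refl)
  qed
  have three: "{x, w} \<in> ?A" if xw: "x \<in> V" "w \<in> V" "real (?d w) < D" "2 \<le> ?d w" "M2 \<le> real (?d x) * real (?d w)" for x w
  proof -
    have "real (?d x) * real (?d w) \<le> real (?d x) * D" using xw by (intro mult_left_mono) auto
    then have "M2 / D \<le> real (?d x)" using xw M by (simp add: divide_le_eq)
    moreover have "(x, ?d x) \<in> high_profile V D I" using prof xw(1) calculation MD by simp
    ultimately have "x \<in> fst ` {z \<in> high_profile V D I. M2 / D \<le> real (snd z)}"
      by (intro image_eqI[of _ _ "(x, ?d x)"]) auto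
    moreover have "w \<in> W" using W xw unfolding low_vertices_def by auto
    ultimately show ?thesis
      unfolding admissible_edges_def
      by (intro UnI2 CollectI exI[of _ x] exI[of _ w] conjI refl SigmaI)
  qed
  from rich e uv(1) consider "M1 \<le> real (?d u)" | "M1 \<le> real (?d v)"
    | "M2 \<le> real (?d u) * real (?d v)" "2 \<le> ?d u" "2 \<le> ?d v"
    unfolding degree_rich_def by blast
  then show "e \<in> ?A"
  proof cases
    case 1
    then show ?thesis using one[of u v] uv by simp
  next
    case 2
    then show ?thesis using one[of v u] uv by (simp add: insert_commute)
  next
    case 3
    consider "D \<le> real (?d u)" "D \<le> real (?d v)" | "real (?d u) < D" | "real (?d v) < D" by linarith
    then show ?thesis
      using two[of u v] three[of u v] three[of v u] uv 3
      by cases (simp_all add: mult.commute insert_commute)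
  qed
qed

text \<open>Two low vertices are never adjacent, so each edge is counted at most once below.\<close>

lemma low_vertices_le:
  assumes V: "finite V" and I: "I \<subseteq> all_edges V" and rich: "degree_rich M1 M2 I"
    and M: "0 < D" "D \<le> M1" "D * D \<le> M2"
  shows "2 * card (low_vertices V D I) \<le> card I"
proof -
  interpret edge_subset V I 0
    by unfold_locales (use V I in auto)
  let ?L = "low_vertices V D I"
  have finL: "finite ?L" using V unfolding low_vertices_def by simp
  have indep: "x \<notin> ?L" if w: "w \<in> ?L" and wx: "{w, x} \<in> I" for w x
  proof
    assume "x \<in> ?L"
    then have lt: "real (degree_in I w) < D" "real (degree_in I x) < D" using w unfolding low_vertices_def by auto
    then have "real (degree_in I w) * real (degree_in I x) < D * D"
      by (intro mult_strict_mono) (use M in auto)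
    moreover have "M1 \<le> real (degree_in I w) \<or> M1 \<le> real (degree_in I x) \<or>
        M2 \<le> real (degree_in I w) * real (degree_in I x)"
      using rich wx unfolding degree_rich_def by blast
    ultimately show False using lt M by linarith
  qed
  have "2 * card ?L = (\<Sum>w\<in>?L. 2)" by simp
  also have "\<dots> \<le> (\<Sum>w\<in>?L. card {x. {w, x} \<in> I})"
    by (intro sum_mono) (auto simp: low_vertices_def degree_in_def)
  also have "\<dots> = card (Sigma ?L (\<lambda>w. {x. {w, x} \<in> I}))"
    using finL finite_nbrs by (subst card_SigmaI) auto
  also have "\<dots> \<le> card I"
  proof (rule card_inj_on_le)
    show "inj_on (\<lambda>(w, x). {w, x}) (Sigma ?L (\<lambda>w. {x. {w, x} \<in> I}))"
    proof (rule inj_onI, clarify)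
      fix w x w' x'
      assume a: "w \<in> ?L" "{w, x} \<in> I" "w' \<in> ?L" "{w', x'} \<in> I" "{w, x} = {w', x'}"
      then have "x' \<notin> ?L" using indep by blast
      then have "w = w'" using a(1,5) by (auto simp: doubleton_eq_iff)
      then show "w = w' \<and> x = x'" using a(5) by (auto simp: doubleton_eq_iff)
    qed
  qed (use finI in auto)
  finally show ?thesis .
qed

lemma high_profile_facts:
  assumes V: "finite V" and I: "I \<subseteq> all_edges V"
  shows "high_profile V D I \<subseteq> V \<times> {..card V}"
    "(\<Sum>x\<in>high_profile V D I. real (snd x)) \<le> 2 * real (card I)"
    "real (card (high_profile V D I)) * D \<le> 2 * real (card I)"
proof -
  interpret edge_subset V I 0
    by unfold_locales (use V I in auto)
  have eq: "high_profile V D I = (\<lambda>v. (v, degree_in I v)) ` {v \<in> V. D \<le> real (degree_in I v)}"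
    by (auto simp: high_profile_def)
  have inj: "inj_on (\<lambda>v. (v, degree_in I v)) A" for A by (auto intro: inj_onI)
  show "high_profile V D I \<subseteq> V \<times> {..card V}"
    using degree_le_m by (auto simp: high_profile_def)
  have "(\<Sum>x\<in>high_profile V D I. real (snd x)) = (\<Sum>v | v \<in> V \<and> D \<le> real (degree_in I v). real (degree_in I v))"
    unfolding eq by (subst sum.reindex[OF inj]) simp
  also have "\<dots> \<le> (\<Sum>v\<in>V. real (degree_in I v))" using V by (intro sum_mono2) auto
  finally show 1: "(\<Sum>x\<in>high_profile V D I. real (snd x)) \<le> 2 * real (card I)"
    using handshake_real by simp
  have "real (card (high_profile V D I)) * D = (\<Sum>x\<in>high_profile V D I. D)" by simp
  also have "\<dots> \<le> (\<Sum>x\<in>high_profile V D I. real (snd x))"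
    by (intro sum_mono) (auto simp: high_profile_def)
  finally show "real (card (high_profile V D I)) * D \<le> 2 * real (card I)" using 1 by linarith
qed

text \<open>The weights \<open>z\<close>, \<open>w\<close>, \<open>y\<close> price a profile entry,
  a vertex of \<open>f I\<close> and an edge. The number of admissible edges is bounded by an affine
  function of |X|, so its exponential is geometric in |X| and the sum over codes factors into
  profiles and vertex sets.\<close>

lemma degree_rich_sum_le:
  fixes y z w :: real
  assumes V: "finite V"
    and \<I>: "\<And>I. I \<in> \<I> \<Longrightarrow> I \<subseteq> all_edges V \<and> card I = k \<and> degree_rich M1 M2 I"
    and M: "0 < D" "D \<le> M1" "D * D \<le> M2"
    and W: "\<And>I. I \<in> \<I> \<Longrightarrow> low_vertices V D I \<subseteq> f I \<and> f I \<in> \<W>" "\<W> \<subseteq> Pow V"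
    and y: "0 \<le> y" "0 \<le> z" "0 \<le> w"
  shows "(\<Sum>I\<in>\<I>. z ^ card (high_profile V D I) * w ^ card (f I) * y ^ card I)
    \<le> exp (z * real (card V * Suc (card V)))
       * exp (y * (2 * real k / M1 * real (card V) + (2 * real k)\<^sup>2 / M2))
       * (\<Sum>X\<in>\<W>. (w * exp (y * (2 * real k * D / M2))) ^ card X)"
proof -
  have M0: "0 < M1" "0 < M2" using M by (auto intro: less_le_trans mult_pos_pos)
  let ?P = "V \<times> {..card V}"
  let ?G = "{\<Gamma> \<in> Pow ?P. (\<Sum>x\<in>\<Gamma>. real (snd x)) \<le> 2 * real k}"
  let ?C = "?G \<times> \<W>"
  let ?B = "2 * real k / M1 * real (card V) + (2 * real k)\<^sup>2 / M2"
  let ?A = "2 * real k * D / M2"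
  have finP: "finite ?P" using V by simp
  have finW: "finite \<W>" using W(2) V finite_subset by blast
  have fin: "finite \<I>"
    by (rule finite_subset[of _ "Pow (all_edges V)"]) (use \<I> V finite_all_edges in auto)
  have "(\<Sum>I\<in>\<I>. z ^ card (high_profile V D I) * w ^ card (f I) * y ^ card I)
    \<le> (\<Sum>c\<in>?C. z ^ card (fst c) * w ^ card (snd c) * exp (y * (?B + ?A * real (card (snd c)))))"
  proof (rule sum_encoded_le[where code = "\<lambda>I. (high_profile V D I, f I)" and
      E = "\<lambda>c. admissible_edges V M1 M2 D (fst c) (snd c)" and
      \<phi> = "\<lambda>c. z ^ card (fst c) * w ^ card (snd c)", simplified fst_conv snd_conv])
    fix I assume I: "I \<in> \<I>"
    then show "(high_profile V D I, f I) \<in> ?C \<and> I \<subseteq> admissible_edges V M1 M2 D (high_profile V D I) (f I)"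
      using high_profile_facts[OF V, of I D] degree_rich_subset[OF V _ _ M] \<I>[OF I] W(1)[OF I] by auto
  next
    fix c assume c: "c \<in> ?C"
    have "finite (fst c)" by (rule finite_subset[OF _ finP]) (use c in auto)
    moreover have "snd c \<in> \<W>" using c by auto
    then have "finite (snd c)" using W(2) by (intro finite_subset[OF _ V]) blast
    ultimately show "finite (admissible_edges V M1 M2 D (fst c) (snd c))"
      "real (card (admissible_edges V M1 M2 D (fst c) (snd c))) \<le> ?B + ?A * real (card (snd c))"
      using admissible_edges_card[OF V _ _ M0 M(1), of "fst c" "2 * real k" "snd c"] c by auto
  next
    show "finite ?C" using finP finW by (intro finite_cartesian_product) auto
  next
    show "0 \<le> z ^ card (fst c) * w ^ card (snd c)" for c :: "('a \<times> nat) set \<times> 'a set"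
      using y by simp
  qed (rule fin, rule y(1))
  also have "\<dots> = (\<Sum>\<Gamma>\<in>?G. z ^ card \<Gamma>) * (exp (y * ?B) * (\<Sum>X\<in>\<W>. (w * exp (y * ?A)) ^ card X))"
  proof -
    have "(\<Sum>c\<in>?C. z ^ card (fst c) * w ^ card (snd c) * exp (y * (?B + ?A * real (card (snd c)))))
      = (\<Sum>c\<in>?C. z ^ card (fst c) * (exp (y * ?B) * (w * exp (y * ?A)) ^ card (snd c)))"
    proof (intro sum.cong refl)
      fix c :: "('a \<times> nat) set \<times> 'a set"
      have "exp (y * (?B + ?A * real (card (snd c)))) = exp (y * ?B) * exp (y * ?A) ^ card (snd c)"
        by (simp only: exp_of_nat_mult[symmetric] exp_add[symmetric] distrib_left ac_simps)
      then show "z ^ card (fst c) * w ^ card (snd c) * exp (y * (?B + ?A * real (card (snd c))))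
        = z ^ card (fst c) * (exp (y * ?B) * (w * exp (y * ?A)) ^ card (snd c))"
        by (simp only: power_mult_distrib mult_ac)
    qed
    also have "\<dots> = (\<Sum>\<Gamma>\<in>?G. z ^ card \<Gamma>) * (\<Sum>X\<in>\<W>. exp (y * ?B) * (w * exp (y * ?A)) ^ card X)"
    proof -
      have "(\<Sum>c\<in>A \<times> B. g (fst c) * h (snd c)) = sum g A * sum h B"
        for A :: "('a \<times> nat) set set" and B :: "'a set set" and g h :: "_ \<Rightarrow> real"
        by (simp add: sum_product sum.cartesian_product case_prod_unfold)
      then show ?thesis .
    qed
    also have "(\<Sum>X\<in>\<W>. exp (y * ?B) * (w * exp (y * ?A)) ^ card X) = exp (y * ?B) * (\<Sum>X\<in>\<W>. (w * exp (y * ?A)) ^ card X)"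
      by (rule sum_distrib_left[symmetric])
    finally show ?thesis .
  qed
  also have "\<dots> \<le> exp (z * real (card V * Suc (card V))) * (exp (y * ?B) * (\<Sum>X\<in>\<W>. (w * exp (y * ?A)) ^ card X))"
  proof (rule mult_right_mono)
    have "(\<Sum>\<Gamma>\<in>?G. z ^ card \<Gamma>) \<le> (\<Sum>\<Gamma>\<in>Pow ?P. z ^ card \<Gamma>)"
      using finP y by (intro sum_mono2) auto
    also have "\<dots> \<le> exp (z * real (card ?P))"
      by (rule sum_Pow_power_le_exp[OF finP y(2)])
    finally show "(\<Sum>\<Gamma>\<in>?G. z ^ card \<Gamma>) \<le> exp (z * real (card V * Suc (card V)))"
      by (simp add: card_cartesian_product)
  qed (use y in \<open>auto intro!: mult_nonneg_nonneg sum_nonneg\<close>)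
  finally show ?thesis by (simp only: mult.assoc)
qed

text \<open>With r the fourth root of x, ln x = 4 ln r <= 4 (r - 1), so 1 + ln x <= 5 r.\<close>

lemma one_plus_ln_sq_le:
  fixes x :: real
  assumes "1 \<le> x"
  shows "(1 + ln x)\<^sup>2 \<le> 25 * sqrt x"
proof -
  let ?r = "sqrt (sqrt x)"
  have r: "1 \<le> ?r" "?r ^ 4 = x" "?r\<^sup>2 = sqrt x"
    using assms by (auto simp: power4_eq_xxxx real_sqrt_mult_self mult.assoc)
  have "ln x = 4 * ln ?r"
    using r by (metis ln_realpow of_nat_numeral less_le_trans zero_less_one)
  moreover have "ln ?r \<le> ?r - 1" using r by (intro ln_le_minus_one) auto
  ultimately have "1 + ln x \<le> 5 * ?r" using r by linarith
  then have "(1 + ln x)\<^sup>2 \<le> (5 * ?r)\<^sup>2"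
    using assms by (intro power_mono) auto
  then show ?thesis using r by (simp add: power_mult_distrib)
qed

text \<open>With p = y^4, the factor p^k splits into y^k for the edges, y^(2k) for the low vertices
  and y^k as gain. Profiles cost only exp (k), since entries have degree at least D, hence number at
  most 2k / D, and D exceeds 4 ln m.\<close>

lemma card_degree_rich_le:
  fixes p q H :: real
  assumes V: "finite V" and q_def: "q = real (card V) * p"
    and \<I>: "\<And>I. I \<in> \<I> \<Longrightarrow> I \<subseteq> all_edges V \<and> card I = k \<and>
      degree_rich (real (card V) / H ^ t) (q\<^sup>2 / H ^ t) I"
    and H: "4 \<le> H" "8 * real j * ln H \<le> H" and p: "p = 1 / H ^ (4 * j)" and j: "t + 5 \<le> j"
    and q: "H ^ (t + 5) \<le> q" and k: "1 \<le> k" "3 * q \<le> real k" "2 * real k \<le> H * q\<^sup>2"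
  shows "real (card \<I>) * p ^ k \<le> (1 / H ^ j) ^ k * exp (5 * real k)"
proof -
  define m where "m = real (card V)"
  define y where "y = 1 / H ^ j"
  define D where "D = H * (1 + ln m)"
  define z where "z = 1 / m\<^sup>2"
  define M1 where "M1 = m / H ^ t"
  define M2 where "M2 = q\<^sup>2 / H ^ t"
  have Hp: "0 < H" and H1: "1 \<le> H" using H by auto
  have Hpow: "1 \<le> H ^ i" for i using H1 by (rule one_le_power)
  have q1: "1 \<le> q" using Hpow[of "t + 5"] q by linarith
  have y: "0 < y" "y \<le> 1" "p = y ^ 4"
    using Hp Hpow[of j] by (auto simp: y_def p power_divide power_mult[symmetric] mult.commute)
  have p0: "0 < p" "p \<le> 1" using y by (auto intro: power_le_one)
  have mq: "m = q * H ^ (4 * j)"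
    using Hp by (simp add: q_def p m_def)
  have mqle: "q * 1 \<le> m" unfolding mq using q1 Hpow by (intro mult_left_mono) auto
  then have m1: "1 \<le> m" using q1 by simp
  have lnm: "0 \<le> ln m" using m1 by simp
  have D1: "1 \<le> D" using H1 lnm mult_mono[of 1 H 1 "1 + ln m"] by (simp add: D_def)
  have yH: "y * H ^ i \<le> 1" if "i \<le> j" for i
    using that Hp H1 by (simp add: y_def divide_le_eq power_increasing)
  \<comment> \<open>Note q p = m p^2. Below 1 it makes m a bounded power of H, so that ln m <= H;
    above 1 the excess of ln m is absorbed by q p.\<close>
  have small_or: "(q * p < 1 \<and> ln m \<le> H) \<or> (1 \<le> q * p \<and> ln m \<le> q * p + H)"
  proof -
    have "m = (q * p) * H ^ (8 * j)"
    proof -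
      have "H ^ (8 * j) = H ^ (4 * j) * H ^ (4 * j)" by (simp add: power_add[symmetric])
      then show ?thesis unfolding mq p using Hp by simp
    qed
    moreover have "0 < q * p" using q1 p0 by simp
    ultimately have "ln m = ln (q * p) + 8 * real j * ln H"
      using Hp ln_mult_pos[of "q * p" "H ^ (8 * j)"] by (simp only: ln_realpow zero_less_power)
    moreover have "ln (q * p) \<le> q * p - 1" using \<open>0 < q * p\<close> by (rule ln_le_minus_one)
    ultimately show ?thesis using H(2) by linarith
  qed
  \<comment> \<open>For m p^2 < 1, D^2 is at most H^5 and q is at least H^(t+5). Otherwise (ln m)^2
    is compared with sqrt m, and m <= q^2 reduces both claims to the one for m.\<close>
  have DD: "D * D * H ^ t \<le> q\<^sup>2 \<and> D * D * H ^ t \<le> m"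
  proof (cases "q * p < 1")
    case True
    then have "ln m \<le> H" using small_or by auto
    then have "D \<le> H * (H * 2)" unfolding D_def using H by (intro mult_left_mono) auto
    then have "D * D \<le> (H * (H * 2)) * (H * (H * 2))"
      using D1 by (intro mult_mono) auto
    also have "\<dots> = H ^ 4 * 4" by (simp add: power4_eq_xxxx)
    also have "\<dots> \<le> H ^ 4 * H" using H by (intro mult_left_mono) auto
    finally have "D * D * H ^ t \<le> H ^ 4 * H * H ^ t" using Hp by (intro mult_right_mono) auto
    also have "\<dots> = H ^ (t + 5)" by (simp add: power_add power4_eq_xxxx eval_nat_numeral)
    finally have "D * D * H ^ t \<le> q" using q by linarith
    moreover have "q * 1 \<le> q * q" using q1 by (intro mult_left_mono) auto
    ultimately show ?thesis using mqle by (simp add: power2_eq_square)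
  next
    case False
    have "D * D * H ^ t = H ^ (t + 2) * (1 + ln m)\<^sup>2"
      by (simp add: D_def power2_eq_square power_add)
    also have "\<dots> \<le> H ^ (t + 2) * (25 * sqrt m)"
      using Hp by (intro mult_left_mono one_plus_ln_sq_le m1) auto
    also have "\<dots> \<le> H ^ (t + 2) * (H ^ 3 * sqrt m)"
    proof -
      have "(4::real) ^ 3 \<le> H ^ 3" using H by (intro power_mono) auto
      then have "25 * sqrt m \<le> H ^ 3 * sqrt m" using m1 by (intro mult_right_mono) auto
      then show ?thesis using Hp by (intro mult_left_mono) auto
    qed
    also have "\<dots> = H ^ (t + 5) * sqrt m" by (simp add: power_add eval_nat_numeral)
    also have "\<dots> \<le> sqrt m * sqrt m"
    proof (intro mult_right_mono real_le_rsqrt)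
      have "(H ^ (t + 5))\<^sup>2 = H ^ (t + 5) * H ^ (t + 5)" by (simp add: power2_eq_square)
      also have "\<dots> \<le> q * H ^ (4 * j)"
        using q q1 H1 j Hp by (intro mult_mono power_increasing) auto
      finally show "(H ^ (t + 5))\<^sup>2 \<le> m" by (simp only: mq)
    qed (use m1 in simp)
    also have "\<dots> = m" using m1 by simp
    finally have "D * D * H ^ t \<le> m" .
    moreover have "m * 1 \<le> m * (q * p)" using False m1 by (intro mult_left_mono) auto
    then have "m \<le> q\<^sup>2" by (simp add: q_def m_def power2_eq_square mult_ac)
    ultimately show ?thesis by linarith
  qed
  have M: "0 < D" "D \<le> M1" "D * D \<le> M2"
  proof -
    have "D * 1 * H ^ t \<le> D * D * H ^ t"
      using D1 Hp by (intro mult_right_mono mult_left_mono) auto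
    then show "D \<le> M1" "D * D \<le> M2"
      using DD Hp by (auto simp: M1_def M2_def le_divide_eq)
  qed (use D1 in simp)
  have rich: "I \<subseteq> all_edges V \<and> card I = k \<and> degree_rich M1 M2 I" if "I \<in> \<I>" for I
    using \<I>[OF that] by (simp add: M1_def M2_def m_def)
  have z: "0 \<le> z" by (simp add: z_def)
  \<comment> \<open>The price 1 / m^2 per entry is small enough for the sum over all m (m + 1)
    conceivable entries to stay at most 2, yet its total is no smaller than exp (-k).\<close>
  have zle: "exp (- real k) \<le> z ^ card (high_profile V D I)" if "I \<in> \<I>" for I
  proof -
    let ?n = "real (card (high_profile V D I))"
    have "?n * D \<le> 2 * real k"
      using high_profile_facts(3)[OF V, of I D] \<I>[OF that] by auto
    moreover have "?n * (4 * ln m) \<le> ?n * D"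
      unfolding D_def using H lnm by (intro mult_left_mono mult_mono) auto
    ultimately have "?n * (2 * ln m) \<le> real k" by linarith
    moreover have "z ^ card (high_profile V D I) = exp (- (?n * (2 * ln m)))"
    proof -
      have "z = exp (- (2 * ln m))"
      proof -
        have "exp (2 * ln m) = m\<^sup>2"
          using m1 by (simp only: exp_double) simp
        then show ?thesis unfolding z_def exp_minus by (simp add: inverse_eq_divide)
      qed
      then have "z ^ card (high_profile V D I) = exp (- (2 * ln m)) ^ card (high_profile V D I)"
        by (rule arg_cong)
      also have "\<dots> = exp (?n * (- (2 * ln m)))"
        by (rule exp_of_nat_mult[symmetric])
      finally show ?thesis by simp
    qed
    ultimately show ?thesis by simp
  qed
  have zm: "z * real (card V * Suc (card V)) \<le> 2"
  proof -
    have "z * real (card V * Suc (card V)) = (m * (1 + m)) / (m * m)"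
    proof -
      have "real (card V * Suc (card V)) = m * (1 + m)" by (simp add: m_def distrib_left)
      then show ?thesis by (simp add: z_def power2_eq_square)
    qed
    also have "\<dots> = (1 + m) / m" using m1 by simp
    also have "\<dots> \<le> 2" using m1 by (simp add: divide_le_eq)
    finally show ?thesis .
  qed
  let ?B = "2 * real k / M1 * real (card V) + (2 * real k)\<^sup>2 / M2"
  let ?A = "2 * real k * D / M2"
  have B: "y * ?B \<le> real k"
  proof -
    have "2 * real k / M1 * real (card V) = 2 * real k * H ^ t"
      using m1 Hp by (simp add: M1_def m_def[symmetric])
    moreover have "(2 * real k)\<^sup>2 / M2 = (2 * real k * H ^ t) * (2 * real k / q\<^sup>2)"
      using q1 Hp by (simp add: M2_def power2_eq_square)
    moreover have "\<dots> \<le> (2 * real k * H ^ t) * H"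
      using k(3) q1 Hp by (intro mult_left_mono) (auto simp: divide_le_eq)
    ultimately have "?B \<le> real k * H ^ t * (2 + 2 * H)" by (simp add: algebra_simps)
    also have "\<dots> \<le> real k * H ^ t * (H * H)"
    proof -
      have "4 * H \<le> H * H" using H by (intro mult_right_mono) auto
      then have "2 + 2 * H \<le> H * H" using H by linarith
      then show ?thesis using Hp by (intro mult_left_mono) auto
    qed
    also have "\<dots> = real k * H ^ (t + 2)" by (simp add: power_add power2_eq_square)
    finally have "y * ?B \<le> y * (real k * H ^ (t + 2))" using y by (intro mult_left_mono) auto
    also have "\<dots> = real k * (y * H ^ (t + 2))" by simp
    also have "\<dots> \<le> real k * 1" using j by (intro mult_left_mono yH) auto
    finally show ?thesis by simp
  qed
  have A: "?A = (2 * real k / q\<^sup>2) * (D * H ^ t)"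
    using Hp q1 by (simp add: M2_def)
  \<comment> \<open>For m p^2 < 1 the low vertices are encoded exactly, at price p each; they number
    at most k/2, which y^(2k) covers. Otherwise all of \<open>V\<close> is allowed free of charge:
    the partners of low vertices are so few that every edge to them is affordable.\<close>
  obtain f \<W> w where W: "\<And>I. I \<in> \<I> \<Longrightarrow> low_vertices V D I \<subseteq> f I \<and> f I \<in> \<W>" "\<W> \<subseteq> Pow V"
    and w: "0 \<le> w" "\<And>I. I \<in> \<I> \<Longrightarrow> y ^ (2 * k) \<le> w ^ card (f I)"
    and SW: "(\<Sum>X\<in>\<W>. (w * exp (y * ?A)) ^ card X) \<le> exp (real k)"
  proof (cases "q * p < 1")
    case True
    have lowle: "2 * card (low_vertices V D I) \<le> k" if "I \<in> \<I>" for I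
      using low_vertices_le[OF V _ _ M, of I] rich[OF that] by auto
    have "?A \<le> H * (D * H ^ t)"
      unfolding A using k(3) q1 D1 Hp by (intro mult_right_mono) (auto simp: divide_le_eq)
    also have "\<dots> \<le> H * ((H * (1 + H)) * H ^ t)"
      unfolding D_def using small_or True Hp by (intro mult_right_mono mult_left_mono) auto
    also have "\<dots> \<le> H * ((H * (H * H)) * H ^ t)"
    proof -
      have "4 * H \<le> H * H" using H by (intro mult_right_mono) auto
      then have "1 + H \<le> H * H" using H by linarith
      then show ?thesis using Hp by (intro mult_right_mono mult_left_mono) auto
    qed
    also have "\<dots> = H ^ (t + 4)" by (simp add: power_add eval_nat_numeral)
    finally have "y * ?A \<le> y * H ^ (t + 4)" using Hp y by (intro mult_left_mono) auto
    also have "\<dots> \<le> 1" using j by (intro yH) auto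
    finally have yA: "exp (y * ?A) \<le> 3"
      using exp_le by (metis exp_le_cancel_iff order_trans)
    show ?thesis
    proof (rule that[of "low_vertices V D" "Pow V" p])
      show "y ^ (2 * k) \<le> p ^ card (low_vertices V D I)" if "I \<in> \<I>" for I
        unfolding y(3) power_mult[symmetric] using lowle[OF that] y by (intro power_decreasing) auto
      have "p * exp (y * ?A) * real (card V) \<le> p * 3 * real (card V)"
        using p0 yA by (intro mult_right_mono mult_left_mono) auto
      also have "\<dots> = 3 * q" by (simp add: q_def)
      also have "\<dots> \<le> real k" by (rule k(2))
      finally have "exp (p * exp (y * ?A) * real (card V)) \<le> exp (real k)" by simp
      moreover have "(\<Sum>X\<in>Pow V. (p * exp (y * ?A)) ^ card X) \<le> exp (p * exp (y * ?A) * real (card V))"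
        using p0 by (intro sum_Pow_power_le_exp V) auto
      ultimately show "(\<Sum>X\<in>Pow V. (p * exp (y * ?A)) ^ card X) \<le> exp (real k)" by (rule order_trans[rotated])
    qed (use p0 in \<open>auto simp: low_vertices_def\<close>)
  next
    case False
    then have lnm2: "1 \<le> q * p" "ln m \<le> q * p + H" using small_or by auto
    have Am: "y * ?A * m \<le> real k"
    proof -
      \<comment> \<open>\<open>?A\<close> bounds the number of possible partners, so
        \<open>?A * m\<close> bounds the edges of the third family; D / (q p) is at most a power of
        H because ln m <= q p + H.\<close>
      have "?A * m = 2 * real k * H ^ t * (D / (q * p))"
        unfolding A using q1 p0 m1 by (simp add: q_def m_def[symmetric] power2_eq_square field_simps)
      also have "\<dots> \<le> 2 * real k * H ^ t * (H * (2 + H))"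
      proof (rule mult_left_mono)
        have "H * 1 \<le> H * (q * p)"
          using Hp by (intro mult_left_mono lnm2(1)) simp
        then have "1 + ln m \<le> q * p + (q * p) + H * (q * p)"
          using lnm2 by linarith
        then have "D \<le> H * (q * p + (q * p) + H * (q * p))"
          unfolding D_def using Hp by (intro mult_left_mono) auto
        also have "\<dots> = H * (2 + H) * (q * p)" by (simp add: algebra_simps)
        finally show "D / (q * p) \<le> H * (2 + H)" using lnm2(1) by (simp add: divide_le_eq)
      qed (use Hp in simp)
      also have "\<dots> \<le> real k * H ^ (t + 3)"
      proof -
        have "4 * H \<le> H * H" using H by (intro mult_right_mono) auto
        moreover have "2 * (2 + H) \<le> 4 * H" using H(1) by simp
        ultimately have "2 * (2 + H) \<le> H * H" by (rule order_trans[rotated])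
        then have "real k * H ^ t * H * (2 * (2 + H)) \<le> real k * H ^ t * H * (H * H)"
          using Hp by (intro mult_left_mono) auto
        then show ?thesis by (simp only: power_add power3_eq_cube mult_ac)
      qed
      finally have "y * (?A * m) \<le> y * (real k * H ^ (t + 3))"
        using Hp y by (intro mult_left_mono) auto
      also have "\<dots> = real k * (y * H ^ (t + 3))" by simp
      also have "\<dots> \<le> real k * 1" using j by (intro mult_left_mono yH) auto
      finally show ?thesis by (simp add: mult.assoc)
    qed
    show ?thesis
    proof (rule that[of "\<lambda>_. V" "{V}" 1])
      have "exp (y * ?A) ^ card V = exp (y * ?A * m)"
        by (simp add: exp_of_nat_mult[symmetric] m_def mult.commute)
      then show "(\<Sum>X\<in>{V}. (1 * exp (y * ?A)) ^ card X) \<le> exp (real k)"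
        using Am by simp
    qed (use y in \<open>auto simp: low_vertices_def intro: power_le_one\<close>)
  qed
  have "real (card \<I>) * p ^ k = (\<Sum>I\<in>\<I>. p ^ k)" by simp
  also have "\<dots> \<le> (\<Sum>I\<in>\<I>. y ^ k * exp (real k) * (z ^ card (high_profile V D I) * w ^ card (f I) * y ^ card I))"
  proof (rule sum_mono)
    fix I assume I: "I \<in> \<I>"
    \<comment> \<open>The inserted 1 = exp (k) exp (-k) pays for the profile.\<close>
    have "p ^ k = y ^ k * (1 * y ^ (2 * k)) * y ^ k"
      unfolding y(3) by (simp add: power_mult[symmetric] power_add[symmetric])
    also have "1 = exp (real k) * exp (- real k)" by (simp add: exp_minus)
    also have "y ^ k * (exp (real k) * exp (- real k) * y ^ (2 * k)) * y ^ k
      \<le> y ^ k * (exp (real k) * z ^ card (high_profile V D I) * w ^ card (f I)) * y ^ k"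
      using y zle[OF I] w(2)[OF I] z by (intro mult_right_mono mult_left_mono mult_mono) auto
    finally show "p ^ k \<le> y ^ k * exp (real k) * (z ^ card (high_profile V D I) * w ^ card (f I) * y ^ card I)"
      using \<I>[OF I] by (simp add: mult_ac)
  qed
  also have "\<dots> = y ^ k * exp (real k) * (\<Sum>I\<in>\<I>. z ^ card (high_profile V D I) * w ^ card (f I) * y ^ card I)"
    by (simp add: sum_distrib_left)
  also have "\<dots> \<le> y ^ k * exp (real k) * (exp (z * real (card V * Suc (card V))) * exp (y * ?B)
       * (\<Sum>X\<in>\<W>. (w * exp (y * ?A)) ^ card X))"
    using y by (intro mult_left_mono degree_rich_sum_le[OF V rich M W _ z w(1)]) auto
  also have "\<dots> \<le> y ^ k * exp (real k) * (exp 2 * exp (real k) * exp (real k))"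
    using y zm B SW w(1) by (intro mult_left_mono mult_mono) (auto intro!: sum_nonneg)
  also have "\<dots> = y ^ k * exp (3 * real k + 2)"
    by (simp add: exp_add[symmetric])
  also have "\<dots> \<le> y ^ k * exp (5 * real k)"
    using y k(1) by (intro mult_left_mono) auto
  finally show ?thesis by (simp add: y_def)
qed

section \<open>Summation over all cores\<close>

lemma (in edge_subset) core_sum_eq_through:
  "3 \<le> l \<Longrightarrow> (\<Sum>\<alpha> | \<alpha> \<in> cycles l V \<and> {u, v} \<in> \<alpha>. p ^ card (\<alpha> - I)) = (\<Sum>\<alpha>\<in>through l u v. p ^ card (\<alpha> - I))"
  by (simp add: through_def)

lemma sum_geometric_le:
  fixes r :: real
  assumes "0 \<le> r" "r \<le> 1 / 2" "finite S" "\<And>k. k \<in> S \<Longrightarrow> k0 \<le> k"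
  shows "(\<Sum>k\<in>S. r ^ k) \<le> 2 * r ^ k0"
proof -
  have s: "summable (\<lambda>k. r ^ (k + k0))" "(\<Sum>k. r ^ (k + k0)) = r ^ k0 * (1 / (1 - r))"
    using assms(1,2) suminf_mult[of "\<lambda>k. r ^ k" "r ^ k0"] suminf_geometric[of r] summable_geometric[of r]
    by (auto simp: power_add mult.commute intro: summable_mult2)
  have "inj_on (\<lambda>k. k - k0) S" using assms(4) by (intro inj_onI) (metis eq_diff_iff)
  then have "(\<Sum>k\<in>(\<lambda>k. k - k0) ` S. r ^ (k + k0)) = (\<Sum>k\<in>S. r ^ k)"
    using assms(4) by (simp add: sum.reindex)
  moreover have "(\<Sum>k\<in>(\<lambda>k. k - k0) ` S. r ^ (k + k0)) \<le> (\<Sum>k. r ^ (k + k0))"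
    using assms(1,3) by (intro sum_le_suminf s) auto
  moreover have "r ^ k0 * (1 / (1 - r)) \<le> r ^ k0 * 2"
    using assms(1,2) by (intro mult_left_mono) (auto simp: divide_le_eq)
  ultimately show ?thesis using s(2) by linarith
qed

text \<open>The two structures are complementary: up to q = H^(2l + 5) cores are dense, beyond it
  they are \<open>degree_rich\<close> and q exceeds the powers of H lost in the degree
  count.\<close>

lemma card_cores_le:
  fixes p q H \<epsilon> :: real
  assumes V: "finite V" and l: "3 \<le> l" and q_def: "q = real (card V) * p"
    and p: "p = 1 / H ^ (12 * l\<^sup>2 * (2 * l + 5))" and q1: "1 \<le> q" and \<epsilon>: "0 < \<epsilon>"
    and H: "4 \<le> H" "24 * (real l)\<^sup>2 * (2 * real l + 5) * ln H \<le> H" "exp (5 + 3 / \<epsilon>) \<le> H"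
    and k: "1 \<le> k" "\<epsilon> * q\<^sup>2 \<le> real k" "2 * real k \<le> H * q\<^sup>2" "real k \<le> q ^ l"
    and C: "\<And>I. I \<in> \<C> \<Longrightarrow> I \<subseteq> all_edges V \<and> card I = k"
    and core: "\<And>I u v. I \<in> \<C> \<Longrightarrow> {u, v} \<in> I \<Longrightarrow>
      4 \<le> (\<Sum>\<alpha> | \<alpha> \<in> cycles l V \<and> {u, v} \<in> \<alpha>. p ^ card (\<alpha> - I)) \<and>
      4 * (q ^ (l - 2) / H) \<le> (\<Sum>\<alpha> | \<alpha> \<in> cycles l V \<and> {u, v} \<in> \<alpha>. p ^ card (\<alpha> - I))"
  shows "real (card \<C>) * p ^ k \<le> (1 / H) ^ k"
proof -
  define J1 where "J1 = 2 * l + 5"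
  define J where "J = 12 * l\<^sup>2 * J1"
  have Hp: "0 < H" and H1: "1 \<le> H" using H by auto
  have pJ: "p = 1 / H ^ J" using p by (simp add: J_def J1_def)
  have p01: "0 \<le> p" "p \<le> 1" using one_le_power[OF H1, of J] by (auto simp: pJ)
  have pH: "p * H ^ J = 1" using Hp by (simp add: pJ)
  have ll: "3 * l \<le> l\<^sup>2" using l by (simp add: power2_eq_square)
  have es: "edge_subset V I p" if "I \<in> \<C>" for I
    using V C[OF that] p01 by unfold_locales auto
  have exps: "exp 5 \<le> H" "3 / \<epsilon> \<le> H" "exp (1 + 1 / \<epsilon>) \<le> H"
  proof -
    show "exp 5 \<le> H" using H(3) \<epsilon> by (smt (verit) exp_le_cancel_iff divide_pos_pos)
    have "1 + 1 / \<epsilon> \<le> 5 + 3 / \<epsilon>"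
      using \<epsilon> by (intro add_mono divide_right_mono) auto
    then have "exp (1 + 1 / \<epsilon>) \<le> exp (5 + 3 / \<epsilon>)" by simp
    then show "exp (1 + 1 / \<epsilon>) \<le> H" using H(3) by linarith
    show "3 / \<epsilon> \<le> H" using H(3) exp_ge_add_one_self[of "5 + 3 / \<epsilon>"] by linarith
  qed
  show ?thesis
  proof (cases "q \<le> H ^ J1")
    case True
    \<comment> \<open>Chosen so that p = y^(4l), while k <= q^l <= H^(l J1) gives y k <= 1.\<close>
    define y where "y = 1 / H ^ (3 * l * J1)"
    have y: "0 \<le> y" "y \<le> 1" using one_le_power[OF H1, of "3 * l * J1"] by (auto simp: y_def)
    have "real k \<le> (H ^ J1) ^ l"
      using k(4) True q1 by (meson order_trans power_mono zero_le_one)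
    also have "\<dots> \<le> H ^ (3 * l * J1)"
      using H1 by (simp add: power_mult[symmetric] power_increasing)
    finally have yk: "y * real k \<le> 1" using Hp by (simp add: y_def divide_le_eq)
    have py: "p = y ^ (4 * l)"
      by (simp add: pJ y_def J_def power_divide power_mult[symmetric] power2_eq_square mult_ac)
    have "2 * l + 3 * l * J1 \<le> 5 * l * J1" by (simp add: J1_def)
    also have "\<dots> \<le> 12 * l\<^sup>2 * J1"
      using ll by (intro mult_right_mono) auto
    finally have JJ: "2 * l + 3 * l * J1 \<le> J" by (simp add: J_def)
    have dense: "2 * l * card (\<Union> I) + card I \<le> 2 * l * card I" if IC: "I \<in> \<C>" for I
    proof (rule dense_of_two_cycles[OF l])
      interpret edge_subset V I p by (rule es[OF IC])
      show "finite I" by (rule finI)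
      show "I \<subseteq> all_edges V" using C[OF IC] by auto
      fix e assume e: "e \<in> I"
      then obtain u v where uv: "e = {u, v}" using C[OF IC] by (meson all_edgesE subsetD)
      show "\<exists>\<alpha> \<beta>. \<alpha> \<in> cycles l V \<and> \<beta> \<in> cycles l V \<and> \<alpha> \<noteq> \<beta> \<and> \<alpha> \<subseteq> I \<and> \<beta> \<subseteq> I \<and> e \<in> \<alpha> \<and> e \<in> \<beta>"
        unfolding uv
      proof (rule core_edge_two_cycles[OF l _ H(1) _ pH JJ])
        show "4 \<le> (\<Sum>\<alpha>\<in>through l u v. p ^ card (\<alpha> - I))"
          using core[OF IC, of u v] e uv core_sum_eq_through[OF l, of u v] by auto
      qed (use e uv k q1 True C[OF IC] in \<open>auto simp: q_def[symmetric]\<close>)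
    qed
    have "real (card \<C>) * p ^ k \<le> y ^ k * exp (p * real (card V) + real k)"
      by (rule card_dense_graphs_le[OF V _ _ y yk py]) (use l C dense in auto)
    also have "\<dots> \<le> y ^ k * exp (real k * (1 + 1 / \<epsilon>))"
    proof -
      have "q * 1 \<le> q * q" using q1 by (intro mult_left_mono) auto
      also have "\<dots> \<le> real k / \<epsilon>"
        using k(2) \<epsilon> by (simp add: le_divide_eq power2_eq_square mult_ac)
      finally have "p * real (card V) + real k \<le> real k * (1 + 1 / \<epsilon>)"
        by (simp add: q_def algebra_simps)
      then show ?thesis using y by (intro mult_left_mono) auto
    qed
    also have "\<dots> = (y * exp (1 + 1 / \<epsilon>)) ^ k"
      by (simp add: power_mult_distrib exp_of_nat_mult[symmetric])
    also have "\<dots> \<le> (1 / H) ^ k"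
    proof (rule power_mono)
      have "2 * 1 \<le> 3 * l * J1" using l by (intro mult_mono) (auto simp: J1_def)
      then have "H ^ 2 \<le> H ^ (3 * l * J1)"
        using H1 by (intro power_increasing) auto
      then have "y \<le> 1 / H ^ 2" unfolding y_def using Hp by (intro divide_left_mono) auto
      then have "y * exp (1 + 1 / \<epsilon>) \<le> 1 / H ^ 2 * H"
        using exps y Hp by (intro mult_mono) auto
      then show "y * exp (1 + 1 / \<epsilon>) \<le> 1 / H" using Hp by (simp add: power2_eq_square)
    qed (use y in auto)
    finally show ?thesis .
  next
    case False
    then have qJ: "H ^ J1 \<le> q" by simp
    \<comment> \<open>The degree count needs p to be the fourth power of y = H^(-j).\<close>
    define j where "j = 3 * l\<^sup>2 * J1"
    have Jj: "J = 4 * j" by (simp add: J_def j_def)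
    have qH: "H \<le> q"
    proof -
      have "H ^ 1 \<le> H ^ J1" using H1 by (intro power_increasing) (auto simp: J1_def)
      then show ?thesis using qJ by simp
    qed
    have "2 * l \<le> J1 * 1" by (simp add: J1_def)
    also have "\<dots> \<le> J1 * (12 * l\<^sup>2)" using l by (intro mult_left_mono) auto
    finally have JJ: "2 * l \<le> J" by (simp add: J_def mult_ac)
    have rich: "degree_rich (real (card V) / H ^ (2 * l)) (q\<^sup>2 / H ^ (2 * l)) I" if IC: "I \<in> \<C>" for I
      unfolding degree_rich_def
    proof (intro allI impI)
      interpret edge_subset V I p by (rule es[OF IC])
      fix u v assume uv: "{u, v} \<in> I"
      show "real (card V) / H ^ (2 * l) \<le> real (degree_in I u) \<or>
        real (card V) / H ^ (2 * l) \<le> real (degree_in I v) \<or>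
        q\<^sup>2 / H ^ (2 * l) \<le> real (degree_in I u) * real (degree_in I v) \<and> 2 \<le> degree_in I u \<and> 2 \<le> degree_in I v"
        unfolding q_def
      proof (rule core_edge_degrees[OF l uv H(1) _ pH JJ])
        have "2 * H ^ (2 * l) \<le> H * H ^ (2 * l)" using H by (intro mult_right_mono) auto
        also have "\<dots> \<le> H ^ J1" unfolding power_Suc[symmetric] using H1 by (intro power_increasing) (auto simp: J1_def)
        finally show "2 * H ^ (2 * l) \<le> real (card V) * p" using qJ by (simp add: q_def)
        show "4 * ((real (card V) * p) ^ (l - 2) / H) \<le> (\<Sum>\<alpha>\<in>through l u v. p ^ card (\<alpha> - I))"
          using core[OF IC uv] core_sum_eq_through[OF l, of u v] by (simp add: q_def)
      qed (use k(3) C[OF IC] in \<open>auto simp: q_def\<close>)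
    qed
    have "real (card \<C>) * p ^ k \<le> (1 / H ^ j) ^ k * exp (5 * real k)"
    proof (rule card_degree_rich_le[OF V q_def _ H(1), where t = "2 * l"])
      show "8 * real j * ln H \<le> H" using H(2) by (simp add: j_def J1_def mult_ac)
      show "p = 1 / H ^ (4 * j)" using pJ Jj by simp
      have "1 * J1 \<le> 3 * l\<^sup>2 * J1" using l by (intro mult_right_mono) auto
      then show "2 * l + 5 \<le> j" by (simp add: j_def J1_def)
      show "H ^ (2 * l + 5) \<le> q" using qJ by (simp add: J1_def)
      \<comment> \<open>Here H >= 3/\<epsilon>, and q >= H supplies the second factor q.\<close>
      have "3 * q \<le> \<epsilon> * H * q" using exps(2) \<epsilon> q1 by (intro mult_right_mono) (auto simp: divide_le_eq mult.commute)
      also have "\<dots> \<le> \<epsilon> * q * q" using qH \<epsilon> q1 by (intro mult_right_mono mult_left_mono) auto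
      finally show "3 * q \<le> real k" using k(2) by (simp add: power2_eq_square mult.assoc)
    qed (use C rich k in auto)
    also have "\<dots> = (1 / H ^ j * exp 5) ^ k"
    proof -
      have "exp (5 * real k) = exp 5 ^ k" by (simp add: exp_of_nat_mult[symmetric] mult.commute)
      then show ?thesis by (simp only: power_mult_distrib)
    qed
    also have "\<dots> \<le> (1 / H) ^ k"
    proof (rule power_mono)
      have "H ^ 2 \<le> H ^ j"
      proof (rule power_increasing)
        have "1 * 1 * 5 \<le> 3 * l\<^sup>2 * J1" using l by (intro mult_mono) (auto simp: J1_def)
        then show "2 \<le> j" by (simp add: j_def)
      qed (use H1 in simp)
      then have "1 / H ^ j \<le> 1 / H ^ 2" using Hp by (intro divide_left_mono) auto
      then have "1 / H ^ j * exp 5 \<le> 1 / H ^ 2 * H"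
        using exps Hp by (intro mult_mono) auto
      then show "1 / H ^ j * exp 5 \<le> 1 / H" using Hp by (simp add: power2_eq_square)
    qed (use Hp in auto)
    finally show ?thesis .
  qed
qed

text \<open>Cores of size k contribute at most H^(-k), and sizes start at \<epsilon> q^2, so the
  geometric series is dominated by its first term.\<close>

lemma cores_sum_le:
  fixes p q H \<epsilon> :: real
  assumes V: "finite V" and l: "3 \<le> l" and q_def: "q = real (card V) * p"
    and p: "p = 1 / H ^ (12 * l\<^sup>2 * (2 * l + 5))" and q1: "1 \<le> q" and \<epsilon>: "0 < \<epsilon>"
    and H: "4 \<le> H" "24 * (real l)\<^sup>2 * (2 * real l + 5) * ln H \<le> H" "exp (5 + 3 / \<epsilon>) \<le> H"
    and C: "\<And>I. I \<in> \<C> \<Longrightarrow> I \<subseteq> all_edges V \<and> \<epsilon> * q\<^sup>2 \<le> real (card I) \<and>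
      2 * real (card I) \<le> H * q\<^sup>2 \<and> real (card I) \<le> q ^ l"
    and core: "\<And>I u v. I \<in> \<C> \<Longrightarrow> {u, v} \<in> I \<Longrightarrow>
      4 \<le> (\<Sum>\<alpha> | \<alpha> \<in> cycles l V \<and> {u, v} \<in> \<alpha>. p ^ card (\<alpha> - I)) \<and>
      4 * (q ^ (l - 2) / H) \<le> (\<Sum>\<alpha> | \<alpha> \<in> cycles l V \<and> {u, v} \<in> \<alpha>. p ^ card (\<alpha> - I))"
  shows "(\<Sum>I\<in>\<C>. p ^ card I) \<le> 2 * exp (- (\<epsilon> * q\<^sup>2 * ln H))"
proof -
  have Hp: "0 < H" and H1: "1 \<le> H" using H by auto
  have fin: "finite \<C>"
    by (rule finite_subset[of _ "Pow (all_edges V)"]) (use C V finite_all_edges in auto)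
  define k0 where "k0 = nat \<lceil>\<epsilon> * q\<^sup>2\<rceil>"
  have eq0: "0 < \<epsilon> * q\<^sup>2" using \<epsilon> q1 by simp
  have k0: "k0 \<le> card I" if "I \<in> \<C>" for I
    using C[OF that] by (simp add: k0_def nat_le_iff ceiling_le_iff)
  have "(\<Sum>I\<in>\<C>. p ^ card I) = (\<Sum>k\<in>card ` \<C>. \<Sum>I | I \<in> \<C> \<and> card I = k. p ^ card I)"
    by (rule sum.image_gen[OF fin])
  also have "\<dots> \<le> (\<Sum>k\<in>card ` \<C>. (1 / H) ^ k)"
  proof (rule sum_mono)
    fix k assume "k \<in> card ` \<C>"
    then obtain I where I: "I \<in> \<C>" "k = card I" by auto
    have "0 < real k" using C[OF I(1)] eq0 I(2) by linarith
    have "(\<Sum>I | I \<in> \<C> \<and> card I = k. p ^ card I) = real (card {I \<in> \<C>. card I = k}) * p ^ k"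
      by simp
    also have "\<dots> \<le> (1 / H) ^ k"
      by (rule card_cores_le[OF V l q_def p q1 \<epsilon> H]) (use C I core \<open>0 < real k\<close> in auto)
    finally show "(\<Sum>I | I \<in> \<C> \<and> card I = k. p ^ card I) \<le> (1 / H) ^ k" .
  qed
  also have "\<dots> \<le> 2 * (1 / H) ^ k0"
    using H k0 fin by (intro sum_geometric_le) (auto simp: field_simps)
  also have "(1 / H) ^ k0 = exp (- (real k0 * ln H))"
    using Hp by (simp add: exp_minus exp_of_nat_mult power_one_over inverse_eq_divide)
  also have "\<dots> \<le> exp (- (\<epsilon> * q\<^sup>2 * ln H))"
  proof -
    have "\<epsilon> * q\<^sup>2 \<le> real k0" unfolding k0_def by linarith
    then have "\<epsilon> * q\<^sup>2 * ln H \<le> real k0 * ln H" using H1 by (intro mult_right_mono) auto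
    then show ?thesis by simp
  qed
  finally show ?thesis by simp
qed

section \<open>The random graph and the tail bound\<close>

text \<open>The random graph without its constant vertex component.\<close>

definition edge_pmf :: "'e set \<Rightarrow> real \<Rightarrow> 'e set pmf" where
  "edge_pmf \<Omega> p = map_pmf (\<lambda>f. {e \<in> \<Omega>. f e}) (Pi_pmf \<Omega> False (\<lambda>_. bernoulli_pmf p))"

lemma random_graph_eq: "random_graph m p = map_pmf (Pair {..<m}) (edge_pmf (all_edges {..<m}) p)"
  by (simp add: random_graph_def edge_pmf_def map_pmf_comp)

lemma set_edge_pmf: "set_pmf (edge_pmf \<Omega> p) \<subseteq> Pow \<Omega>"
  by (auto simp: edge_pmf_def)

lemma finite_edge_pmf: "finite \<Omega> \<Longrightarrow> finite (set_pmf (edge_pmf \<Omega> p))"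
  by (rule finite_subset[OF set_edge_pmf]) simp

lemma prob_edge_pmf:
  assumes "finite \<Omega>" "0 \<le> p" "p \<le> 1" "S \<subseteq> \<Omega>"
  shows "measure_pmf.prob (edge_pmf \<Omega> p) {g. S \<subseteq> g} = p ^ card S"
proof -
  let ?B = "\<lambda>e. if e \<in> S then {True} else UNIV"
  have "measure_pmf.prob (edge_pmf \<Omega> p) {g. S \<subseteq> g}
    = measure_pmf.prob (Pi_pmf \<Omega> False (\<lambda>_. bernoulli_pmf p)) (Pi \<Omega> ?B)"
    unfolding edge_pmf_def measure_map_pmf
    by (rule arg_cong[where f = "measure_pmf.prob _"]) (use assms(4) in \<open>auto split: if_splits\<close>)
  also have "\<dots> = (\<Prod>e\<in>\<Omega>. measure_pmf.prob (bernoulli_pmf p) (?B e))"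
    by (rule measure_Pi_pmf_Pi[OF assms(1)])
  also have "\<dots> = (\<Prod>e\<in>\<Omega>. if e \<in> S then p else 1)"
    using assms by (intro prod.cong) (auto simp: measure_pmf_single)
  also have "\<dots> = p ^ card S"
    using assms by (simp add: prod.If_cases Int_absorb1)
  finally show ?thesis .
qed

lemma expectation_count:
  assumes \<Omega>: "finite \<Omega>" and p: "0 \<le> p" "p \<le> 1" and F: "finite \<F>" "\<And>\<alpha>. \<alpha> \<in> \<F> \<Longrightarrow> \<alpha> \<subseteq> \<Omega>"
  shows "measure_pmf.expectation (edge_pmf \<Omega> p) (\<lambda>g. real (card {\<alpha> \<in> \<F>. \<alpha> \<subseteq> g})) = (\<Sum>\<alpha>\<in>\<F>. p ^ card \<alpha>)"
proof -
  have "measure_pmf.expectation (edge_pmf \<Omega> p) (\<lambda>g. real (card {\<alpha> \<in> \<F>. \<alpha> \<subseteq> g}))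
    = measure_pmf.expectation (edge_pmf \<Omega> p) (\<lambda>g. \<Sum>\<alpha>\<in>\<F>. indicator {g. \<alpha> \<subseteq> g} g)"
    using F(1) by (intro arg_cong[where f = "measure_pmf.expectation _"] ext)
      (simp add: indicator_def sum.If_cases Int_def)
  also have "\<dots> = (\<Sum>\<alpha>\<in>\<F>. measure_pmf.expectation (edge_pmf \<Omega> p) (indicator {g. \<alpha> \<subseteq> g}))"
    by (intro Bochner_Integration.integral_sum integrable_measure_pmf_finite finite_edge_pmf \<Omega>)
  also have "\<dots> = (\<Sum>\<alpha>\<in>\<F>. p ^ card \<alpha>)"
    using prob_edge_pmf[OF \<Omega> p] F(2) by (intro sum.cong) auto
  finally show ?thesis .
qed

text \<open>Markov's inequality. It serves where the exponent is bounded, so that a fixed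
  probability below 1 is enough.\<close>

lemma weak_tail_le:
  assumes \<Omega>: "finite \<Omega>" and p: "0 \<le> p" "p \<le> 1" and F: "finite \<F>" "\<And>\<alpha>. \<alpha> \<in> \<F> \<Longrightarrow> \<alpha> \<subseteq> \<Omega>"
    and \<eta>: "0 < \<eta>" and \<mu>: "\<mu> = (\<Sum>\<alpha>\<in>\<F>. p ^ card \<alpha>)"
  shows "measure_pmf.prob (edge_pmf \<Omega> p) {g. (1 + \<eta>) * \<mu> < real (card {\<alpha> \<in> \<F>. \<alpha> \<subseteq> g})} \<le> 1 / (1 + \<eta>)"
proof -
  let ?P = "measure_pmf.prob (edge_pmf \<Omega> p)"
  let ?X = "\<lambda>g. real (card {\<alpha> \<in> \<F>. \<alpha> \<subseteq> g})"
  have \<mu>0: "0 \<le> \<mu>" unfolding \<mu> using p by (intro sum_nonneg) auto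
  show "?P {g. (1 + \<eta>) * \<mu> < ?X g} \<le> 1 / (1 + \<eta>)"
  proof (cases "\<mu> = 0")
    case True
    \<comment> \<open>With mean 0 Markov's inequality would divide by zero; the union bound gives
      probability 0.\<close>
    have "?P {g. (1 + \<eta>) * \<mu> < ?X g} \<le> ?P (\<Union>\<alpha>\<in>\<F>. {g. \<alpha> \<subseteq> g})"
    proof (intro measure_pmf.finite_measure_mono subsetI)
      fix g assume "g \<in> {g. (1 + \<eta>) * \<mu> < ?X g}"
      then have "card {\<alpha> \<in> \<F>. \<alpha> \<subseteq> g} \<noteq> 0" using True by simp
      then have "{\<alpha> \<in> \<F>. \<alpha> \<subseteq> g} \<noteq> {}" by (intro notI) (simp only: card.empty)
      then show "g \<in> (\<Union>\<alpha>\<in>\<F>. {g. \<alpha> \<subseteq> g})" by auto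
    qed simp
    also have "\<dots> \<le> (\<Sum>\<alpha>\<in>\<F>. ?P {g. \<alpha> \<subseteq> g})"
      by (intro measure_pmf.finite_measure_subadditive_finite F) auto
    also have "\<dots> = \<mu>" unfolding \<mu> using prob_edge_pmf[OF \<Omega> p] F(2) by (intro sum.cong) auto
    finally show ?thesis using True \<eta> by (meson order_trans zero_le_divide_1_iff add_nonneg_nonneg less_imp_le zero_le_one)
  next
    case False
    then have x: "0 < (1 + \<eta>) * \<mu>" using \<mu>0 \<eta> by simp
    have "?P {g. (1 + \<eta>) * \<mu> < ?X g} \<le> ?P {g. (1 + \<eta>) * \<mu> \<le> ?X g}"
      by (intro measure_pmf.finite_measure_mono) auto
    also have "\<dots> \<le> measure_pmf.expectation (edge_pmf \<Omega> p) ?X / ((1 + \<eta>) * \<mu>)"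
      using integral_Markov_inequality_measure[of "edge_pmf \<Omega> p" ?X "{}" "(1 + \<eta>) * \<mu>"] x
        integrable_measure_pmf_finite[OF finite_edge_pmf[OF \<Omega>], of p ?X] by simp
    also have "\<dots> = 1 / (1 + \<eta>)"
      using False by (simp add: expectation_count[OF \<Omega> p F] \<mu>[symmetric])
    finally show ?thesis .
  qed
qed

lemma expected_cycles_ge:
  assumes V: "finite V" "l \<le> card V" and l: "1 \<le> l" and p: "0 \<le> p" "p \<le> (1::real)"
  shows "(1 / (real l)\<^sup>2) ^ l * (real (card V) * p) ^ l \<le> (\<Sum>\<alpha>\<in>cycles l V. p ^ card \<alpha>)"
proof -
  have "(1 / (real l)\<^sup>2) ^ l * (real (card V) * p) ^ l = (real (card V) / (real l)\<^sup>2) ^ l * p ^ l"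
    by (simp add: power_mult_distrib power_divide)
  also have "\<dots> \<le> real (card (cycles l V)) * p ^ l"
    using card_cycles_ge[OF V(1) l V(2)] p by (intro mult_right_mono) auto
  also have "\<dots> = (\<Sum>\<alpha>\<in>cycles l V. p ^ l)" by simp
  also have "\<dots> \<le> (\<Sum>\<alpha>\<in>cycles l V. p ^ card \<alpha>)"
    using p card_cycles_le by (intro sum_mono power_decreasing) auto
  finally show ?thesis .
qed

text \<open>For p bounded below the mean is of order m^l, while \<open>l * n\<close> edges, a small
  multiple of m^2, meet at most \<open>l * n * m ^ (l - 2)\<close> cycles. So no seed exists, and
  the family of cores is empty.\<close>

lemma dense_regime_tail:
  fixes p p0 \<eta> c1 :: real
  assumes V: "finite (V :: 'a set)" "l \<le> card V" and l: "3 \<le> l" and \<eta>: "0 < \<eta>"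
    and p: "0 < p0" "p0 \<le> p" "p \<le> 1" and \<mu>: "\<mu> = (\<Sum>\<alpha>\<in>cycles l V. p ^ card \<alpha>)"
    and c1: "0 \<le> c1" "c1 \<le> \<eta> * (1 / (real l)\<^sup>2) ^ l * p0 ^ l / (2 * real l)"
    and n: "real n \<le> c1 * ((real (card V) * p)\<^sup>2 * ln (1 / p))"
  shows "measure_pmf.prob (edge_pmf (all_edges V) p)
    {g. (1 + \<eta>) * \<mu> < real (card {\<alpha> \<in> cycles l V. \<alpha> \<subseteq> g})} \<le> ((1 + \<eta> / 2) / (1 + \<eta>)) ^ n"
proof -
  let ?F = "cycles l V"
  let ?\<Omega> = "all_edges V"
  let ?a = "(1 / (real l)\<^sup>2) ^ l"
  let ?m = "real (card V)"
  have fin: "finite ?\<Omega>" "finite ?F" using V finite_all_edges finite_cycles by auto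
  have pp: "0 < p" "0 \<le> p" using p by auto
  have m: "1 \<le> ?m" using V(2) l by simp
  have F: "\<alpha> \<subseteq> ?\<Omega> \<and> card \<alpha> \<le> l" if "\<alpha> \<in> ?F" for \<alpha>
    using that cycles_subset_all_edges card_cycles_le l by fastforce
  have \<mu>ge: "?a * (?m * p) ^ l \<le> \<mu>"
    unfolding \<mu> using expected_cycles_ge[OF V _ pp(2) p(3)] l by simp
  have "0 < ?a * (?m * p) ^ l" using l m pp by (intro mult_pos_pos zero_less_power) auto
  then have \<mu>0: "0 < \<mu>" using \<mu>ge by linarith
  have "\<not> seed ?F p ((1 + \<eta> / 2) * \<mu>) (l * n) S" if S: "S \<subseteq> ?\<Omega>" for S
  proof
    assume s: "seed ?F p ((1 + \<eta> / 2) * \<mu>) (l * n) S"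
    interpret edge_subset V S p by unfold_locales (use V S pp p in auto)
    have finS: "finite S" by (rule finI)
    have thr: "real (card {\<alpha> \<in> ?F. e \<in> \<alpha>}) \<le> ?m ^ (l - 2)" if e: "e \<in> S" for e
    proof -
      obtain u v where "e = {u, v}" using e S by (meson all_edgesE subsetD)
      then show ?thesis using card_through_le[OF l, of u v] e by (simp add: through_def[OF l])
    qed
    have "(\<Sum>\<alpha>\<in>?F. p ^ card (\<alpha> - S)) \<le> (\<Sum>\<alpha>\<in>?F. p ^ card \<alpha> + (\<Sum>e\<in>S. if e \<in> \<alpha> then 1 else 0))"
    proof (rule sum_mono)
      fix \<alpha>
      show "p ^ card (\<alpha> - S) \<le> p ^ card \<alpha> + (\<Sum>e\<in>S. if e \<in> \<alpha> then 1 else 0)"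
      proof (cases "\<alpha> \<inter> S = {}")
        case True
        then have "\<alpha> - S = \<alpha>" by auto
        then show ?thesis by (simp add: sum_nonneg)
      next
        case False
        then obtain e where e: "e \<in> S" "e \<in> \<alpha>" by auto
        have "p ^ card (\<alpha> - S) \<le> (if e \<in> \<alpha> then 1 else 0)" using e pp p by (simp add: power_le_one)
        also have "\<dots> \<le> (\<Sum>e\<in>S. if e \<in> \<alpha> then 1 else 0)"
          using e finS by (intro member_le_sum) auto
        finally show ?thesis using pp by (simp add: add_increasing)
      qed
    qed
    also have "\<dots> = \<mu> + (\<Sum>e\<in>S. \<Sum>\<alpha>\<in>?F. if e \<in> \<alpha> then 1 else 0)"
      unfolding sum.distrib \<mu> by (simp only: sum.swap[of _ ?F])
    also have "\<dots> = \<mu> + (\<Sum>e\<in>S. real (card {\<alpha> \<in> ?F. e \<in> \<alpha>}))"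
      using fin by (simp add: sum.If_cases Int_def)
    also have "\<dots> \<le> \<mu> + real (card S) * ?m ^ (l - 2)"
      using sum_mono[OF thr, of S] by simp
    also have "\<dots> \<le> \<mu> + real (l * n) * ?m ^ (l - 2)"
      using s m unfolding seed_def by (intro add_left_mono mult_right_mono of_nat_mono) auto
    \<comment> \<open>Since p^2 ln (1/p) <= p <= 1, \<open>n\<close> is at most c1 m^2, and c1 was
      chosen against p0^l.\<close>
    also have "\<dots> \<le> \<mu> + \<eta> / 2 * \<mu>"
    proof (rule add_left_mono)
      have "p\<^sup>2 * ln (1 / p) \<le> p\<^sup>2 * (1 / p)"
        using ln_le_minus_one[of "1 / p"] pp by (intro mult_left_mono) auto
      also have "\<dots> \<le> 1" using pp p by (simp add: power2_eq_square)
      finally have pl: "p\<^sup>2 * ln (1 / p) \<le> 1" .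
      have "c1 * ((?m * p)\<^sup>2 * ln (1 / p)) = c1 * ?m\<^sup>2 * (p\<^sup>2 * ln (1 / p))"
        by (simp add: power_mult_distrib)
      also have "\<dots> \<le> c1 * ?m\<^sup>2 * 1" using pl c1 by (intro mult_left_mono) auto
      finally have "real n \<le> c1 * ?m\<^sup>2" using n by simp
      then have "real (l * n) * ?m ^ (l - 2) \<le> real l * (c1 * ?m\<^sup>2) * ?m ^ (l - 2)"
        using m by (simp add: mult_left_mono mult_right_mono)
      also have "\<dots> = real l * c1 * (?m\<^sup>2 * ?m ^ (l - 2))" by simp
      also have "?m\<^sup>2 * ?m ^ (l - 2) = ?m ^ (2 + (l - 2))" by (simp only: power_add)
      also have "2 + (l - 2) = l" using l by simp
      also have "real l * c1 * ?m ^ l \<le> (\<eta> / 2 * (?a * p0 ^ l)) * ?m ^ l"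
        using c1(2) l m by (intro mult_right_mono) (auto simp: field_simps)
      also have "\<dots> = \<eta> / 2 * (?a * (?m * p0) ^ l)" by (simp add: power_mult_distrib)
      also have "\<dots> \<le> \<eta> / 2 * (?a * (?m * p) ^ l)"
        using \<eta> p m by (intro mult_left_mono power_mono) auto
      also have "\<dots> \<le> \<eta> / 2 * \<mu>" using \<mu>ge \<eta> by (intro mult_left_mono) auto
      finally show "real (l * n) * ?m ^ (l - 2) \<le> \<eta> / 2 * \<mu>" .
    qed
    finally show False using s unfolding seed_def by (simp add: algebra_simps)
  qed
  then have "measure_pmf.prob (edge_pmf ?\<Omega> p) {g. (1 + \<eta>) * \<mu> < real (card {\<alpha> \<in> ?F. \<alpha> \<subseteq> g})}
    \<le> ((1 + \<eta> / 2) * \<mu> / ((1 + \<eta>) * \<mu>)) ^ n + (\<Sum>I\<in>({} :: 'a set set set). p ^ card I)"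
    using \<mu>0 \<eta> p pp
    by (intro upper_tail_le[where l = l and \<Omega> = ?\<Omega>] finite_edge_pmf fin F prob_edge_pmf) auto
  then show ?thesis using \<mu>0 by simp
qed

text \<open>Verifies that the result of the deletion meets all hypotheses of
  \<open>cores_sum_le\<close>. Half of the excess \<eta> goes to the moment bound; of the other
  half, a quarter of \<eta> is lost in deletion and a quarter remains to force many edges.\<close>

lemma sparse_regime_tail:
  fixes p \<eta> c1 \<epsilon> H :: real
  assumes V: "finite V" "l \<le> card V" and l: "3 \<le> l" and \<eta>: "0 < \<eta>"
    and q_def: "q = real (card V) * p" and q1: "1 \<le> q"
    and p: "p = 1 / H ^ (12 * l\<^sup>2 * (2 * l + 5))" and \<mu>: "\<mu> = (\<Sum>\<alpha>\<in>cycles l V. p ^ card \<alpha>)"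
    and \<epsilon>: "0 < \<epsilon>" "2 * \<epsilon> \<le> 1" "(2 + 8 * 3 ^ (l - 1)) * \<epsilon> \<le> \<eta> / 4 * (1 / (real l)\<^sup>2) ^ l"
    and H: "4 \<le> H" "24 * (real l)\<^sup>2 * (2 * real l + 5) * ln H \<le> H" "exp (5 + 3 / \<epsilon>) \<le> H"
    and \<Lambda>: "\<Lambda> = min (q\<^sup>2 * ln (1 / p)) (q ^ l)" "0 < \<Lambda>"
    and c1: "0 \<le> c1" "c1 \<le> 1 / real l" "c1 \<le> \<eta> * (1 / (real l)\<^sup>2) ^ l / (16 * real l)"
    and n: "1 \<le> n" "real n \<le> c1 * \<Lambda>"
  shows "measure_pmf.prob (edge_pmf (all_edges V) p)
    {g. (1 + \<eta>) * \<mu> < real (card {\<alpha> \<in> cycles l V. \<alpha> \<subseteq> g})}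
    \<le> ((1 + \<eta> / 2) / (1 + \<eta>)) ^ n + 2 * exp (- (\<epsilon> * q\<^sup>2 * ln H))"
proof -
  let ?F = "cycles l V"
  let ?\<Omega> = "all_edges V"
  let ?a = "(1 / (real l)\<^sup>2) ^ l"
  let ?w = "\<lambda>I. \<Sum>\<alpha>\<in>?F. p ^ card (\<alpha> - I)"
  let ?S = "\<lambda>I e. \<Sum>\<alpha> | \<alpha> \<in> ?F \<and> e \<in> \<alpha>. p ^ card (\<alpha> - I)"
  have Hp: "0 < H" and H1: "1 \<le> H" using H by auto
  have fin: "finite ?\<Omega>" "finite ?F" using V finite_all_edges finite_cycles by auto
  have pp: "0 < p" "0 \<le> p" "p \<le> 1"
    using Hp one_le_power[OF H1, of "12 * l\<^sup>2 * (2 * l + 5)"] by (auto simp: p)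
  have F: "\<alpha> \<subseteq> ?\<Omega> \<and> card \<alpha> \<le> l" if "\<alpha> \<in> ?F" for \<alpha>
    using that cycles_subset_all_edges card_cycles_le l by fastforce
  have \<mu>ge: "?a * q ^ l \<le> \<mu>"
    unfolding \<mu> q_def using expected_cycles_ge[OF V _ pp(2,3)] l by simp
  have "0 < ?a * q ^ l" using l q1 by (intro mult_pos_pos zero_less_power) auto
  then have \<mu>0: "0 < \<mu>" using \<mu>ge by linarith
  have L: "2 * ln (1 / p) \<le> H"
    using H(2) Hp by (simp add: p ln_realpow)
  \<comment> \<open>So that \<open>l * n\<close> deletions cost exactly a quarter of \<eta>
    \<mu>.\<close>
  define \<tau> where "\<tau> = \<eta> / 4 * \<mu> / real (l * n)"
  have ln0: "0 < real (l * n)" using l n by simp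
  have \<tau>0: "0 \<le> \<tau>" using \<eta> \<mu>0 by (simp add: \<tau>_def)
  have lnl: "real (l * n) \<le> \<Lambda>"
  proof -
    have "real (l * n) \<le> real l * (c1 * \<Lambda>)" using n l by (simp add: mult_left_mono)
    also have "\<dots> \<le> real l * (1 / real l * \<Lambda>)"
      using c1 \<Lambda>(2) by (intro mult_left_mono mult_right_mono) auto
    finally show ?thesis using l by simp
  qed
  \<comment> \<open>The 16 in the bound on \<open>c1\<close> is the 4 from \<tau> times the 4 wanted
    here.\<close>
  have \<tau>ge: "4 * (q ^ l / \<Lambda>) \<le> \<tau>"
  proof -
    have "real (l * n) \<le> real l * (c1 * \<Lambda>)" using n l by (simp add: mult_left_mono)
    also have "\<dots> \<le> real l * (\<eta> * ?a / (16 * real l) * \<Lambda>)"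
      using c1 \<Lambda>(2) by (intro mult_left_mono mult_right_mono) auto
    also have "\<dots> = \<eta> * ?a / 16 * \<Lambda>" using l by simp
    finally have "4 * (q ^ l / \<Lambda>) * real (l * n) \<le> 4 * (q ^ l / \<Lambda>) * (\<eta> * ?a / 16 * \<Lambda>)"
      using q1 \<Lambda>(2) by (intro mult_left_mono) auto
    also have "\<dots> = \<eta> / 4 * (?a * q ^ l)" using \<Lambda>(2) by simp
    also have "\<dots> \<le> \<eta> / 4 * \<mu>" using \<mu>ge \<eta> by (intro mult_left_mono) auto
    finally show ?thesis unfolding \<tau>_def using ln0 by (subst le_divide_eq) auto
  qed
  \<comment> \<open>The two bounds come from the two terms of the minimum \<Lambda>, the second with
    ln (1/p) <= H.\<close>
  have \<tau>4: "4 \<le> \<tau>" "4 * (q ^ (l - 2) / H) \<le> \<tau>"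
  proof -
    have "\<Lambda> \<le> q ^ l" by (simp add: \<Lambda>(1))
    then have "1 \<le> q ^ l / \<Lambda>" using \<Lambda>(2) by (simp add: le_divide_eq)
    then show "4 \<le> \<tau>" using \<tau>ge by linarith
    have "\<Lambda> \<le> q\<^sup>2 * ln (1 / p)" by (simp add: \<Lambda>(1))
    also have "\<dots> \<le> q\<^sup>2 * H" using L Hp by (intro mult_left_mono) auto
    finally have "q ^ l / (q\<^sup>2 * H) \<le> q ^ l / \<Lambda>"
      using \<Lambda>(2) q1 Hp by (intro divide_left_mono) auto
    moreover have "l - 2 + 2 = l" using l by simp
    then have "q ^ l = q ^ (l - 2) * q\<^sup>2" using power_add[of q "l - 2" 2] by simp
    then have "q ^ l / (q\<^sup>2 * H) = q ^ (l - 2) / H" using q1 by simp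
    ultimately show "4 * (q ^ (l - 2) / H) \<le> \<tau>" using \<tau>ge by linarith
  qed
  define \<C> where "\<C> = {I. I \<subseteq> ?\<Omega> \<and> card I \<le> l * n \<and> (1 + \<eta> / 4) * \<mu> < ?w I \<and> (\<forall>e\<in>I. \<tau> \<le> ?S I e)}"
  have finC: "finite \<C>" by (rule finite_subset[of _ "Pow ?\<Omega>"]) (use fin in \<open>auto simp: \<C>_def\<close>)
  have "measure_pmf.prob (edge_pmf ?\<Omega> p) {g. (1 + \<eta>) * \<mu> < real (card {\<alpha> \<in> ?F. \<alpha> \<subseteq> g})}
    \<le> ((1 + \<eta> / 2) * \<mu> / ((1 + \<eta>) * \<mu>)) ^ n + (\<Sum>I\<in>\<C>. p ^ card I)"
  proof (intro upper_tail_le[where l = l and \<Omega> = ?\<Omega>] finite_edge_pmf fin F prob_edge_pmf finC)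
    fix S assume S: "S \<subseteq> ?\<Omega>" "seed ?F p ((1 + \<eta> / 2) * \<mu>) (l * n) S"
    have finS: "finite S" using S(1) fin finite_subset by blast
    have eq: "(1 + \<eta> / 2) * \<mu> - real (l * n) * \<tau> = (1 + \<eta> / 4) * \<mu>"
    proof -
      have "real (l * n) * \<tau> = \<eta> / 4 * \<mu>"
        unfolding \<tau>_def using ln0 by (simp del: of_nat_mult)
      then show ?thesis by (simp only:) (simp add: algebra_simps)
    qed
    obtain I where I: "I \<subseteq> S" "(1 + \<eta> / 4) * \<mu> < ?w I" "\<forall>e\<in>I. \<tau> \<le> ?w I - ?w (I - {e})"
      using seed_contains_core[OF finS S(2) \<tau>0] unfolding eq by blast
    have "card I \<le> l * n"
      using card_mono[OF finS I(1)] S(2) unfolding seed_def by linarith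
    moreover have "\<tau> \<le> ?S I e" if e: "e \<in> I" for e
    proof -
      have "?w I - ?w (I - {e}) \<le> ?S I e"
        by (rule weight_drop_le[OF fin(2) _ pp(2,3) e]) (use F fin finite_subset in blast)
      then show ?thesis using I(3) e by fastforce
    qed
    ultimately have "I \<in> \<C>" unfolding \<C>_def using I S(1) by blast
    then show "\<exists>I\<in>\<C>. I \<subseteq> S" using I(1) by blast
  qed (use \<mu>0 \<eta> pp in \<open>auto simp: \<C>_def\<close>)
  also have "\<dots> \<le> ((1 + \<eta> / 2) * \<mu> / ((1 + \<eta>) * \<mu>)) ^ n + 2 * exp (- (\<epsilon> * q\<^sup>2 * ln H))"
  proof (intro add_left_mono cores_sum_le[OF V(1) l q_def p q1 \<epsilon>(1) H])
    fix I assume I: "I \<in> \<C>"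
    have I': "I \<subseteq> ?\<Omega>" "card I \<le> l * n" "(1 + \<eta> / 4) * \<mu> < ?w I" using I by (auto simp: \<C>_def)
    have cI: "real (card I) \<le> \<Lambda>" using I'(2) lnl by (meson of_nat_le_iff order_trans)
    have "real (card I) \<le> q ^ l" using cI by (simp add: \<Lambda>(1))
    moreover have "2 * real (card I) \<le> H * q\<^sup>2"
    proof -
      have "2 * real (card I) \<le> 2 * (q\<^sup>2 * ln (1 / p))" using cI by (simp add: \<Lambda>(1))
      also have "\<dots> = q\<^sup>2 * (2 * ln (1 / p))" by simp
      also have "\<dots> \<le> q\<^sup>2 * H" using L by (intro mult_left_mono) auto
      finally show ?thesis by (simp only: mult.commute)
    qed
    moreover have "\<epsilon> * q\<^sup>2 \<le> real (card I)"
    proof (rule ccontr)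
      assume "\<not> ?thesis"
      then have k: "real (card I) \<le> \<epsilon> * q\<^sup>2" by simp
      interpret edge_subset V I p by unfold_locales (use V I' pp in auto)
      \<comment> \<open>So few edges cannot raise the weight by a quarter of \<eta> \<mu>, by the
        choice of \<epsilon>.\<close>
      have "?w I \<le> \<mu> + (2 + 8 * 3 ^ (l - 1)) * \<epsilon> * q ^ l"
        using weight_gain_le[OF l _ _ \<epsilon>(2)] k q1 unfolding \<mu> q_def by simp
      also have "\<dots> \<le> \<mu> + \<eta> / 4 * ?a * q ^ l"
        using \<epsilon>(3) q1 by (intro add_left_mono mult_right_mono) auto
      also have "\<dots> = \<mu> + \<eta> / 4 * (?a * q ^ l)" by simp
      also have "\<dots> \<le> \<mu> + \<eta> / 4 * \<mu>" using \<mu>ge \<eta> by (intro add_left_mono mult_left_mono) auto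
      finally show False using I'(3) by (simp add: algebra_simps)
    qed
    ultimately show "I \<subseteq> ?\<Omega> \<and> \<epsilon> * q\<^sup>2 \<le> real (card I) \<and> 2 * real (card I) \<le> H * q\<^sup>2 \<and> real (card I) \<le> q ^ l"
      using I'(1) by blast
  next
    fix I u v assume "I \<in> \<C>" "{u, v} \<in> I"
    then have "\<tau> \<le> ?S I {u, v}" by (auto simp: \<C>_def)
    then show "4 \<le> ?S I {u, v} \<and> 4 * (q ^ (l - 2) / H) \<le> ?S I {u, v}" using \<tau>4 by linarith
  qed
  finally show ?thesis using \<mu>0 by simp
qed

section \<open>Choice of constants and combination of the ranges\<close>

lemma mult_ln_le:
  fixes c x :: real
  assumes "0 \<le> c" "1 \<le> x" "4 * c\<^sup>2 \<le> x"
  shows "c * ln x \<le> x"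
proof -
  have s: "2 * c \<le> sqrt x"
    using assms by (intro real_le_rsqrt) (simp add: power_mult_distrib)
  have "ln x = 2 * ln (sqrt x)" using assms by (simp add: ln_sqrt)
  also have "\<dots> \<le> 2 * sqrt x" using ln_le_minus_one[of "sqrt x"] assms by simp
  finally have "c * ln x \<le> c * (2 * sqrt x)" using assms by (intro mult_left_mono) auto
  also have "\<dots> = 2 * c * sqrt x" by simp
  also have "\<dots> \<le> sqrt x * sqrt x" using s assms by (intro mult_right_mono) auto
  finally show ?thesis using assms by simp
qed

text \<open>Three ranges: \<Lambda> at most a constant K, by Markov; \<Lambda> larger with p >= p0;
  \<Lambda> larger with p < p0, where H is large. The last two give 3 exp (-c2 \<Lambda>), whose
  factor 3 is absorbed by halving c2.\<close>

lemma cycle_upper_tail: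
  fixes l :: nat and \<eta> :: real
  assumes l: "3 \<le> l" and \<eta>: "0 < \<eta>"
  shows "\<exists>c>0. \<forall>m p. 0 \<le> p \<and> p \<le> (1::real) \<longrightarrow>
    measure_pmf.prob (edge_pmf (all_edges {..<m::nat}) p)
      {g. (1 + \<eta>) * (\<Sum>\<alpha>\<in>cycles l {..<m}. p ^ card \<alpha>) < real (card {\<alpha> \<in> cycles l {..<m}. \<alpha> \<subseteq> g})}
    < exp (- c * min ((real m)\<^sup>2 * p\<^sup>2 * ln (1 / p)) (real m ^ l * p ^ l))"
proof -
  define a where "a = (1 / (real l)\<^sup>2) ^ l"
  have a: "0 < a" using l by (simp add: a_def)
  define \<epsilon> where "\<epsilon> = min (1 / 2) (\<eta> / 4 * a / (2 + 8 * 3 ^ (l - 1)))"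
  have b0: "(0::real) < 2 + 8 * 3 ^ (l - 1)" by (simp add: add_pos_pos)
  have \<epsilon>: "0 < \<epsilon>" "2 * \<epsilon> \<le> 1" using \<eta> a b0 by (auto simp: \<epsilon>_def)
  have "\<epsilon> \<le> \<eta> / 4 * a / (2 + 8 * 3 ^ (l - 1))" unfolding \<epsilon>_def by simp
  then have \<epsilon>b: "(2 + 8 * 3 ^ (l - 1)) * \<epsilon> \<le> \<eta> / 4 * a"
    by (simp only: pos_le_divide_eq[OF b0] mult.commute[of \<epsilon>])
  define J where "J = 12 * l\<^sup>2 * (2 * l + 5)"
  have J0: "0 < J" using l by (simp add: J_def)
  define b where "b = 24 * (real l)\<^sup>2 * (2 * real l + 5)"
  have b: "0 \<le> b" by (simp add: b_def)
  \<comment> \<open>The entry 4 b^2 ensures b ln H <= H for all H >= H0, by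
    \<open>mult_ln_le\<close>; the exponential absorbs the factors exp (O(k)) of the core
    counts.\<close>
  define H0 where "H0 = max 4 (max (4 * b\<^sup>2) (exp (5 + 3 / \<epsilon>)))"
  have H0: "4 \<le> H0" "4 * b\<^sup>2 \<le> H0" "exp (5 + 3 / \<epsilon>) \<le> H0" by (auto simp: H0_def)
  define p0 where "p0 = 1 / H0 ^ J"
  have p0: "0 < p0" using H0 by (simp add: p0_def)
  define c1 where "c1 = min (1 / real l) (min (\<eta> * a / (16 * real l)) (\<eta> * a * p0 ^ l / (2 * real l)))"
  have c1: "0 < c1" "c1 \<le> 1 / real l" "c1 \<le> \<eta> * a / (16 * real l)" "c1 \<le> \<eta> * a * p0 ^ l / (2 * real l)"
    using l \<eta> a p0 by (auto simp: c1_def)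
  define \<rho> where "\<rho> = (1 + \<eta> / 2) / (1 + \<eta>)"
  have \<rho>: "0 < \<rho>" "\<rho> < 1" using \<eta> by (auto simp: \<rho>_def)
  \<comment> \<open>The first entry serves \<rho>^n, as n >= c1 \<Lambda> / 2; the second serves the
    cores, as ln (1/p) = J ln H.\<close>
  define c2 where "c2 = min (c1 * - ln \<rho> / 2) (\<epsilon> / real J)"
  have c2: "0 < c2" "c2 \<le> c1 * - ln \<rho> / 2" "c2 \<le> \<epsilon> / real J"
    using c1(1) \<rho> \<epsilon> J0 by (auto simp: c2_def intro: mult_pos_neg)
  \<comment> \<open>Beyond K: c1 \<Lambda> > 1, so the moment order is at least 1; q > l, so the
    vertex set has at least l elements; and c2 \<Lambda> >= 4, so exp (c2 \<Lambda> / 2) >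
    3.\<close>
  define K where "K = max (1 / c1) (max (real l ^ l) (4 / c2))"
  have K: "1 / c1 \<le> K" "real l ^ l \<le> K" "4 / c2 \<le> K" by (auto simp: K_def)
  have K0: "0 < K" using K(1) c1(1) by (meson less_le_trans zero_less_divide_1_iff)
  \<comment> \<open>The 2 in the second entry makes the inequality strict in the Markov
    range.\<close>
  define c where "c = min (c2 / 2) (ln (1 + \<eta>) / (2 * K))"
  have c: "0 < c" "c \<le> c2 / 2" "c \<le> ln (1 + \<eta>) / (2 * K)" using c2(1) K0 \<eta> by (auto simp: c_def)
  show ?thesis
  proof (intro exI[of _ c] conjI allI impI c(1))
    fix m :: nat and p :: real
    assume p: "0 \<le> p \<and> p \<le> 1"
    let ?V = "{..<m}"
    let ?F = "cycles l ?V"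
    define \<mu> where "\<mu> = (\<Sum>\<alpha>\<in>?F. p ^ card \<alpha>)"
    let ?P = "measure_pmf.prob (edge_pmf (all_edges ?V) p) {g. (1 + \<eta>) * \<mu> < real (card {\<alpha> \<in> ?F. \<alpha> \<subseteq> g})}"
    define q where "q = real m * p"
    define \<Lambda> where "\<Lambda> = min (q\<^sup>2 * ln (1 / p)) (q ^ l)"
    have fin: "finite (all_edges ?V)" "finite ?F" using finite_all_edges finite_cycles by auto
    have F: "\<alpha> \<subseteq> all_edges ?V" if "\<alpha> \<in> ?F" for \<alpha>
      using cycles_subset_all_edges[OF that] l by auto
    have "?P < exp (- c * \<Lambda>)"
    proof (cases "\<Lambda> \<le> K")
      case True
      have "c * \<Lambda> \<le> c * K" using True c(1) by (intro mult_left_mono) auto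
      also have "\<dots> \<le> ln (1 + \<eta>) / (2 * K) * K" using c(3) K0 by (intro mult_right_mono) auto
      also have "\<dots> < ln (1 + \<eta>)" using K0 \<eta> by simp
      finally have "exp (- ln (1 + \<eta>)) < exp (- c * \<Lambda>)" by simp
      moreover have "exp (- ln (1 + \<eta>)) = 1 / (1 + \<eta>)" using \<eta> by (simp add: exp_minus inverse_eq_divide)
      moreover have "?P \<le> 1 / (1 + \<eta>)"
        using p by (intro weak_tail_le fin F \<eta> \<mu>_def) auto
      ultimately show ?thesis by linarith
    next
      case False
      then have \<Lambda>: "K < \<Lambda>" by simp
      then have \<Lambda>0: "0 < \<Lambda>" using K0 by simp
      have pp: "0 < p"
      proof (rule ccontr)
        assume "\<not> 0 < p"
        \<comment> \<open>At p = 0 also q = 0, so the first term of the minimum is 0 whatever value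
          \<open>ln (1 / 0)\<close> has.\<close>
        then have "q\<^sup>2 * ln (1 / p) = 0" using p by (simp add: q_def)
        then show False using \<Lambda>0 by (auto simp: \<Lambda>_def)
      qed
      have q0: "0 \<le> q" using p by (simp add: q_def)
      have "real l ^ l < q ^ l" using K(2) \<Lambda> by (simp add: \<Lambda>_def)
      then have lq: "real l < q" using power_less_imp_less_base[OF _ q0] by blast
      have "q \<le> real m" using p by (simp add: q_def mult_left_le)
      then have lm: "l \<le> card ?V" using lq by simp
      have q1: "1 \<le> q" using lq l by linarith
      define n where "n = nat \<lfloor>c1 * \<Lambda>\<rfloor>"
      have "1 < c1 * \<Lambda>" using K(1) \<Lambda> c1(1) by (metis le_less_trans mult.commute pos_divide_less_eq)
      then have n: "1 \<le> n" "real n \<le> c1 * \<Lambda>" "c1 * \<Lambda> - 1 \<le> real n"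
        unfolding n_def by linarith+
      then have n2: "c1 * \<Lambda> / 2 \<le> real n" by linarith
      have \<rho>n: "\<rho> ^ n \<le> exp (- (c2 * \<Lambda>))"
      proof -
        have "c2 * \<Lambda> \<le> (c1 * - ln \<rho> / 2) * \<Lambda>" using c2 \<Lambda>0 by (intro mult_right_mono) auto
        also have "\<dots> = (c1 * \<Lambda> / 2) * - ln \<rho>" by simp
        also have "\<dots> \<le> real n * - ln \<rho>" using n2 \<rho> by (intro mult_right_mono) auto
        finally have "exp (real n * ln \<rho>) \<le> exp (- (c2 * \<Lambda>))" by simp
        then show ?thesis using \<rho> by (simp add: exp_of_nat_mult)
      qed
      have "?P \<le> 3 * exp (- (c2 * \<Lambda>))"
      proof (cases "p0 \<le> p")
        case True
        have nn: "real n \<le> c1 * ((real (card ?V) * p)\<^sup>2 * ln (1 / p))"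
        proof -
          have "\<Lambda> \<le> (real (card ?V) * p)\<^sup>2 * ln (1 / p)" by (simp add: \<Lambda>_def q_def)
          then have "c1 * \<Lambda> \<le> c1 * ((real (card ?V) * p)\<^sup>2 * ln (1 / p))"
            using c1(1) by (intro mult_left_mono) auto
          then show ?thesis using n(2) by linarith
        qed
        have "?P \<le> \<rho> ^ n"
          unfolding \<rho>_def using p c1
          by (intro dense_regime_tail[OF _ lm l \<eta> p0 True _ \<mu>_def _ _ nn]) (auto simp: a_def)
        also have "\<dots> \<le> exp (- (c2 * \<Lambda>))" by (rule \<rho>n)
        also have "\<dots> \<le> 3 * exp (- (c2 * \<Lambda>))" by simp
        finally show ?thesis .
      next
        case False
        \<comment> \<open>Only p < p0 makes this root as large as H0.\<close>
        define H where "H = root J (1 / p)"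
        have HJ: "H ^ J = 1 / p" using pp J0 by (simp add: H_def)
        have HH: "H0 \<le> H"
        proof -
          have "H0 ^ J \<le> 1 / p"
            using False pp p0 H0 by (simp add: p0_def field_simps)
          then have "root J (H0 ^ J) \<le> root J (1 / p)" using J0 by (intro real_root_le_mono) auto
          then show ?thesis using J0 H0 by (simp add: H_def real_root_power_cancel)
        qed
        have pH: "p = 1 / H ^ J" by (simp add: HJ)
        have Hl: "b * ln H \<le> H" using b H0 HH by (intro mult_ln_le) auto
        have lnp: "ln (1 / p) = real J * ln H" using H0 HH by (simp add: HJ[symmetric] ln_realpow)
        have "?P \<le> \<rho> ^ n + 2 * exp (- (\<epsilon> * q\<^sup>2 * ln H))"
          unfolding \<rho>_def
        proof (rule sparse_regime_tail[where ?c1.0 = c1 and \<Lambda> = \<Lambda>])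
          show "p = 1 / H ^ (12 * l\<^sup>2 * (2 * l + 5))" using pH by (simp add: J_def)
          show "24 * (real l)\<^sup>2 * (2 * real l + 5) * ln H \<le> H" using Hl by (simp add: b_def)
          show "(2 + 8 * 3 ^ (l - 1)) * \<epsilon> \<le> \<eta> / 4 * (1 / (real l)\<^sup>2) ^ l" using \<epsilon>b by (simp add: a_def)
          show "c1 \<le> \<eta> * (1 / (real l)\<^sup>2) ^ l / (16 * real l)" using c1 by (simp add: a_def)
        qed (use l \<eta> \<epsilon> H0 HH c1 n lm q1 \<Lambda>0 in \<open>auto simp: q_def \<mu>_def \<Lambda>_def\<close>)
        also have "\<dots> \<le> exp (- (c2 * \<Lambda>)) + 2 * exp (- (c2 * \<Lambda>))"
        proof (intro add_mono mult_left_mono \<rho>n)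
          have "c2 * \<Lambda> \<le> \<epsilon> / real J * (q\<^sup>2 * ln (1 / p))"
            using c2 \<Lambda>0 by (intro mult_mono) (auto simp: \<Lambda>_def)
          also have "\<dots> = \<epsilon> * q\<^sup>2 * ln H" unfolding lnp using J0 by simp
          finally show "exp (- (\<epsilon> * q\<^sup>2 * ln H)) \<le> exp (- (c2 * \<Lambda>))" by simp
        qed simp
        finally show ?thesis by simp
      qed
      also have "\<dots> < exp (c2 * \<Lambda> / 2) * exp (- (c2 * \<Lambda>))"
      proof (rule mult_strict_right_mono)
        have "4 \<le> c2 * \<Lambda>"
          using K(3) \<Lambda> c2(1) by (metis le_less_trans less_imp_le mult.commute pos_divide_less_eq)
        then show "3 < exp (c2 * \<Lambda> / 2)"
        proof -
          assume *: "4 \<le> c2 * \<Lambda>"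
          have "(3::real) < 1 + 2 + 2\<^sup>2 / 2" by simp
          also have "\<dots> \<le> exp 2" using exp_lower_Taylor_quadratic[of 2] by simp
          also have "\<dots> \<le> exp (c2 * \<Lambda> / 2)" using * by simp
          finally show ?thesis .
        qed
      qed simp
      also have "\<dots> = exp (- (c2 / 2 * \<Lambda>))" by (simp add: exp_add[symmetric])
      also have "\<dots> \<le> exp (- c * \<Lambda>)" using c(2) \<Lambda>0 by (simp add: mult_right_mono)
      finally show ?thesis .
    qed
    then show "measure_pmf.prob (edge_pmf (all_edges {..<m}) p)
      {g. (1 + \<eta>) * (\<Sum>\<alpha>\<in>?F. p ^ card \<alpha>) < real (card {\<alpha> \<in> ?F. \<alpha> \<subseteq> g})}
      < exp (- c * min ((real m)\<^sup>2 * p\<^sup>2 * ln (1 / p)) (real m ^ l * p ^ l))"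
      by (simp add: \<mu>_def \<Lambda>_def q_def power_mult_distrib)
  qed
qed

theorem theorem1p2:
  fixes l :: nat and \<eta> :: real
  assumes "l \<ge> 3" and "\<eta> > 0"
  shows "\<exists>c>0. \<forall>m::nat. \<forall>p::real. m \<ge> 1 \<longrightarrow> 0 \<le> p \<longrightarrow> p \<le> 1 \<longrightarrow>
    measure_pmf.prob (random_graph m p)
      {G. real (num_cycles l G) >
          (1 + \<eta>) * measure_pmf.expectation (random_graph m p) (\<lambda>G. real (num_cycles l G))}
    < exp (- c * min ((real m)\<^sup>2 * p\<^sup>2 * ln (1 / p)) (real m ^ l * p ^ l))"
proof -
  obtain c where c: "0 < c" and tail: "\<And>m p. 0 \<le> p \<Longrightarrow> p \<le> (1::real) \<Longrightarrow>
    measure_pmf.prob (edge_pmf (all_edges {..<m::nat}) p)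
      {g. (1 + \<eta>) * (\<Sum>\<alpha>\<in>cycles l {..<m}. p ^ card \<alpha>) < real (card {\<alpha> \<in> cycles l {..<m}. \<alpha> \<subseteq> g})}
    < exp (- c * min ((real m)\<^sup>2 * p\<^sup>2 * ln (1 / p)) (real m ^ l * p ^ l))"
    using cycle_upper_tail[OF assms] by blast
  show ?thesis
  proof (intro exI[of _ c] conjI allI impI c)
    fix m :: nat and p :: real
    assume p: "0 \<le> p" "p \<le> 1"
    let ?\<Omega> = "all_edges {..<m}"
    let ?F = "cycles l {..<m}"
    have fin: "finite ?\<Omega>" "finite ?F" by (auto intro: finite_all_edges finite_cycles)
    have F: "\<alpha> \<subseteq> ?\<Omega>" if "\<alpha> \<in> ?F" for \<alpha>
      using cycles_subset_all_edges[OF that] assms(1) by auto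
    \<comment> \<open>The identity is claimed on the support only, where edges are genuine pairs;
      almost-sure equality then transfers both the expectation and the probability.\<close>
    have count: "num_cycles l ({..<m}, g) = card {\<alpha> \<in> ?F. \<alpha> \<subseteq> g}" if "g \<in> set_pmf (edge_pmf ?\<Omega> p)" for g
      using num_cycles_eq[OF assms(1)] set_edge_pmf that by blast
    have "measure_pmf.expectation (random_graph m p) (\<lambda>G. real (num_cycles l G))
      = measure_pmf.expectation (edge_pmf ?\<Omega> p) (\<lambda>g. real (num_cycles l ({..<m}, g)))"
      unfolding random_graph_eq by simp
    also have "\<dots> = measure_pmf.expectation (edge_pmf ?\<Omega> p) (\<lambda>g. real (card {\<alpha> \<in> ?F. \<alpha> \<subseteq> g}))"
      using count by (intro integral_cong_AE) (auto simp: AE_measure_pmf_iff)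
    also have "\<dots> = (\<Sum>\<alpha>\<in>?F. p ^ card \<alpha>)"
      by (rule expectation_count[OF fin(1) p fin(2) F])
    finally have E: "measure_pmf.expectation (random_graph m p) (\<lambda>G. real (num_cycles l G)) = (\<Sum>\<alpha>\<in>?F. p ^ card \<alpha>)" .
    have "measure_pmf.prob (random_graph m p) {G. x < real (num_cycles l G)}
      = measure_pmf.prob (edge_pmf ?\<Omega> p) {g. x < real (card {\<alpha> \<in> ?F. \<alpha> \<subseteq> g})}" for x
      unfolding random_graph_eq measure_map_pmf
      using count by (intro measure_pmf.finite_measure_eq_AE) (auto simp: AE_measure_pmf_iff)
    then show "measure_pmf.prob (random_graph m p)
      {G. real (num_cycles l G) >
          (1 + \<eta>) * measure_pmf.expectation (random_graph m p) (\<lambda>G. real (num_cycles l G))}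
      < exp (- c * min ((real m)\<^sup>2 * p\<^sup>2 * ln (1 / p)) (real m ^ l * p ^ l))"
      unfolding E using tail[OF p, of m] by simp
  qed
qed

end
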